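(* Let $(\mathcal{R},\partial,\int)$ be an integro-differential ring with constants $\mathcal{K}=\mathcal{C}$. Let $M=M_{\mathsf R}\oplus M_{\mathsf D}\oplus M_{\mathsf I}\oplus M_{\mathsf E}$ be the $\mathcal{K}$-bimodule and $\Sigma_{\mathrm{IDO}}$ the tensor reduction system on $\mathcal{K}\langle M\rangle$ defined in the context. Then every $t\in\mathcal{K}\langle M\rangle$ has a unique normal form $t\!\downarrow_{\Sigma_{\mathrm{IDO}}}\in\mathcal{K}\langle M\rangle$, which can be written as a $\mathcal{K}$-linear combination of pure tensors of the form $$\textstyle f\otimes\partial^{\otimes j},\quad f\otimes\int\otimes g,\quad f\otimes\mathrm{E}\otimes g\otimes\partial^{\otimes j},\quad\text{or}\quad f\otimes\mathrm{E}\otimes h\otimes\int\otimes g$$ where $j\in\mathbb{N}_0$, $f,g,h\in\int\mathcal{R}$, and each $f$ and $g$ may be absent. Moreover, $$\textstyle\mathcal{R}\langle\partial,\int,\mathrm{E}\rangle\cong\mathcal{K}\langle M\rangle_{\mathrm{irr}}$$ as $\mathcal{K}$-rings, where multiplication on $\mathcal{K}\langle M\rangle_{\mathrm{irr}}$ is defined by $s\cdot t:=(s\otimes t)\!\downarrow_{\Sigma_{\mathrm{IDO}}}$.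
   Context: Rings are unital, nonzero, not necessarily commutative. A derivation on $\mathcal{R}$ is an additive map $\partial$ with $\partial(fg)=(\partial f)g+f\,\partial g$; $\mathcal{C}=\{f:\partial f=0\}$ is the ring of constants. "$\mathcal{C}$-linear" means homomorphism of $\mathcal{C}$-bimodules. An integro-differential ring $(\mathcal{R},\partial,\int)$ is a differential ring with a $\mathcal{C}$-linear map $\int\colon\mathcal{R}\to\mathcal{R}$ satisfying $\partial\int f=f$. Its induced evaluation is $\mathrm{E}f:=f-\int\partial f\in\mathcal{C}$, and $\mathcal{R}=\mathcal{C}\oplus\int\mathcal{R}$ as $\mathcal{C}$-bimodules. Operator ring: $\mathcal{R}\langle\partial,\int,\mathrm{E}\rangle$ is the ring extension of $\mathcal{R}$ generated by indeterminates $\partial,\int,\mathrm{E}$ commuting with all elements of $\mathcal{C}$, subject to, for all $f\in\mathcal{R}$: $\partial\cdot f=f\cdot\partial+\partial f$, $\partial\cdot\int=1$, $\int\cdot\partial=1-\mathrm{E}$, $\partial\cdot f\cdot\mathrm{E}=\partial f\cdot\mathrm{E}$, $\int\cdot f\cdot\mathrm{E}=\int f\cdot\mathrm{E}$, $\mathrm{E}\cdot f\cdot\mathrm{E}=\mathrm{E}f\cdot\mathrm{E}$. Equivalently, it is the quotient of $\mathcal{K}\langle M\rangle$ (below) by the two-sided ideal generated by the corresponding tensor relations together with $1-\varepsilon$ and $f\otimes g-fg$ ($1,f,g\in M_{\mathsf R}$). Module: $M_{\mathsf R}:=\mathcal{R}=M_{\mathsf K}\oplus M_{\tilde{\mathsf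 R}}$ with $M_{\mathsf K}:=\mathcal{K}$ and $M_{\tilde{\mathsf R}}:=\int\mathcal{R}$; $M_{\mathsf D}:=\mathcal{K}\partial$, $M_{\mathsf I}:=\mathcal{K}\int$, $M_{\mathsf E}:=\mathcal{K}\mathrm{E}$ are free left $\mathcal{K}$-modules on the symbols $\partial,\int,\mathrm{E}$, made into bimodules by $(c\,s)\cdot d=cd\,s$ for $c,d\in\mathcal{K}$ and $s$ the symbol. The tensor ring is $\mathcal{K}\langle M\rangle=\bigoplus_{n\ge0}M^{\otimes n}$ (bimodule tensor products over $\mathcal{K}$, $M^{\otimes0}=\mathcal{K}\varepsilon$, with $\varepsilon$ the empty tensor, multiplication $\otimes$). A $\mathcal{K}$-ring is a ring that is a $\mathcal{K}$-bimodule with $(xy)z=x(yz)$ for all $x,y,z$ in the ring or $\mathcal{K}$. Words: $X=\{\mathsf K,\tilde{\mathsf R},\mathsf D,\mathsf I,\mathsf E\}$, $Z=X\cup\{\mathsf R\}$; for a word $W=w_1\cdots w_n$ over $Z$, $M_W:=M_{w_1}\otimes\dots\otimes M_{w_n}$. The specializations of $W$ are the words over $X$ obtained by replacing each letter $\mathsf R$ by $\mathsf K$ or $\tilde{\mathsf R}$. Reductions: a reduction rule is a pair $(W,h)$ with a $\mathcal{K}$-bimodule homomorphism $h\colon M_W\to\mathcal{K}\langle M\rangle$; it reduces $a\otimes w\otimes b$ to $a\otimes h(w)\otimes b$ for $w\in M_W$, $a\in M_A$, $b\in M_B$ with words $A,B$ (and a sum of tensors by reducing a summand). For a set $\Sigma$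 of rules, $t$ can be reduced to $s$ if $s$ arises from $t$ by finitely many (possibly zero) such steps. A word over $X$ is irreducible if it contains no subword that is a specialization of a word $W$ with $(W,h)\in\Sigma$; $\mathcal{K}\langle M\rangle_{\mathrm{irr}}:=\bigoplus M_W$ over all irreducible words $W$ over $X$. A normal form of $t$ is an element of $\mathcal{K}\langle M\rangle_{\mathrm{irr}}$ to which $t$ can be reduced; if unique it is denoted $t\!\downarrow_\Sigma$. $\Sigma_{\mathrm{IDO}}$ consists of the rules (for $f,g\in\mathcal{R}$): $\mathsf K$: $1\mapsto\varepsilon$; $\mathsf{RR}$: $f\otimes g\mapsto fg$; $\mathsf{DR}$: $\partial\otimes f\mapsto f\otimes\partial+\partial f$; $\mathsf{DE}$: $\partial\otimes\mathrm{E}\mapsto0$; $\mathsf{DI}$: $\partial\otimes\int\mapsto\varepsilon$; $\mathsf{ERE}$: $\mathrm{E}\otimes f\otimes\mathrm{E}\mapsto(\mathrm{E}f)\mathrm{E}$; $\mathsf{EE}$: $\mathrm{E}\otimes\mathrm{E}\mapsto\mathrm{E}$; $\mathsf{EI}$: $\mathrm{E}\otimes\int\mapsto0$; $\mathsf{IRD}$: $\int\otimes f\otimes\partial\mapsto f-\mathrm{E}\otimes f-\int\otimes\partial f$; $\mathsf{IRE}$: $\int\otimes f\otimes\mathrm{E}\mapsto\int f\otimes\mathrm{E}$; $\mathsf{IRI}$: $\int\otimes f\otimes\int\mapsto\int f\otimes\int-\mathrm{E}\otimes\int f\otimes\int-\int\otimes\int f$; $\mathsf{ID}$: $\int\otimes\partial\mapsto\varepsilon-\mathrm{E}$;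 $\mathsf{IE}$: $\int\otimes\mathrm{E}\mapsto\int1\otimes\mathrm{E}$; $\mathsf{II}$: $\int\otimes\int\mapsto\int1\otimes\int-\mathrm{E}\otimes\int1\otimes\int-\int\otimes\int1$. Here $\partial f,\int f,\mathrm{E}f,\int1$ denote elements of $\mathcal{R}=M_{\mathsf R}$ (resp. $\mathcal{K}$), while isolated $\partial,\int,\mathrm{E}$ denote the symbols. *)

theory Defs
  imports
    "HOL-Algebra.QuotRing"
    "HOL-Algebra.Free_Abelian_Groups"
    "HOL-Library.FuncSet"
    "HOL-Library.Product_Plus"
    "HOL-Library.Sublist"
begin

section \<open>Integro-differential rings\<close>

text \<open>The base ring is a type of class \<^class>\<open>ring_1\<close>: unital, nonzero, not necessarily
  commutative.\<close>

definition derivation :: "('a::ring_1 \<Rightarrow> 'a) \<Rightarrow> bool" where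
  "derivation d \<longleftrightarrow>
     (\<forall>f g. d (f + g) = d f + d g) \<and> (\<forall>f g. d (f * g) = d f * g + f * d g)"

definition constants :: "('a::ring_1 \<Rightarrow> 'a) \<Rightarrow> 'a set" where
  "constants d = {f. d f = 0}"

definition integro_differential_ring :: "('a::ring_1 \<Rightarrow> 'a) \<Rightarrow> ('a \<Rightarrow> 'a) \<Rightarrow> bool" where
  "integro_differential_ring d J \<longleftrightarrow>
     derivation d \<and>
     (\<forall>f g. J (f + g) = J f + J g) \<and>
     (\<forall>c \<in> constants d. \<forall>f. J (c * f) = c * J f \<and> J (f * c) = J f * c) \<and>
     (\<forall>f. d (J f) = f)"

definition evaluation :: "('a::ring_1 \<Rightarrow> 'a) \<Rightarrow> ('a \<Rightarrow> 'a) \<Rightarrow> 'a \<Rightarrow> 'a" where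
  "evaluation d J f = f - J (d f)"

section \<open>The tensor ring of a bimodule\<close>

text \<open>Let \<open>K\<close> be a subring of the ring \<open>'k\<close> and \<open>M\<close> a \<open>K\<close>-bimodule with actions \<open>l\<close> (left)
  and \<open>r\<close> (right, \<open>r m c\<close> being \<open>m\<close> times \<open>c\<close>).  A pair \<open>(c, [m\<^sub>1, \<dots>, m\<^sub>n])\<close> stands for the
  pure tensor \<open>c \<epsilon> \<otimes> m\<^sub>1 \<otimes> \<dots> \<otimes> m\<^sub>n\<close>.  The direct sum of all tensor powers is the free
  abelian group on these pairs modulo additivity in each factor and balancedness over \<open>K\<close>.
  As these relations preserve \<open>n\<close>, the quotient is the direct sum over \<open>n\<close> of
  \<open>K \<otimes> M \<otimes> \<dots> \<otimes> M\<close> (tensor products over \<open>K\<close>), that is of \<open>K\<close> for \<open>n = 0\<close> and of the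
  \<open>n\<close>-th tensor power of \<open>M\<close> for \<open>n \<ge> 1\<close>.\<close>

definition tensor_words :: "'k set \<Rightarrow> 'm set \<Rightarrow> ('k \<times> 'm list) set" where
  "tensor_words K M = K \<times> lists M"

fun tensor_word_mult ::
    "('m \<Rightarrow> 'k \<Rightarrow> 'm) \<Rightarrow> 'k::ring_1 \<times> 'm list \<Rightarrow> 'k \<times> 'm list \<Rightarrow> 'k \<times> 'm list" where
  "tensor_word_mult r (c, xs) (e, ys) =
     (if xs = [] then (c * e, ys) else (c, butlast xs @ [r (last xs) e] @ ys))"

definition free_tensor_ring ::
    "'k::ring_1 set \<Rightarrow> 'm set \<Rightarrow> ('m \<Rightarrow> 'k \<Rightarrow> 'm) \<Rightarrow> (('k \<times> 'm list) \<Rightarrow>\<^sub>0 int) ring" where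
  "free_tensor_ring K M r =
     \<lparr>carrier = {p. Poly_Mapping.keys p \<subseteq> tensor_words K M},
      mult = (\<lambda>p q. frag_extend (\<lambda>u. frag_extend (\<lambda>v. frag_of (tensor_word_mult r u v)) q) p),
      one = frag_of (1, []), ring.zero = 0, ring.add = (+)\<rparr>"

definition tensor_relations ::
    "'k::ring_1 set \<Rightarrow> 'm::ab_group_add set \<Rightarrow> ('k \<Rightarrow> 'm \<Rightarrow> 'm) \<Rightarrow> ('m \<Rightarrow> 'k \<Rightarrow> 'm) \<Rightarrow>
     (('k \<times> 'm list) \<Rightarrow>\<^sub>0 int) set" where
  "tensor_relations K M l r =
     {frag_of (c + c', xs) - frag_of (c, xs) - frag_of (c', xs) | c c' xs.
        c \<in> K \<and> c' \<in> K \<and> xs \<in> lists M} \<union>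
     {frag_of (c, xs @ [m + m'] @ ys) - frag_of (c, xs @ [m] @ ys) - frag_of (c, xs @ [m'] @ ys)
        | c xs m m' ys. c \<in> K \<and> xs \<in> lists M \<and> m \<in> M \<and> m' \<in> M \<and> ys \<in> lists M} \<union>
     {frag_of (c * e, [m] @ ys) - frag_of (c, [l e m] @ ys) | c e m ys.
        c \<in> K \<and> e \<in> K \<and> m \<in> M \<and> ys \<in> lists M} \<union>
     {frag_of (c, xs @ [r m e, m'] @ ys) - frag_of (c, xs @ [m, l e m'] @ ys) | c e xs m m' ys.
        c \<in> K \<and> e \<in> K \<and> xs \<in> lists M \<and> m \<in> M \<and> m' \<in> M \<and> ys \<in> lists M}"

text \<open>The subgroup generated by the relations is a two-sided ideal of the ring of formal
  combinations, so that the product of the quotient is the concatenation of tensors.\<close>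

definition tensor_kernel ::
    "'k::ring_1 set \<Rightarrow> 'm::ab_group_add set \<Rightarrow> ('k \<Rightarrow> 'm \<Rightarrow> 'm) \<Rightarrow> ('m \<Rightarrow> 'k \<Rightarrow> 'm) \<Rightarrow>
     (('k \<times> 'm list) \<Rightarrow>\<^sub>0 int) set" where
  "tensor_kernel K M l r =
     generate (free_Abelian_group (tensor_words K M)) (tensor_relations K M l r)"

definition tensor_ring ::
    "'k::ring_1 set \<Rightarrow> 'm::ab_group_add set \<Rightarrow> ('k \<Rightarrow> 'm \<Rightarrow> 'm) \<Rightarrow> ('m \<Rightarrow> 'k \<Rightarrow> 'm) \<Rightarrow>
     (('k \<times> 'm list) \<Rightarrow>\<^sub>0 int) set ring" where
  "tensor_ring K M l r = free_tensor_ring K M r Quot tensor_kernel K M l r"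

definition tensor ::
    "'k::ring_1 set \<Rightarrow> 'm::ab_group_add set \<Rightarrow> ('k \<Rightarrow> 'm \<Rightarrow> 'm) \<Rightarrow> ('m \<Rightarrow> 'k \<Rightarrow> 'm) \<Rightarrow>
     'k \<Rightarrow> 'm list \<Rightarrow> (('k \<times> 'm list) \<Rightarrow>\<^sub>0 int) set" where
  "tensor K M l r c ms = tensor_kernel K M l r +>\<^bsub>free_tensor_ring K M r\<^esub> frag_of (c, ms)"

section \<open>Rings over a ring of scalars\<close>

definition K_ring ::
    "'k::ring_1 set \<Rightarrow> ('b, 'c) ring_scheme \<Rightarrow> ('k \<Rightarrow> 'b \<Rightarrow> 'b) \<Rightarrow> ('b \<Rightarrow> 'k \<Rightarrow> 'b) \<Rightarrow> bool" where
  "K_ring K A l r \<longleftrightarrow>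
     ring A \<and> \<one>\<^bsub>A\<^esub> \<noteq> \<zero>\<^bsub>A\<^esub> \<and>
     (\<forall>c \<in> K. \<forall>x \<in> carrier A. l c x \<in> carrier A \<and> r x c \<in> carrier A) \<and>
     (\<forall>c \<in> K. \<forall>x \<in> carrier A. \<forall>y \<in> carrier A.
        l c (x \<oplus>\<^bsub>A\<^esub> y) = l c x \<oplus>\<^bsub>A\<^esub> l c y \<and> r (x \<oplus>\<^bsub>A\<^esub> y) c = r x c \<oplus>\<^bsub>A\<^esub> r y c) \<and>
     (\<forall>c \<in> K. \<forall>e \<in> K. \<forall>x \<in> carrier A.
        l (c + e) x = l c x \<oplus>\<^bsub>A\<^esub> l e x \<and> r x (c + e) = r x c \<oplus>\<^bsub>A\<^esub> r x e \<and>
        l (c * e) x = l c (l e x) \<and> r x (c * e) = r (r x c) e \<and>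
        r (l c x) e = l c (r x e)) \<and>
     (\<forall>x \<in> carrier A. l 1 x = x \<and> r x 1 = x) \<and>
     (\<forall>c \<in> K. \<forall>x \<in> carrier A. \<forall>y \<in> carrier A.
        l c (x \<otimes>\<^bsub>A\<^esub> y) = l c x \<otimes>\<^bsub>A\<^esub> y \<and>
        r x c \<otimes>\<^bsub>A\<^esub> y = x \<otimes>\<^bsub>A\<^esub> l c y \<and>
        r (x \<otimes>\<^bsub>A\<^esub> y) c = x \<otimes>\<^bsub>A\<^esub> r y c)"

definition K_ring_isomorphic ::
    "'k::ring_1 set \<Rightarrow>
     ('b, 'c) ring_scheme \<Rightarrow> ('k \<Rightarrow> 'b \<Rightarrow> 'b) \<Rightarrow> ('b \<Rightarrow> 'k \<Rightarrow> 'b) \<Rightarrow>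
     ('e, 'f) ring_scheme \<Rightarrow> ('k \<Rightarrow> 'e \<Rightarrow> 'e) \<Rightarrow> ('e \<Rightarrow> 'k \<Rightarrow> 'e) \<Rightarrow> bool" where
  "K_ring_isomorphic K A l r A' l' r' \<longleftrightarrow>
     K_ring K A l r \<and> K_ring K A' l' r' \<and>
     (\<exists>\<phi> \<in> ring_iso A A'. \<forall>c \<in> K. \<forall>x \<in> carrier A.
        \<phi> (l c x) = l' c (\<phi> x) \<and> \<phi> (r x c) = r' (\<phi> x) c)"

section \<open>The bimodule of the operator ring and its tensor ring\<close>

text \<open>The quadruple \<open>(f, a, b, c)\<close> stands for the element \<open>f + a \<partial> + b \<integral> + c E\<close>
  of \<open>M\<^sub>R \<oplus> M\<^sub>D \<oplus> M\<^sub>I \<oplus> M\<^sub>E\<close>, where \<open>a, b, c\<close> are constants.\<close>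

type_synonym 'a ido = "'a \<times> 'a \<times> 'a \<times> 'a"

type_synonym 'a ido_tensor = "(('a \<times> 'a ido list) \<Rightarrow>\<^sub>0 int) set"

definition ido_module :: "('a::ring_1 \<Rightarrow> 'a) \<Rightarrow> 'a ido set" where
  "ido_module d = UNIV \<times> constants d \<times> constants d \<times> constants d"

fun ido_lact :: "'a::ring_1 \<Rightarrow> 'a ido \<Rightarrow> 'a ido" where
  "ido_lact c (f, x, y, z) = (c * f, c * x, c * y, c * z)"

fun ido_ract :: "'a::ring_1 ido \<Rightarrow> 'a \<Rightarrow> 'a ido" where
  "ido_ract (f, x, y, z) c = (f * c, x * c, y * c, z * c)"

definition emb :: "'a::ring_1 \<Rightarrow> 'a ido" where "emb f = (f, 0, 0, 0)"
definition symD :: "'a::ring_1 ido" where "symD = (0, 1, 0, 0)"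
definition symI :: "'a::ring_1 ido" where "symI = (0, 0, 1, 0)"
definition symE :: "'a::ring_1 ido" where "symE = (0, 0, 0, 1)"

abbreviation TR :: "('a::ring_1 \<Rightarrow> 'a) \<Rightarrow> 'a ido_tensor ring" where
  "TR d \<equiv> tensor_ring (constants d) (ido_module d) ido_lact ido_ract"

abbreviation scaled_tensor :: "('a::ring_1 \<Rightarrow> 'a) \<Rightarrow> 'a \<Rightarrow> 'a ido list \<Rightarrow> 'a ido_tensor" where
  "scaled_tensor d \<equiv> tensor (constants d) (ido_module d) ido_lact ido_ract"

abbreviation pure_tensor :: "('a::ring_1 \<Rightarrow> 'a) \<Rightarrow> 'a ido list \<Rightarrow> 'a ido_tensor" where
  "pure_tensor d \<equiv> scaled_tensor d 1"

definition TR_lact :: "('a::ring_1 \<Rightarrow> 'a) \<Rightarrow> 'a \<Rightarrow> 'a ido_tensor \<Rightarrow> 'a ido_tensor" where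
  "TR_lact d c t = scaled_tensor d c [] \<otimes>\<^bsub>TR d\<^esub> t"

definition TR_ract :: "('a::ring_1 \<Rightarrow> 'a) \<Rightarrow> 'a ido_tensor \<Rightarrow> 'a \<Rightarrow> 'a ido_tensor" where
  "TR_ract d t c = t \<otimes>\<^bsub>TR d\<^esub> scaled_tensor d c []"

definition left_span :: "('a::ring_1 \<Rightarrow> 'a) \<Rightarrow> 'a ido_tensor set \<Rightarrow> 'a ido_tensor set" where
  "left_span d S = generate (add_monoid (TR d)) {TR_lact d c x | c x. c \<in> constants d \<and> x \<in> S}"

section \<open>Words\<close>

text \<open>\<open>LRt\<close> is the letter for the complement \<open>J\<close>(\<open>R\<close>) of the constants, \<open>LR\<close> is the additional
  letter for the whole ring.\<close>

datatype letter = LK | LRt | LD | LI | LE | LR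

definition base_letters :: "letter set" where
  "base_letters = {LK, LRt, LD, LI, LE}"

fun component :: "('a::ring_1 \<Rightarrow> 'a) \<Rightarrow> ('a \<Rightarrow> 'a) \<Rightarrow> letter \<Rightarrow> 'a ido set" where
  "component d J LK = emb ` constants d"
| "component d J LRt = emb ` range J"
| "component d J LD = (\<lambda>c. ido_lact c symD) ` constants d"
| "component d J LI = (\<lambda>c. ido_lact c symI) ` constants d"
| "component d J LE = (\<lambda>c. ido_lact c symE) ` constants d"
| "component d J LR = range emb"

text \<open>The tensor product \<open>M\<^sub>W\<close> as a subgroup of the tensor ring.  Since all components are
  direct summands of the bimodule, the tensor product of the components along \<open>W\<close> embeds into the
  corresponding tensor power.  The empty word gives \<open>K \<epsilon>\<close>.\<close>

definition word_module ::
    "('a::ring_1 \<Rightarrow> 'a) \<Rightarrow> ('a \<Rightarrow> 'a) \<Rightarrow> letter list \<Rightarrow> 'a ido_tensor set" where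
  "word_module d J W =
     generate (add_monoid (TR d))
       {scaled_tensor d c ms | c ms.
          c \<in> constants d \<and> list_all2 (\<lambda>m w. m \<in> component d J w) ms W}"

definition specializations :: "letter list \<Rightarrow> letter list set" where
  "specializations W = {V. list_all2 (\<lambda>v w. if w = LR then v \<in> {LK, LRt} else v = w) V W}"

section \<open>Tensor reduction systems\<close>

text \<open>A rule is a pair \<open>(W, h)\<close>, where \<open>h\<close> is a bimodule homomorphism on \<open>M\<^sub>W\<close>.  In HOL,
  \<open>h\<close> is a total function, of which only the values on \<open>M\<^sub>W\<close> matter; it is required to be
  \<^const>\<open>extensional\<close> to make it unique.\<close>

type_synonym 'a rule = "letter list \<times> ('a ido_tensor \<Rightarrow> 'a ido_tensor)"

definition bimodule_hom ::
    "('a::ring_1 \<Rightarrow> 'a) \<Rightarrow> 'a ido_tensor set \<Rightarrow> ('a ido_tensor \<Rightarrow> 'a ido_tensor) \<Rightarrow> bool" where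
  "bimodule_hom d S h \<longleftrightarrow>
     h \<in> S \<rightarrow>\<^sub>E carrier (TR d) \<and>
     (\<forall>x \<in> S. \<forall>y \<in> S. h (x \<oplus>\<^bsub>TR d\<^esub> y) = h x \<oplus>\<^bsub>TR d\<^esub> h y) \<and>
     (\<forall>c \<in> constants d. \<forall>x \<in> S.
        h (TR_lact d c x) = TR_lact d c (h x) \<and> h (TR_ract d x c) = TR_ract d (h x) c)"

definition reduction_step ::
    "('a::ring_1 \<Rightarrow> 'a) \<Rightarrow> ('a \<Rightarrow> 'a) \<Rightarrow> 'a rule set \<Rightarrow> ('a ido_tensor \<times> 'a ido_tensor) set" where
  "reduction_step d J \<Sigma> =
     {(u \<oplus>\<^bsub>TR d\<^esub> (a \<otimes>\<^bsub>TR d\<^esub> w \<otimes>\<^bsub>TR d\<^esub> b), u \<oplus>\<^bsub>TR d\<^esub> (a \<otimes>\<^bsub>TR d\<^esub> h w \<otimes>\<^bsub>TR d\<^esub> b))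
        | u a w b W h A B.
          (W, h) \<in> \<Sigma> \<and> u \<in> carrier (TR d) \<and>
          a \<in> word_module d J A \<and> w \<in> word_module d J W \<and> b \<in> word_module d J B}"

definition irreducible_word :: "'a rule set \<Rightarrow> letter list \<Rightarrow> bool" where
  "irreducible_word \<Sigma> V \<longleftrightarrow>
     V \<in> lists base_letters \<and> (\<forall>(W, h) \<in> \<Sigma>. \<forall>U \<in> specializations W. \<not> sublist U V)"

definition irr :: "('a::ring_1 \<Rightarrow> 'a) \<Rightarrow> ('a \<Rightarrow> 'a) \<Rightarrow> 'a rule set \<Rightarrow> 'a ido_tensor set" where
  "irr d J \<Sigma> =
     generate (add_monoid (TR d)) (\<Union>V \<in> {V. irreducible_word \<Sigma> V}. word_module d J V)"

definition normal_form ::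
    "('a::ring_1 \<Rightarrow> 'a) \<Rightarrow> ('a \<Rightarrow> 'a) \<Rightarrow> 'a rule set \<Rightarrow> 'a ido_tensor \<Rightarrow> 'a ido_tensor \<Rightarrow> bool" where
  "normal_form d J \<Sigma> t s \<longleftrightarrow> s \<in> irr d J \<Sigma> \<and> (t, s) \<in> (reduction_step d J \<Sigma>)\<^sup>*"

definition nf ::
    "('a::ring_1 \<Rightarrow> 'a) \<Rightarrow> ('a \<Rightarrow> 'a) \<Rightarrow> 'a rule set \<Rightarrow> 'a ido_tensor \<Rightarrow> 'a ido_tensor" where
  "nf d J \<Sigma> t = (THE s. normal_form d J \<Sigma> t s)"

definition irr_ring ::
    "('a::ring_1 \<Rightarrow> 'a) \<Rightarrow> ('a \<Rightarrow> 'a) \<Rightarrow> 'a rule set \<Rightarrow> 'a ido_tensor ring" where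
  "irr_ring d J \<Sigma> =
     \<lparr>carrier = irr d J \<Sigma>, mult = (\<lambda>s t. nf d J \<Sigma> (s \<otimes>\<^bsub>TR d\<^esub> t)),
      one = \<one>\<^bsub>TR d\<^esub>, ring.zero = \<zero>\<^bsub>TR d\<^esub>, ring.add = (\<oplus>\<^bsub>TR d\<^esub>)\<rparr>"

section \<open>The reduction system for integro-differential operators\<close>

definition rules_with ::
    "('a::ring_1 \<Rightarrow> 'a) \<Rightarrow> ('a \<Rightarrow> 'a) \<Rightarrow> letter list \<Rightarrow> (('a ido_tensor \<Rightarrow> 'a ido_tensor) \<Rightarrow> bool) \<Rightarrow>
     'a rule set" where
  "rules_with d J W P = {(W, h) | h. bimodule_hom d (word_module d J W) h \<and> P h}"

text \<open>In each case, the bimodule \<open>M\<^sub>W\<close> is generated by the tensors at which \<open>h\<close> is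
  prescribed, so every word below contributes exactly one rule.\<close>

definition ido_rules :: "('a::ring_1 \<Rightarrow> 'a) \<Rightarrow> ('a \<Rightarrow> 'a) \<Rightarrow> 'a rule set" where
  "ido_rules d J =
     rules_with d J [LK] (\<lambda>h.
       h (pure_tensor d [emb 1]) = \<one>\<^bsub>TR d\<^esub>) \<union>
     rules_with d J [LR, LR] (\<lambda>h. \<forall>f g.
       h (pure_tensor d [emb f, emb g]) = pure_tensor d [emb (f * g)]) \<union>
     rules_with d J [LD, LR] (\<lambda>h. \<forall>f.
       h (pure_tensor d [symD, emb f]) =
         pure_tensor d [emb f, symD] \<oplus>\<^bsub>TR d\<^esub> pure_tensor d [emb (d f)]) \<union>
     rules_with d J [LD, LE] (\<lambda>h.
       h (pure_tensor d [symD, symE]) = \<zero>\<^bsub>TR d\<^esub>) \<union>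
     rules_with d J [LD, LI] (\<lambda>h.
       h (pure_tensor d [symD, symI]) = \<one>\<^bsub>TR d\<^esub>) \<union>
     rules_with d J [LE, LR, LE] (\<lambda>h. \<forall>f.
       h (pure_tensor d [symE, emb f, symE]) =
         pure_tensor d [ido_lact (evaluation d J f) symE]) \<union>
     rules_with d J [LE, LE] (\<lambda>h.
       h (pure_tensor d [symE, symE]) = pure_tensor d [symE]) \<union>
     rules_with d J [LE, LI] (\<lambda>h.
       h (pure_tensor d [symE, symI]) = \<zero>\<^bsub>TR d\<^esub>) \<union>
     rules_with d J [LI, LR, LD] (\<lambda>h. \<forall>f.
       h (pure_tensor d [symI, emb f, symD]) =
         pure_tensor d [emb f] \<ominus>\<^bsub>TR d\<^esub> pure_tensor d [symE, emb f]
           \<ominus>\<^bsub>TR d\<^esub> pure_tensor d [symI, emb (d f)]) \<union>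
     rules_with d J [LI, LR, LE] (\<lambda>h. \<forall>f.
       h (pure_tensor d [symI, emb f, symE]) = pure_tensor d [emb (J f), symE]) \<union>
     rules_with d J [LI, LR, LI] (\<lambda>h. \<forall>f.
       h (pure_tensor d [symI, emb f, symI]) =
         pure_tensor d [emb (J f), symI] \<ominus>\<^bsub>TR d\<^esub> pure_tensor d [symE, emb (J f), symI]
           \<ominus>\<^bsub>TR d\<^esub> pure_tensor d [symI, emb (J f)]) \<union>
     rules_with d J [LI, LD] (\<lambda>h.
       h (pure_tensor d [symI, symD]) = \<one>\<^bsub>TR d\<^esub> \<ominus>\<^bsub>TR d\<^esub> pure_tensor d [symE]) \<union>
     rules_with d J [LI, LE] (\<lambda>h.
       h (pure_tensor d [symI, symE]) = pure_tensor d [emb (J 1), symE]) \<union>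
     rules_with d J [LI, LI] (\<lambda>h.
       h (pure_tensor d [symI, symI]) =
         pure_tensor d [emb (J 1), symI] \<ominus>\<^bsub>TR d\<^esub> pure_tensor d [symE, emb (J 1), symI]
           \<ominus>\<^bsub>TR d\<^esub> pure_tensor d [symI, emb (J 1)])"

text \<open>The shapes of pure tensors occurring in normal forms; factors from \<open>absent_or J\<close> may be
  missing.\<close>

definition absent_or :: "('a::ring_1 \<Rightarrow> 'a) \<Rightarrow> 'a ido list set" where
  "absent_or J = insert [] ((\<lambda>f. [emb f]) ` range J)"

definition standard_tensors :: "('a::ring_1 \<Rightarrow> 'a) \<Rightarrow> ('a \<Rightarrow> 'a) \<Rightarrow> 'a ido_tensor set" where
  "standard_tensors d J =
     {pure_tensor d (f @ replicate j symD) | f j. f \<in> absent_or J} \<union>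
     {pure_tensor d (f @ [symI] @ g) | f g. f \<in> absent_or J \<and> g \<in> absent_or J} \<union>
     {pure_tensor d (f @ [symE] @ g @ replicate j symD) | f g j.
        f \<in> absent_or J \<and> g \<in> absent_or J} \<union>
     {pure_tensor d (f @ [symE, emb h, symI] @ g) | f g h.
        f \<in> absent_or J \<and> g \<in> absent_or J \<and> h \<in> range J}"

section \<open>The ring of integro-differential operators\<close>

definition operator_relations ::
    "('a::ring_1 \<Rightarrow> 'a) \<Rightarrow> ('a \<Rightarrow> 'a) \<Rightarrow> 'a ido_tensor set" where
  "operator_relations d J =
     {\<one>\<^bsub>TR d\<^esub> \<ominus>\<^bsub>TR d\<^esub> pure_tensor d [emb 1]} \<union>
     {pure_tensor d [emb f, emb g] \<ominus>\<^bsub>TR d\<^esub> pure_tensor d [emb (f * g)] | f g. True} \<union>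
     {pure_tensor d [symD, emb f]
        \<ominus>\<^bsub>TR d\<^esub> (pure_tensor d [emb f, symD] \<oplus>\<^bsub>TR d\<^esub> pure_tensor d [emb (d f)]) | f. True} \<union>
     {pure_tensor d [symD, symI] \<ominus>\<^bsub>TR d\<^esub> \<one>\<^bsub>TR d\<^esub>} \<union>
     {pure_tensor d [symI, symD] \<ominus>\<^bsub>TR d\<^esub> (\<one>\<^bsub>TR d\<^esub> \<ominus>\<^bsub>TR d\<^esub> pure_tensor d [symE])} \<union>
     {pure_tensor d [symD, emb f, symE] \<ominus>\<^bsub>TR d\<^esub> pure_tensor d [emb (d f), symE] | f. True} \<union>
     {pure_tensor d [symI, emb f, symE] \<ominus>\<^bsub>TR d\<^esub> pure_tensor d [emb (J f), symE] | f. True} \<union>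
     {pure_tensor d [symE, emb f, symE]
        \<ominus>\<^bsub>TR d\<^esub> pure_tensor d [emb (evaluation d J f), symE] | f. True}"

definition operator_ideal :: "('a::ring_1 \<Rightarrow> 'a) \<Rightarrow> ('a \<Rightarrow> 'a) \<Rightarrow> 'a ido_tensor set" where
  "operator_ideal d J = Idl\<^bsub>TR d\<^esub> (operator_relations d J)"

definition operator_ring :: "('a::ring_1 \<Rightarrow> 'a) \<Rightarrow> ('a \<Rightarrow> 'a) \<Rightarrow> 'a ido_tensor set ring" where
  "operator_ring d J = TR d Quot operator_ideal d J"

text \<open>The bimodule structure induced from the tensor ring: a constant \<open>c\<close> acts as
  multiplication by the class of \<open>c \<epsilon>\<close>.\<close>

definition operator_lact ::
    "('a::ring_1 \<Rightarrow> 'a) \<Rightarrow> ('a \<Rightarrow> 'a) \<Rightarrow> 'a \<Rightarrow> 'a ido_tensor set \<Rightarrow> 'a ido_tensor set" where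
  "operator_lact d J c x =
     (operator_ideal d J +>\<^bsub>TR d\<^esub> scaled_tensor d c []) \<otimes>\<^bsub>operator_ring d J\<^esub> x"

definition operator_ract ::
    "('a::ring_1 \<Rightarrow> 'a) \<Rightarrow> ('a \<Rightarrow> 'a) \<Rightarrow> 'a ido_tensor set \<Rightarrow> 'a \<Rightarrow> 'a ido_tensor set" where
  "operator_ract d J x c =
     x \<otimes>\<^bsub>operator_ring d J\<^esub> (operator_ideal d J +>\<^bsub>TR d\<^esub> scaled_tensor d c [])"

end

theory Submission
  imports Defs
begin

text \<open>The summand \<open>u\<close> of a reduction step is arbitrary.  Hence \<open>t\<close> reduces to \<open>s\<close> iff \<open>t - s\<close> lies in
  the ideal generated by the differences of both sides of the rules, which is the defining ideal of the
  operator ring.  So the theorem says that the tensor ring is the direct sum of this ideal and of the span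
  of the standard tensors.  The sum of both is the whole ring because it is closed under left
  multiplication by the generators.  The intersection is zero by van der Waerden's method: the
  generators act from the left on the formal expressions \<open>f \<partial>\<^sup>j\<close>, \<open>f \<integral> g\<close>, \<open>f E g \<partial>\<^sup>j\<close>, \<open>f E h \<integral> g\<close> such
  that the relations of the operator ring hold, and applying an element of the tensor ring to \<open>1\<close> is an
  additive map that vanishes on the ideal and fixes the standard tensors.\<close>

text \<open>No order on words and no overlap of rules is examined, because steps are reversible:
  rewriting w in u + a w b is undone by rewriting -w while u + a w b + a h(w) b stays as the
  untouched summand. The difficulty lies in the direct sum. The constants need not commute and R
  need not be free over them, so the standard tensors form no basis; elements are cosets of formal
  sums, and maps have to come from the universal property of tensor products. Such maps are given by
  their values on scaled pure tensors, and \<open>operator_rep\<close> lists the equations that make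
  a map vanish on the ideal. It is instantiated in two ways: with the class map of the quotient,
  where the remaining rules follow from the defining relations, and with the action on formal
  expressions, where the relations are verified by calculation. Products of coefficients may leave
  the image of \<open>J\<close>, so closure under multiplication and the action allow arbitrary
  outer coefficients; the splitting f = ev f + J (d f), whose constant part moves to the left, comes
  in on the way to the standard tensors.\<close>

section \<open>Embedding abelian groups into a type\<close>

text \<open>A type of class \<^class>\<open>ab_group_add\<close> containing every abelian group whose elements have type \<open>'b\<close>,
  namely the product of all these groups.  It allows the type class laws to be used for groups
  that depend on term parameters, such as tensor products.\<close>

typedef 'b group_product =
  "{F :: 'b monoid \<Rightarrow> 'b. \<forall>G. if comm_group G then F G \<in> carrier G else F G = undefined}"
proof
  show "(\<lambda>G. if comm_group G then \<one>\<^bsub>G\<^esub> else undefined) \<in>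
    {F :: 'b monoid \<Rightarrow> 'b. \<forall>G. if comm_group G then F G \<in> carrier G else F G = undefined}"
    by (auto intro: monoid.one_closed group.is_monoid comm_group.axioms(2))
qed

setup_lifting type_definition_group_product

lemmas comm_group_rules =
  monoid.one_closed [OF group.is_monoid [OF comm_group.axioms(2)]]
  monoid.m_closed [OF group.is_monoid [OF comm_group.axioms(2)]]
  monoid.l_one [OF group.is_monoid [OF comm_group.axioms(2)]]
  monoid.m_assoc [OF group.is_monoid [OF comm_group.axioms(2)]]
  group.inv_closed [OF comm_group.axioms(2)]
  group.l_inv [OF comm_group.axioms(2)]

instantiation group_product :: (type) ab_group_add
begin

lift_definition zero_group_product :: "'a group_product" is
  "\<lambda>G. if comm_group G then \<one>\<^bsub>G\<^esub> else undefined"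
  by (simp add: comm_group_rules)

lift_definition plus_group_product :: "'a group_product \<Rightarrow> 'a group_product \<Rightarrow> 'a group_product" is
  "\<lambda>F F' G. if comm_group G then F G \<otimes>\<^bsub>G\<^esub> F' G else undefined"
  by (simp add: comm_group_rules split: if_splits)

lift_definition uminus_group_product :: "'a group_product \<Rightarrow> 'a group_product" is
  "\<lambda>F G. if comm_group G then inv\<^bsub>G\<^esub> F G else undefined"
  by (simp add: comm_group_rules split: if_splits)

definition minus_group_product :: "'a group_product \<Rightarrow> 'a group_product \<Rightarrow> 'a group_product" where
  "minus_group_product x y = x + (- y)"

instance
proof
  fix a b c :: "'a group_product"
  show "a + b + c = a + (b + c)"
    by transfer (simp add: fun_eq_iff comm_group_rules)
  show "a + b = b + a"
    by transfer (simp add: fun_eq_iff comm_monoid.m_comm [OF comm_group.axioms(1)])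
  show "0 + a = a"
    by transfer (simp add: fun_eq_iff comm_group_rules)
  show "- a + a = 0"
    by transfer (simp add: fun_eq_iff comm_group_rules)
  show "a - b = a + - b"
    by (simp add: minus_group_product_def)
qed

end

text \<open>The inclusion of the factor \<open>G\<close> into the product of all groups. The unit
  serves as default for \<open>x\<close> outside the carrier, since every coordinate has to lie in
  its group.\<close>

lift_definition inject :: "'b monoid \<Rightarrow> 'b \<Rightarrow> 'b group_product" is
  "\<lambda>G x G'. if comm_group G' then (if G' = G \<and> x \<in> carrier G then x else \<one>\<^bsub>G'\<^esub>) else undefined"
  by (simp add: comm_group_rules)

lemma inject_mult:
  assumes "comm_group G" "x \<in> carrier G" "y \<in> carrier G"
  shows "inject G (x \<otimes>\<^bsub>G\<^esub> y) = inject G x + inject G y"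
  using assms by transfer (simp add: fun_eq_iff comm_group_rules)

lemma inject_eq_iff:
  assumes "comm_group G" "x \<in> carrier G" "y \<in> carrier G"
  shows "inject G x = inject G y \<longleftrightarrow> x = y"
  using assms by transfer (auto simp: fun_eq_iff)


section \<open>The tensor ring\<close>

lemma frag_extend_fun_add:
  "frag_extend (\<lambda>x. f x + g x) p = frag_extend f p + frag_extend g p"
  by (simp add: frag_extend_def frag_cmul_distrib2 sum.distrib)

lemma frag_extend_fun_diff:
  "frag_extend (\<lambda>x. f x - g x) p = frag_extend f p - frag_extend g p"
proof -
  have "frag_extend (\<lambda>x. (f x - g x) + g x) p = frag_extend (\<lambda>x. f x - g x) p + frag_extend g p"
    by (rule frag_extend_fun_add)
  then show ?thesis by simp
qed

lemma frag_extend_fun_zero: "frag_extend (\<lambda>x. 0) p = 0"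
  by (simp add: frag_extend_def)

locale coefficient_bimodule =
  fixes K :: "'k::ring_1 set" and M :: "'m::ab_group_add set"
    and l :: "'k \<Rightarrow> 'm \<Rightarrow> 'm" and r :: "'m \<Rightarrow> 'k \<Rightarrow> 'm"
  assumes K_one [simp]: "1 \<in> K"
    and K_add [simp]: "c \<in> K \<Longrightarrow> e \<in> K \<Longrightarrow> c + e \<in> K"
    and K_mult [simp]: "c \<in> K \<Longrightarrow> e \<in> K \<Longrightarrow> c * e \<in> K"
    and M_add [simp]: "m \<in> M \<Longrightarrow> m' \<in> M \<Longrightarrow> m + m' \<in> M"
    and l_closed [simp]: "c \<in> K \<Longrightarrow> m \<in> M \<Longrightarrow> l c m \<in> M"
    and r_closed [simp]: "c \<in> K \<Longrightarrow> m \<in> M \<Longrightarrow> r m c \<in> M"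
    and l_add: "c \<in> K \<Longrightarrow> m \<in> M \<Longrightarrow> m' \<in> M \<Longrightarrow> l c (m + m') = l c m + l c m'"
    and r_add: "c \<in> K \<Longrightarrow> m \<in> M \<Longrightarrow> m' \<in> M \<Longrightarrow> r (m + m') c = r m c + r m' c"
    and r_add2: "c \<in> K \<Longrightarrow> e \<in> K \<Longrightarrow> m \<in> M \<Longrightarrow> r m (c + e) = r m c + r m e"
    and r_mult: "c \<in> K \<Longrightarrow> e \<in> K \<Longrightarrow> m \<in> M \<Longrightarrow> r m (c * e) = r (r m c) e"
    and l_mult: "c \<in> K \<Longrightarrow> e \<in> K \<Longrightarrow> m \<in> M \<Longrightarrow> l (c * e) m = l c (l e m)"
    and r_one [simp]: "m \<in> M \<Longrightarrow> r m 1 = m"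
    and l_one [simp]: "m \<in> M \<Longrightarrow> l 1 m = m"
    and r_l: "c \<in> K \<Longrightarrow> e \<in> K \<Longrightarrow> m \<in> M \<Longrightarrow> r (l c m) e = l c (r m e)"
begin

abbreviation "Free \<equiv> free_tensor_ring K M r"
abbreviation "Ker \<equiv> tensor_kernel K M l r"
abbreviation "Wds \<equiv> tensor_words K M"

text \<open>The product of \<open>Free\<close> as a plain function, to be simplified together with
  the type class addition of formal combinations.\<close>

definition fmul :: "(('k \<times> 'm list) \<Rightarrow>\<^sub>0 int) \<Rightarrow> (('k \<times> 'm list) \<Rightarrow>\<^sub>0 int) \<Rightarrow> (('k \<times> 'm list) \<Rightarrow>\<^sub>0 int)" where
  "fmul p q = frag_extend (\<lambda>u. frag_extend (\<lambda>v. frag_of (tensor_word_mult r u v)) q) p"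

lemma Free_simps [simp]:
  "carrier Free = {p. Poly_Mapping.keys p \<subseteq> Wds}"
  "x \<otimes>\<^bsub>Free\<^esub> y = fmul x y" "x \<oplus>\<^bsub>Free\<^esub> y = x + y" "\<zero>\<^bsub>Free\<^esub> = 0" "\<one>\<^bsub>Free\<^esub> = frag_of (1, [])"
  by (simp_all add: free_tensor_ring_def fmul_def)

lemma fmul_simps:
  "fmul (p + p') q = fmul p q + fmul p' q" "fmul p (q + q') = fmul p q + fmul p q'"
  "fmul (p - p') q = fmul p q - fmul p' q" "fmul p (q - q') = fmul p q - fmul p q'"
  "fmul (- p) q = - fmul p q" "fmul p (- q) = - fmul p q"
  "fmul 0 q = 0" "fmul p 0 = 0"
  "fmul (frag_of u) (frag_of v) = frag_of (tensor_word_mult r u v)"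
proof -
  show d: "fmul (p - p') q = fmul p q - fmul p' q" "fmul p (q - q') = fmul p q - fmul p q'" for p p' q q'
    by (simp_all add: fmul_def frag_extend_diff frag_extend_fun_diff)
  show z: "fmul 0 q = 0" "fmul p 0 = 0" for p q
    by (simp_all add: fmul_def frag_extend_fun_zero)
  show "fmul (- p) q = - fmul p q" "fmul p (- q) = - fmul p q" for p q
    using d[of 0 p q] d(2)[of p 0 q] by (simp_all add: z)
qed (simp_all add: fmul_def frag_extend_add frag_extend_fun_add)

lemma word_mult_closed: "u \<in> Wds \<Longrightarrow> v \<in> Wds \<Longrightarrow> tensor_word_mult r u v \<in> Wds"
  by (cases u; cases v) (auto simp: tensor_words_def in_lists_conv_set dest: in_set_butlastD last_in_set)

lemma last_in_M: "xs \<in> lists M \<Longrightarrow> xs \<noteq> [] \<Longrightarrow> last xs \<in> M"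
  by (auto simp: in_lists_conv_set)

text \<open>The action law \<open>r_mult\<close> enters when the middle factor has no letters: its
  scalar and the one after it act in turn on the last letter of the first factor.\<close>

lemma word_mult_assoc:
  assumes "u \<in> Wds" "v \<in> Wds" "w \<in> Wds"
  shows "tensor_word_mult r (tensor_word_mult r u v) w = tensor_word_mult r u (tensor_word_mult r v w)"
  using assms
  by (cases u; cases v; cases w)
    (auto simp: tensor_words_def mult.assoc r_mult last_in_M butlast_append)

lemma fmul_closed: "Poly_Mapping.keys p \<subseteq> Wds \<Longrightarrow> Poly_Mapping.keys q \<subseteq> Wds \<Longrightarrow> Poly_Mapping.keys (fmul p q) \<subseteq> Wds"
  unfolding fmul_def
  by (intro order.trans[OF keys_frag_extend] UN_least)
    (simp del: tensor_word_mult.simps add: word_mult_closed subset_iff split_paired_all)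

lemma fmul_assoc:
  assumes "Poly_Mapping.keys p \<subseteq> Wds" "Poly_Mapping.keys q \<subseteq> Wds" "Poly_Mapping.keys s \<subseteq> Wds"
  shows "fmul (fmul p q) s = fmul p (fmul q s)"
  using assms(1)
proof (induction rule: frag_induction)
  case (one u)
  show ?case using assms(2)
  proof (induction rule: frag_induction)
    case (one v)
    show ?case using assms(3)
      by (induction rule: frag_induction) (simp_all add: fmul_simps word_mult_assoc \<open>u \<in> Wds\<close> \<open>v \<in> Wds\<close>)
  qed (simp_all add: fmul_simps)
qed (simp_all add: fmul_simps)

lemma one_in_Wds [simp]: "(1, []) \<in> Wds"
  by (simp add: tensor_words_def)

lemma fmul_one:
  assumes "Poly_Mapping.keys p \<subseteq> Wds"
  shows "fmul (frag_of (1, [])) p = p" "fmul p (frag_of (1, [])) = p"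
  using assms
  by (induction rule: frag_induction)
    (auto simp: fmul_simps tensor_words_def last_in_M)

lemma ring_Free: "ring Free"
proof (rule ringI)
  show "abelian_group Free"
  proof (rule abelian_groupI)
    fix x assume "x \<in> carrier Free"
    then show "\<exists>y\<in>carrier Free. y \<oplus>\<^bsub>Free\<^esub> x = \<zero>\<^bsub>Free\<^esub>"
      by (auto intro!: exI[of _ "- x"])
  qed (auto dest!: subsetD[OF keys_add])
  show "monoid Free"
    by (rule monoidI) (auto simp: fmul_closed[THEN subsetD] fmul_assoc fmul_one)
qed (auto simp: fmul_simps)

section \<open>The tensor relations generate a two-sided ideal\<close>

abbreviation "Rels \<equiv> tensor_relations K M l r"

lemma frag_keys_Wds: "c \<in> K \<Longrightarrow> xs \<in> lists M \<Longrightarrow> Poly_Mapping.keys (frag_of (c, xs)) \<subseteq> Wds"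
  by (simp add: tensor_words_def)

lemma keys_diff_subset: "Poly_Mapping.keys p \<subseteq> S \<Longrightarrow> Poly_Mapping.keys q \<subseteq> S \<Longrightarrow> Poly_Mapping.keys (p - q :: _ \<Rightarrow>\<^sub>0 int) \<subseteq> S"
  by (rule order.trans [OF keys_diff Un_least])

lemma Rels_I:
  "c \<in> K \<Longrightarrow> c' \<in> K \<Longrightarrow> xs \<in> lists M \<Longrightarrow>
    frag_of (c + c', xs) - frag_of (c, xs) - frag_of (c', xs) \<in> Rels"
  "c \<in> K \<Longrightarrow> xs \<in> lists M \<Longrightarrow> m \<in> M \<Longrightarrow> m' \<in> M \<Longrightarrow> ys \<in> lists M \<Longrightarrow>
    frag_of (c, xs @ (m + m') # ys) - frag_of (c, xs @ m # ys) - frag_of (c, xs @ m' # ys) \<in> Rels"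
  "c \<in> K \<Longrightarrow> e \<in> K \<Longrightarrow> m \<in> M \<Longrightarrow> ys \<in> lists M \<Longrightarrow>
    frag_of (c * e, m # ys) - frag_of (c, l e m # ys) \<in> Rels"
  "c \<in> K \<Longrightarrow> e \<in> K \<Longrightarrow> xs \<in> lists M \<Longrightarrow> m \<in> M \<Longrightarrow> m' \<in> M \<Longrightarrow> ys \<in> lists M \<Longrightarrow>
    frag_of (c, xs @ r m e # m' # ys) - frag_of (c, xs @ m # l e m' # ys) \<in> Rels"
  unfolding tensor_relations_def
  subgoal by (intro UnI1 CollectI exI conjI; (rule refl | assumption))
  subgoal by (rule UnI1, rule UnI1, rule UnI2) fastforce
  subgoal by (rule UnI1, rule UnI2) fastforce
  subgoal by (rule UnI2) fastforce
  done

lemma Rels_E [consumes 1, case_names scalar slot left middle]: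
  assumes "p \<in> Rels"
  obtains
    c c' xs where "p = frag_of (c + c', xs) - frag_of (c, xs) - frag_of (c', xs)"
      "c \<in> K" "c' \<in> K" "xs \<in> lists M"
  | c xs m m' ys where
      "p = frag_of (c, xs @ (m + m') # ys) - frag_of (c, xs @ m # ys) - frag_of (c, xs @ m' # ys)"
      "c \<in> K" "xs \<in> lists M" "m \<in> M" "m' \<in> M" "ys \<in> lists M"
  | c e m ys where "p = frag_of (c * e, m # ys) - frag_of (c, l e m # ys)"
      "c \<in> K" "e \<in> K" "m \<in> M" "ys \<in> lists M"
  | c e xs m m' ys where "p = frag_of (c, xs @ r m e # m' # ys) - frag_of (c, xs @ m # l e m' # ys)"
      "c \<in> K" "e \<in> K" "xs \<in> lists M" "m \<in> M" "m' \<in> M" "ys \<in> lists M"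
  using assms unfolding tensor_relations_def by (elim UnE CollectE exE conjE) simp_all

lemma Rels_closed: "p \<in> Rels \<Longrightarrow> Poly_Mapping.keys p \<subseteq> Wds"
  by (erule Rels_E; hypsubst; intro keys_diff_subset frag_keys_Wds; simp)

lemma subgroup_Ker: "subgroup Ker (free_Abelian_group Wds)"
  unfolding tensor_kernel_def
  by (rule group.generate_is_subgroup) (auto simp: Rels_closed[THEN subsetD])

lemma Ker_closed: "p \<in> Ker \<Longrightarrow> Poly_Mapping.keys p \<subseteq> Wds"
  using subgroup.subset[OF subgroup_Ker] by (meson carrier_free_Abelian_group_iff subset_iff)

lemma Ker_zero: "0 \<in> Ker"
  using subgroup.one_closed[OF subgroup_Ker] by simp

lemma Ker_add: "p \<in> Ker \<Longrightarrow> q \<in> Ker \<Longrightarrow> p + q \<in> Ker"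
  using subgroup.m_closed[OF subgroup_Ker] by simp

lemma Ker_minus: "p \<in> Ker \<Longrightarrow> - p \<in> Ker"
  using subgroup.m_inv_closed[OF subgroup_Ker, of p] Ker_closed[of p] by simp

lemma Ker_diff: "p \<in> Ker \<Longrightarrow> q \<in> Ker \<Longrightarrow> p - q \<in> Ker"
  using Ker_add[of p "- q"] by (simp add: Ker_minus)

lemma Rels_Ker: "p \<in> Rels \<Longrightarrow> p \<in> Ker"
  unfolding tensor_kernel_def by (rule generate.incl)

lemma Ker_induct [consumes 1, case_names zero incl minus add]:
  assumes "p \<in> Ker" "P 0" "\<And>p. p \<in> Rels \<Longrightarrow> P p" "\<And>p. P p \<Longrightarrow> P (- p)"
    "\<And>p q. P p \<Longrightarrow> P q \<Longrightarrow> P (p + q)"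
  shows "P p"
  using assms(1) unfolding tensor_kernel_def
  by (induction rule: generate.induct) (auto simp: assms Rels_closed)

text \<open>A scalar behind a nonempty word acts on the last letter of that word. So a
  \<open>scalar\<close> relation becomes a \<open>slot\<close> relation and a \<open>left\<close>
  relation becomes a \<open>middle\<close> one; each relation stays a single relation.\<close>

lemma Rels_mult_left:
  assumes "u \<in> Wds" "p \<in> Rels"
  shows "fmul (frag_of u) p \<in> Rels"
proof -
  obtain a zs where u: "u = (a, zs)" "a \<in> K" "zs \<in> lists M"
    using assms(1) by (auto simp: tensor_words_def)
  show ?thesis
  proof (cases "zs = []")
    case True
    from assms(2) show ?thesis
      by (cases rule: Rels_E)
        (simp_all add: u True fmul_simps distrib_left mult.assoc [symmetric] Rels_I)
  next
    case False
    then obtain z zs' where zs: "zs = zs' @ [z]" "z \<in> M" "zs' \<in> lists M"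
      using u(3) by (cases zs rule: rev_cases) auto
    from assms(2) show ?thesis
    proof (cases rule: Rels_E)
      case (slot c xs m m' ys)
      then show ?thesis
        using Rels_I(2)[of a "zs' @ r z c # xs" m m' ys] u zs
        by (simp add: fmul_simps)
    next
      case (middle c e xs m m' ys)
      then show ?thesis
        using Rels_I(4)[of a e "zs' @ r z c # xs" m m' ys] u zs
        by (simp add: fmul_simps)
    qed (use u zs in \<open>simp_all add: fmul_simps r_add2 r_mult Rels_I\<close>)
  qed
qed

text \<open>The scalar of \<open>u\<close> acts on the last letter of each term. If the relation
  involves that letter, additivity of the right action or its commutation with the left action
  (\<open>r_l\<close>) shows that the result is again a relation.\<close>

lemma Rels_mult_right:
  assumes "u \<in> Wds" "p \<in> Rels"
  shows "fmul p (frag_of u) \<in> Rels"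
proof -
  obtain a zs where u: "u = (a, zs)" "a \<in> K" "zs \<in> lists M"
    using assms(1) by (auto simp: tensor_words_def)
  from assms(2) show ?thesis
  proof (cases rule: Rels_E)
    case (scalar c c' xs)
    show ?thesis
      using scalar u by (cases xs rule: rev_cases) (simp_all add: fmul_simps distrib_right Rels_I)
  next
    case (slot c xs m m' ys)
    show ?thesis
    proof (cases ys rule: rev_cases)
      case Nil
      then show ?thesis using slot u by (simp add: fmul_simps r_add Rels_I)
    next
      case (snoc ys' y)
      then show ?thesis
        using slot u Rels_I(2)[of c xs m m' "ys' @ r y a # zs"]
        by (simp add: fmul_simps butlast_append)
    qed
  next
    case (left c e m ys)
    show ?thesis
    proof (cases ys rule: rev_cases)
      case Nil
      then show ?thesis using left u by (simp add: fmul_simps r_l Rels_I)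
    next
      case (snoc ys' y)
      then show ?thesis
        using left u Rels_I(3)[of c e m "ys' @ r y a # zs"]
        by (simp add: fmul_simps butlast_append)
    qed
  next
    case (middle c e xs m m' ys)
    show ?thesis
    proof (cases ys rule: rev_cases)
      case Nil
      then show ?thesis
        using middle u Rels_I(4)[of c e xs m "r m' a" zs]
        by (simp add: fmul_simps butlast_append r_l)
    next
      case (snoc ys' y)
      then show ?thesis
        using middle u Rels_I(4)[of c e xs m m' "ys' @ r y a # zs"]
        by (simp add: fmul_simps butlast_append)
    qed
  qed
qed

lemma ideal_Ker: "ideal Ker Free"
proof (rule idealI[OF ring_Free])
  show "subgroup Ker (add_monoid Free)"
  proof (rule group.subgroupI)
    show "Group.group (add_monoid Free)"
      by (rule abelian_group.a_group [OF ring.is_abelian_group [OF ring_Free]])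
    show "Ker \<subseteq> carrier (add_monoid Free)" using Ker_closed by auto
    show "Ker \<noteq> {}" using Ker_zero by auto
    show "a \<otimes>\<^bsub>add_monoid Free\<^esub> b \<in> Ker" if "a \<in> Ker" "b \<in> Ker" for a b
      using that by (simp add: Ker_add)
    show "inv\<^bsub>add_monoid Free\<^esub> a \<in> Ker" if "a \<in> Ker" for a
    proof -
      have "inv\<^bsub>add_monoid Free\<^esub> a = - a"
        using Ker_closed[OF that]
        by (intro group.inv_equality abelian_group.a_group ring.is_abelian_group ring_Free) simp_all
      then show ?thesis using that by (simp add: Ker_minus)
    qed
  qed
  show "x \<otimes>\<^bsub>Free\<^esub> a \<in> Ker" if "a \<in> Ker" "x \<in> carrier Free" for a x
    using that(1)
  proof (induction rule: Ker_induct)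
    case (incl p)
    have "Poly_Mapping.keys x \<subseteq> Wds" using that by simp
    then have "fmul x p \<in> Ker"
      by (induction rule: frag_induction)
        (auto simp: fmul_simps Ker_zero Ker_diff intro: Rels_Ker Rels_mult_left incl)
    then show ?case by simp
  qed (simp_all add: fmul_simps Ker_zero Ker_minus Ker_add)
  show "a \<otimes>\<^bsub>Free\<^esub> x \<in> Ker" if "a \<in> Ker" "x \<in> carrier Free" for a x
    using that(1)
  proof (induction rule: Ker_induct)
    case (incl p)
    have "Poly_Mapping.keys x \<subseteq> Wds" using that by simp
    then have "fmul p x \<in> Ker"
      by (induction rule: frag_induction)
        (auto simp: fmul_simps Ker_zero Ker_diff intro: Rels_Ker Rels_mult_right incl)
    then show ?case by simp
  qed (simp_all add: fmul_simps Ker_zero Ker_minus Ker_add)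
qed

end

section \<open>Additive spans in a ring\<close>

context ring
begin

text \<open>Integer combinations only; constant factors enter through the generating sets.\<close>

definition span :: "'a set \<Rightarrow> 'a set" where
  "span = generate (add_monoid R)"

lemma subgroup_span: "S \<subseteq> carrier R \<Longrightarrow> subgroup (span S) (add_monoid R)"
  unfolding span_def by (rule add.generate_is_subgroup) simp

lemma span_closed: "S \<subseteq> carrier R \<Longrightarrow> x \<in> span S \<Longrightarrow> x \<in> carrier R"
  using subgroup.subset [OF subgroup_span] by auto

lemma span_zero: "\<zero> \<in> span S"
  using generate.one [of "add_monoid R" S] by (simp add: span_def)

lemma span_incl: "x \<in> S \<Longrightarrow> x \<in> span S"
  unfolding span_def by (rule generate.incl)

lemma span_add: "x \<in> span S \<Longrightarrow> y \<in> span S \<Longrightarrow> x \<oplus> y \<in> span S"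
  using generate.eng [of x "add_monoid R" S y] by (simp add: span_def)

lemma span_minus: "S \<subseteq> carrier R \<Longrightarrow> x \<in> span S \<Longrightarrow> \<ominus> x \<in> span S"
  using subgroup.m_inv_closed [OF subgroup_span] by (simp add: a_inv_def)

lemma span_diff: "S \<subseteq> carrier R \<Longrightarrow> x \<in> span S \<Longrightarrow> y \<in> span S \<Longrightarrow> x \<ominus> y \<in> span S"
  by (simp add: a_minus_def span_add span_minus)

lemma span_induct [consumes 2, case_names zero incl minus add]:
  assumes "x \<in> span S" "S \<subseteq> carrier R"
    and "P \<zero>" and "\<And>x. x \<in> S \<Longrightarrow> P x"
    and "\<And>x. x \<in> carrier R \<Longrightarrow> P x \<Longrightarrow> P (\<ominus> x)"
    and "\<And>x y. x \<in> carrier R \<Longrightarrow> y \<in> carrier R \<Longrightarrow> P x \<Longrightarrow> P y \<Longrightarrow> P (x \<oplus> y)"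
  shows "P x"
proof -
  have "x \<in> carrier R \<and> P x"
    using assms(1) unfolding span_def
  proof (induction rule: generate.induct)
    case (inv h)
    then show ?case using assms(2) assms(4,5) [of h] by (auto simp: a_inv_def [symmetric])
  qed (use assms in auto)
  then show ?thesis by simp
qed

lemma span_mono_subgroup:
  assumes "x \<in> span S" "S \<subseteq> span T" "T \<subseteq> carrier R"
  shows "x \<in> span T"
proof -
  have "S \<subseteq> carrier R" using assms(2,3) span_closed by blast
  with assms(1) show ?thesis
    by (induction rule: span_induct) (use assms in \<open>auto simp: span_zero span_minus span_add\<close>)
qed

end

lemma comm_group_add_monoid: "ring R \<Longrightarrow> comm_group (add_monoid R)"
  by (rule abelian_group.a_comm_group [OF ring.is_abelian_group])

section \<open>Residue classes in a type with addition\<close>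

context ideal
begin

text \<open>Residue classes are moved into \<open>group_product\<close> so that equations between
  them can be solved with the type class laws.\<close>

definition coset_class :: "'a \<Rightarrow> 'a set group_product" where
  "coset_class x = inject (add_monoid (R Quot I)) (I +> x)"

lemma coset_class_add:
  assumes "x \<in> carrier R" "y \<in> carrier R"
  shows "coset_class (x \<oplus> y) = coset_class x + coset_class y"
proof -
  have hom: "(+>) I \<in> ring_hom R (R Quot I)" by (rule rcos_ring_hom)
  show ?thesis
    using inject_mult [OF comm_group_add_monoid [OF quotient_is_ring], of "I +> x" "I +> y"]
      ring_hom_closed [OF hom] ring_hom_add [OF hom] assms
    by (simp add: coset_class_def)
qed

lemma coset_class_eq_iff:
  assumes "x \<in> carrier R" "y \<in> carrier R"
  shows "coset_class x = coset_class y \<longleftrightarrow> x \<ominus> y \<in> I"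
proof -
  have hom: "(+>) I \<in> ring_hom R (R Quot I)" by (rule rcos_ring_hom)
  have "coset_class x = coset_class y \<longleftrightarrow> I +> x = I +> y"
    using inject_eq_iff [OF comm_group_add_monoid [OF quotient_is_ring], of "I +> x" "I +> y"]
      ring_hom_closed [OF hom] assms
    by (simp add: coset_class_def)
  also have "\<dots> \<longleftrightarrow> x \<ominus> y \<in> I"
    using quotient_eq_iff_same_a_r_cos [OF ideal_axioms assms] by auto
  finally show ?thesis .
qed

lemma coset_class_zero: "coset_class \<zero> = 0"
  using coset_class_add [of \<zero> \<zero>] by simp

lemma coset_class_minus: "x \<in> carrier R \<Longrightarrow> coset_class (\<ominus> x) = - coset_class x"
  using coset_class_add [of x "\<ominus> x"] by (simp add: r_neg coset_class_zero eq_neg_iff_add_eq_0 add.commute)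

lemma coset_class_diff:
  "x \<in> carrier R \<Longrightarrow> y \<in> carrier R \<Longrightarrow> coset_class (x \<ominus> y) = coset_class x - coset_class y"
  by (simp add: a_minus_def coset_class_add coset_class_minus)

lemma coset_class_eq_0_iff: "x \<in> carrier R \<Longrightarrow> coset_class x = 0 \<longleftrightarrow> x \<in> I"
  using coset_class_eq_iff [of x \<zero>] by (simp add: coset_class_zero a_minus_def)

end

lemma comm_group_type:
  "comm_group \<lparr>carrier = (UNIV :: 'b::ab_group_add set), mult = (+), one = 0\<rparr>"
  by (rule comm_groupI) (auto simp: algebra_simps intro: exI [of _ "- x" for x])

section \<open>Scaled pure tensors and the universal property of the tensor ring\<close>

context coefficient_bimodule
begin

abbreviation "TRing \<equiv> tensor_ring K M l r"
abbreviation "tens \<equiv> tensor K M l r"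

lemma Wds_iff [simp]: "(c, xs) \<in> Wds \<longleftrightarrow> c \<in> K \<and> xs \<in> lists M"
  by (simp add: tensor_words_def)

sublocale Fr: ring Free
  by (rule ring_Free)

sublocale FK: ideal Ker Free
  by (rule ideal_Ker)

sublocale T: ring TRing
  unfolding tensor_ring_def by (rule FK.quotient_is_ring)

definition proj :: "(('k \<times> 'm list) \<Rightarrow>\<^sub>0 int) \<Rightarrow> (('k \<times> 'm list) \<Rightarrow>\<^sub>0 int) set" where
  "proj p = Ker +>\<^bsub>Free\<^esub> p"

lemma proj_hom: "proj \<in> ring_hom Free TRing"
  using FK.rcos_ring_hom unfolding tensor_ring_def proj_def by simp

lemma tens_proj: "tens c ms = proj (frag_of (c, ms))"
  by (simp add: tensor_def proj_def)

lemma Free_minus: "Poly_Mapping.keys p \<subseteq> Wds \<Longrightarrow> \<ominus>\<^bsub>Free\<^esub> p = - p"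
  by (rule Fr.minus_equality) simp_all

lemma Free_diff: "Poly_Mapping.keys p \<subseteq> Wds \<Longrightarrow> Poly_Mapping.keys q \<subseteq> Wds \<Longrightarrow> p \<ominus>\<^bsub>Free\<^esub> q = p - q"
  by (simp add: a_minus_def Free_minus)

lemma proj_eq_iff:
  assumes "Poly_Mapping.keys p \<subseteq> Wds" "Poly_Mapping.keys q \<subseteq> Wds"
  shows "proj p = proj q \<longleftrightarrow> p - q \<in> Ker"
  using Fr.quotient_eq_iff_same_a_r_cos [OF ideal_Ker, of p q] assms by (auto simp: proj_def Free_diff)

lemma proj_closed: "Poly_Mapping.keys p \<subseteq> Wds \<Longrightarrow> proj p \<in> carrier TRing"
  using ring_hom_closed [OF proj_hom] by simp

lemma proj_add:
  "Poly_Mapping.keys p \<subseteq> Wds \<Longrightarrow> Poly_Mapping.keys q \<subseteq> Wds \<Longrightarrow> proj (p + q) = proj p \<oplus>\<^bsub>TRing\<^esub> proj q"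
  using ring_hom_add [OF proj_hom, of p q] by simp

lemma proj_mult:
  "Poly_Mapping.keys p \<subseteq> Wds \<Longrightarrow> Poly_Mapping.keys q \<subseteq> Wds \<Longrightarrow> proj (fmul p q) = proj p \<otimes>\<^bsub>TRing\<^esub> proj q"
  using ring_hom_mult [OF proj_hom, of p q] by simp

lemma proj_zero: "proj 0 = \<zero>\<^bsub>TRing\<^esub>"
  using ring_hom_zero [OF proj_hom ring_Free T.ring_axioms] by simp

lemma proj_diff:
  assumes "Poly_Mapping.keys p \<subseteq> Wds" "Poly_Mapping.keys q \<subseteq> Wds"
  shows "proj (p - q) = proj p \<ominus>\<^bsub>TRing\<^esub> proj q"
proof -
  have "proj p = proj (p - q) \<oplus>\<^bsub>TRing\<^esub> proj q"
    using proj_add [of "p - q" q] assms by (simp add: keys_diff_subset)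
  then show ?thesis
    using assms by (simp add: proj_closed keys_diff_subset a_minus_def T.a_assoc T.r_neg)
qed

lemma proj_surj:
  assumes "x \<in> carrier TRing"
  obtains p where "Poly_Mapping.keys p \<subseteq> Wds" "x = proj p"
  using assms unfolding tensor_ring_def proj_def FactRing_def A_RCOSETS_def'
  by (auto simp: A_RCOSETS_defs a_r_coset_def)

lemma one_tens: "\<one>\<^bsub>TRing\<^esub> = tens 1 []"
  using ring_hom_one [OF proj_hom] by (simp add: tens_proj)

lemma tens_closed [simp]: "c \<in> K \<Longrightarrow> xs \<in> lists M \<Longrightarrow> tens c xs \<in> carrier TRing"
  by (simp add: tens_proj proj_closed frag_keys_Wds)

lemma tens_mult:
  assumes "c \<in> K" "xs \<in> lists M" "e \<in> K" "ys \<in> lists M"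
  shows "tens c xs \<otimes>\<^bsub>TRing\<^esub> tens e ys =
    (if xs = [] then tens (c * e) ys else tens c (butlast xs @ r (last xs) e # ys))"
  using proj_mult [of "frag_of (c, xs)" "frag_of (e, ys)"] assms
  by (cases "xs = []") (simp_all add: tens_proj fmul_simps)

lemma tens_mult_one:
  assumes "c \<in> K" "xs \<in> lists M" "ys \<in> lists M"
  shows "tens c xs \<otimes>\<^bsub>TRing\<^esub> tens 1 ys = tens c (xs @ ys)"
  using assms by (cases xs rule: rev_cases) (simp_all add: tens_mult)

lemma tens_eqI:
  assumes "frag_of (c, xs) - frag_of (e, ys) \<in> Rels" "c \<in> K" "xs \<in> lists M" "e \<in> K" "ys \<in> lists M"
  shows "tens c xs = tens e ys"
  using assms by (simp add: tens_proj proj_eq_iff frag_keys_Wds Rels_Ker)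

lemma tens_addI:
  assumes "frag_of (c, xs) - frag_of (e, ys) - frag_of (e', ys') \<in> Rels"
    "c \<in> K" "xs \<in> lists M" "e \<in> K" "ys \<in> lists M" "e' \<in> K" "ys' \<in> lists M"
  shows "tens c xs = tens e ys \<oplus>\<^bsub>TRing\<^esub> tens e' ys'"
proof -
  have "proj (frag_of (c, xs)) = proj (frag_of (e, ys) + frag_of (e', ys'))"
    using assms Rels_Ker [OF assms(1)]
    by (subst proj_eq_iff) (simp_all add: diff_diff_eq order.trans [OF keys_add Un_least])
  then show ?thesis using assms by (simp add: tens_proj proj_add frag_keys_Wds)
qed

lemma tens_scalar_add:
  "c \<in> K \<Longrightarrow> c' \<in> K \<Longrightarrow> xs \<in> lists M \<Longrightarrow> tens (c + c') xs = tens c xs \<oplus>\<^bsub>TRing\<^esub> tens c' xs"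
  by (intro tens_addI Rels_I) simp_all

lemma tens_slot_add:
  "c \<in> K \<Longrightarrow> xs \<in> lists M \<Longrightarrow> m \<in> M \<Longrightarrow> m' \<in> M \<Longrightarrow> ys \<in> lists M \<Longrightarrow>
    tens c (xs @ (m + m') # ys) = tens c (xs @ m # ys) \<oplus>\<^bsub>TRing\<^esub> tens c (xs @ m' # ys)"
  by (intro tens_addI Rels_I) simp_all

lemma tens_left:
  "c \<in> K \<Longrightarrow> e \<in> K \<Longrightarrow> m \<in> M \<Longrightarrow> ys \<in> lists M \<Longrightarrow> tens (c * e) (m # ys) = tens c (l e m # ys)"
  by (intro tens_eqI Rels_I) simp_all

lemma tens_middle:
  "c \<in> K \<Longrightarrow> e \<in> K \<Longrightarrow> xs \<in> lists M \<Longrightarrow> m \<in> M \<Longrightarrow> m' \<in> M \<Longrightarrow> ys \<in> lists M \<Longrightarrow>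
    tens c (xs @ r m e # m' # ys) = tens c (xs @ m # l e m' # ys)"
  by (intro tens_eqI Rels_I) simp_all

lemma TRing_induct [consumes 1, case_names zero tens diff]:
  assumes "x \<in> carrier TRing" and "P \<zero>\<^bsub>TRing\<^esub>"
    and "\<And>c xs. c \<in> K \<Longrightarrow> xs \<in> lists M \<Longrightarrow> P (tens c xs)"
    and "\<And>x y. x \<in> carrier TRing \<Longrightarrow> y \<in> carrier TRing \<Longrightarrow> P x \<Longrightarrow> P y \<Longrightarrow> P (x \<ominus>\<^bsub>TRing\<^esub> y)"
  shows "P x"
proof -
  obtain p where p: "Poly_Mapping.keys p \<subseteq> Wds" "x = proj p"
    using assms(1) proj_surj by blast
  have "P (proj p)"
    using p(1)
  proof (rule free_Abelian_group_induct)
    show "P (proj 0)" by (simp add: proj_zero assms(2))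
    show "P (proj (p - q))"
      if "Poly_Mapping.keys p \<subseteq> Wds" "Poly_Mapping.keys q \<subseteq> Wds" "P (proj p)" "P (proj q)" for p q
      using that by (simp add: proj_diff proj_closed assms(4))
    show "P (proj (frag_of u))" if "u \<in> Wds" for u
      using that assms(3) by (cases u) (simp add: tens_proj)
  qed
  with p show ?thesis by simp
qed

text \<open>Admissible values of an additive map on scaled pure tensors; the four clauses correspond
  to the four kinds of \<open>tensor_relations\<close>.\<close>

definition tensor_map :: "('k \<Rightarrow> 'm list \<Rightarrow> 'b::ab_group_add) \<Rightarrow> bool" where
  "tensor_map \<tau> \<longleftrightarrow>
     (\<forall>c\<in>K. \<forall>c'\<in>K. \<forall>xs\<in>lists M. \<tau> (c + c') xs = \<tau> c xs + \<tau> c' xs) \<and>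
     (\<forall>c\<in>K. \<forall>xs\<in>lists M. \<forall>m\<in>M. \<forall>m'\<in>M. \<forall>ys\<in>lists M.
        \<tau> c (xs @ (m + m') # ys) = \<tau> c (xs @ m # ys) + \<tau> c (xs @ m' # ys)) \<and>
     (\<forall>c\<in>K. \<forall>e\<in>K. \<forall>m\<in>M. \<forall>ys\<in>lists M. \<tau> (c * e) (m # ys) = \<tau> c (l e m # ys)) \<and>
     (\<forall>c\<in>K. \<forall>e\<in>K. \<forall>xs\<in>lists M. \<forall>m\<in>M. \<forall>m'\<in>M. \<forall>ys\<in>lists M.
        \<tau> c (xs @ r m e # m' # ys) = \<tau> c (xs @ m # l e m' # ys))"

lemma tensor_map_additive:
  assumes "\<And>x y. x \<in> carrier TRing \<Longrightarrow> y \<in> carrier TRing \<Longrightarrow> h (x \<oplus>\<^bsub>TRing\<^esub> y) = h x + h y"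
  shows "tensor_map (\<lambda>c xs. h (tens c xs))"
  unfolding tensor_map_def
  by (simp add: tens_scalar_add tens_slot_add tens_left tens_middle assms)

text \<open>The universal property: freeness extends \<tau> to formal combinations, each clause of
  \<open>tensor_map\<close> makes one kind of relation vanish, and the map descends to the
  quotient.\<close>

lemma tensor_map_extend:
  assumes "tensor_map \<tau>"
  obtains h where "\<And>x y. x \<in> carrier TRing \<Longrightarrow> y \<in> carrier TRing \<Longrightarrow> h (x \<oplus>\<^bsub>TRing\<^esub> y) = h x + h y"
    "\<And>c xs. c \<in> K \<Longrightarrow> xs \<in> lists M \<Longrightarrow> h (tens c xs) = \<tau> c xs"
proof -
  obtain g where g: "g \<in> hom (free_Abelian_group Wds) \<lparr>carrier = UNIV, mult = (+), one = 0\<rparr>"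
      "\<And>u. u \<in> Wds \<Longrightarrow> g (frag_of u) = (case u of (c, xs) \<Rightarrow> \<tau> c xs)"
    using comm_group.free_Abelian_group_universal [OF comm_group_type, of "\<lambda>(c, xs). \<tau> c xs" Wds] by auto
  have g_add: "g (p + q) = g p + g q" if "Poly_Mapping.keys p \<subseteq> Wds" "Poly_Mapping.keys q \<subseteq> Wds" for p q
    using hom_mult [OF g(1), of p q] that by simp
  have g_diff: "g (p - q) = g p - g q" if "Poly_Mapping.keys p \<subseteq> Wds" "Poly_Mapping.keys q \<subseteq> Wds" for p q
    using g_add [of "p - q" q] that by (simp add: keys_diff_subset)
  have g_zero: "g 0 = 0" using g_add [of 0 0] by simp
  have gw: "g (frag_of (c, xs)) = \<tau> c xs" if "c \<in> K" "xs \<in> lists M" for c xs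
    using g(2) [of "(c, xs)"] that by (simp add: tensor_words_def)
  have g_Rels: "g p = 0" if "p \<in> Rels" for p
    using that assms unfolding tensor_map_def
    by (cases rule: Rels_E) (simp_all add: g_diff frag_keys_Wds keys_diff_subset gw)
  have g_Ker: "g p = 0" if "p \<in> Ker" for p
  proof -
    have "Poly_Mapping.keys p \<subseteq> Wds \<and> g p = 0"
      using that
    proof (induction rule: Ker_induct)
      case (minus p)
      then show ?case using g_diff [of 0 p] by (simp add: g_zero)
    next
      case (add p q)
      then show ?case
        by (simp add: g_add order.trans [OF keys_add Un_least])
    qed (simp_all add: g_zero g_Rels Rels_closed)
    then show ?thesis by simp
  qed
  \<comment> \<open>\<open>h\<close> evaluates an arbitrary representative; two representatives
    differ by an element of \<open>Ker\<close>, where \<open>g\<close> is zero.\<close>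
  define h where "h x = g (SOME p. Poly_Mapping.keys p \<subseteq> Wds \<and> x = proj p)" for x
  have h_proj: "h (proj p) = g p" if "Poly_Mapping.keys p \<subseteq> Wds" for p
  proof -
    define q where "q = (SOME q. Poly_Mapping.keys q \<subseteq> Wds \<and> proj p = proj q)"
    have q: "Poly_Mapping.keys q \<subseteq> Wds \<and> proj p = proj q"
      unfolding q_def by (rule someI [of _ p]) (use that in simp)
    then have "g (q - p) = 0" using that proj_eq_iff g_Ker by metis
    then have "g q = g p" using q that by (simp add: g_diff)
    then show ?thesis by (simp add: h_def flip: q_def)
  qed
  show thesis
  proof
    show "h (x \<oplus>\<^bsub>TRing\<^esub> y) = h x + h y" if xy: "x \<in> carrier TRing" "y \<in> carrier TRing" for x y
    proof -
      obtain p q where "Poly_Mapping.keys p \<subseteq> Wds" "x = proj p" "Poly_Mapping.keys q \<subseteq> Wds" "y = proj q"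
        using xy proj_surj by metis
      then show ?thesis
        by (simp add: h_proj g_add order.trans [OF keys_add Un_least] flip: proj_add)
    qed
    show "h (tens c xs) = \<tau> c xs" if "c \<in> K" "xs \<in> lists M" for c xs
      using that by (simp add: tens_proj h_proj frag_keys_Wds gw)
  qed
qed

end

section \<open>Representations of the relations of integro-differential operators\<close>

locale integro_differential =
  fixes d J :: "'a::ring_1 \<Rightarrow> 'a"
  assumes integro_differential_ring: "integro_differential_ring d J"
begin

abbreviation "K \<equiv> constants d"
abbreviation "M \<equiv> ido_module d"
abbreviation "ev \<equiv> evaluation d J"

lemma d_add: "d (f + g) = d f + d g"
  and d_mult: "d (f * g) = d f * g + f * d g"
  and J_add: "J (f + g) = J f + J g"
  and J_const: "c \<in> K \<Longrightarrow> J (c * f) = c * J f" "c \<in> K \<Longrightarrow> J (f * c) = J f * c"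
  and d_J [simp]: "d (J f) = f"
  using integro_differential_ring
  unfolding integro_differential_ring_def derivation_def by auto

lemma d_zero [simp]: "d 0 = 0" using d_add [of 0 0] by simp
lemma J_zero [simp]: "J 0 = 0" using J_add [of 0 0] by simp
lemma d_one [simp]: "d 1 = 0" using d_mult [of 1 1] by simp
lemma d_minus: "d (- f) = - d f" using d_add [of f "- f"] by (simp add: eq_neg_iff_add_eq_0 add.commute)
lemma d_diff: "d (f - g) = d f - d g" using d_add [of f "- g"] by (simp add: d_minus)

lemma const_iff: "c \<in> K \<longleftrightarrow> d c = 0"
  by (simp add: constants_def)

lemma d_const [simp]: "c \<in> K \<Longrightarrow> d c = 0"
  by (simp add: constants_def)

lemma const_closed [simp]:
  "0 \<in> K" "1 \<in> K" "c \<in> K \<Longrightarrow> e \<in> K \<Longrightarrow> c + e \<in> K" "c \<in> K \<Longrightarrow> e \<in> K \<Longrightarrow> c * e \<in> K"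
  "c \<in> K \<Longrightarrow> - c \<in> K"
  by (simp_all add: const_iff d_add d_mult d_minus)

lemma d_const_mult: "c \<in> K \<Longrightarrow> d (c * f) = c * d f" "c \<in> K \<Longrightarrow> d (f * c) = d f * c"
  by (simp_all add: d_mult)

lemma ev_const [simp]: "ev f \<in> K"
  by (simp add: const_iff evaluation_def d_diff)

lemma ev_of_const [simp]: "c \<in> K \<Longrightarrow> ev c = c"
  by (simp add: evaluation_def)

lemma ev_J [simp]: "ev (J f) = 0"
  by (simp add: evaluation_def)

lemma ev_add: "ev (f + g) = ev f + ev g"
  by (simp add: evaluation_def d_add J_add)

lemma ev_const_mult: "c \<in> K \<Longrightarrow> ev (c * f) = c * ev f" "c \<in> K \<Longrightarrow> ev (f * c) = ev f * c"
  by (simp_all add: evaluation_def d_const_mult J_const algebra_simps)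

text \<open>The splitting of the ring into the constants and the image of \<open>J\<close>,
  elementwise.\<close>

lemma ev_decomp: "ev f + J (d f) = f"
  by (simp add: evaluation_def)

lemma M_iff [simp]: "(f, x, y, z) \<in> M \<longleftrightarrow> x \<in> K \<and> y \<in> K \<and> z \<in> K"
  by (simp add: ido_module_def)

sublocale coefficient_bimodule K M ido_lact ido_ract
  by unfold_locales (auto simp: algebra_simps ido_module_def)

lemma sym_M [simp]: "emb f \<in> M" "symD \<in> M" "symI \<in> M" "symE \<in> M"
  by (simp_all add: emb_def symD_def symI_def symE_def)

lemma emb_simps:
  "emb (f + g) = emb f + emb g" "ido_lact c (emb f) = emb (c * f)" "ido_ract (emb f) c = emb (f * c)"
  "emb 0 = 0"
  by (simp_all add: emb_def zero_prod_def)

lemma sym_ract: "ido_ract symD c = ido_lact c symD" "ido_ract symI c = ido_lact c symI" "ido_ract symE c = ido_lact c symE"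
  by (simp_all add: symD_def symI_def symE_def)

lemma ido_decomp:
  "(f, x, y, z) = emb f + (ido_lact x symD + (ido_lact y symI + ido_lact z symE))"
  by (simp add: emb_def symD_def symI_def symE_def)

end

locale tensor_rep = integro_differential d J
  for d J :: "'a::ring_1 \<Rightarrow> 'a" +
  fixes \<tau> :: "'a \<Rightarrow> 'a ido list \<Rightarrow> 'b::ab_group_add"
  assumes tensor_map: "tensor_map \<tau>"
begin

lemma rep_scalar: "c \<in> K \<Longrightarrow> c' \<in> K \<Longrightarrow> xs \<in> lists M \<Longrightarrow> \<tau> (c + c') xs = \<tau> c xs + \<tau> c' xs"
  and rep_slot: "c \<in> K \<Longrightarrow> xs \<in> lists M \<Longrightarrow> m \<in> M \<Longrightarrow> m' \<in> M \<Longrightarrow> ys \<in> lists M \<Longrightarrow>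
    \<tau> c (xs @ (m + m') # ys) = \<tau> c (xs @ m # ys) + \<tau> c (xs @ m' # ys)"
  and rep_left: "c \<in> K \<Longrightarrow> e \<in> K \<Longrightarrow> m \<in> M \<Longrightarrow> ys \<in> lists M \<Longrightarrow> \<tau> (c * e) (m # ys) = \<tau> c (ido_lact e m # ys)"
  and rep_middle: "c \<in> K \<Longrightarrow> e \<in> K \<Longrightarrow> xs \<in> lists M \<Longrightarrow> m \<in> M \<Longrightarrow> m' \<in> M \<Longrightarrow> ys \<in> lists M \<Longrightarrow>
    \<tau> c (xs @ ido_ract m e # m' # ys) = \<tau> c (xs @ m # ido_lact e m' # ys)"
  using tensor_map unfolding tensor_map_def by blast+

lemma rep_scalar_zero: "xs \<in> lists M \<Longrightarrow> \<tau> 0 xs = 0"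
  using rep_scalar [of 0 0 xs] by simp

lemma rep_zero: "c \<in> K \<Longrightarrow> xs \<in> lists M \<Longrightarrow> ys \<in> lists M \<Longrightarrow> \<tau> c (xs @ 0 # ys) = 0"
  using rep_slot [of c xs "emb 0" "emb 0" ys] by (simp add: emb_simps zero_prod_def)

end

text \<open>Describes an additive map that vanishes on the operator ideal in terms of words: the
  factors \<open>xs\<close> and \<open>ys\<close> around each relation account for the ideal being
  two-sided.\<close>

locale operator_rep = tensor_rep d J \<tau>
  for d J and \<tau> :: "'a::ring_1 \<Rightarrow> 'a ido list \<Rightarrow> 'b::ab_group_add" +
  assumes rel_one: "c \<in> K \<Longrightarrow> xs \<in> lists M \<Longrightarrow> ys \<in> lists M \<Longrightarrow> \<tau> c (xs @ emb 1 # ys) = \<tau> c (xs @ ys)"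
    and rel_RR: "c \<in> K \<Longrightarrow> xs \<in> lists M \<Longrightarrow> ys \<in> lists M \<Longrightarrow>
      \<tau> c (xs @ emb f # emb g # ys) = \<tau> c (xs @ emb (f * g) # ys)"
    and rel_DR: "c \<in> K \<Longrightarrow> xs \<in> lists M \<Longrightarrow> ys \<in> lists M \<Longrightarrow>
      \<tau> c (xs @ symD # emb f # ys) = \<tau> c (xs @ emb f # symD # ys) + \<tau> c (xs @ emb (d f) # ys)"
    and rel_DI: "c \<in> K \<Longrightarrow> xs \<in> lists M \<Longrightarrow> ys \<in> lists M \<Longrightarrow> \<tau> c (xs @ symD # symI # ys) = \<tau> c (xs @ ys)"
    and rel_ID: "c \<in> K \<Longrightarrow> xs \<in> lists M \<Longrightarrow> ys \<in> lists M \<Longrightarrow>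
      \<tau> c (xs @ symI # symD # ys) = \<tau> c (xs @ ys) - \<tau> c (xs @ symE # ys)"
    and rel_DRE: "c \<in> K \<Longrightarrow> xs \<in> lists M \<Longrightarrow> ys \<in> lists M \<Longrightarrow>
      \<tau> c (xs @ symD # emb f # symE # ys) = \<tau> c (xs @ emb (d f) # symE # ys)"
    and rel_IRE: "c \<in> K \<Longrightarrow> xs \<in> lists M \<Longrightarrow> ys \<in> lists M \<Longrightarrow>
      \<tau> c (xs @ symI # emb f # symE # ys) = \<tau> c (xs @ emb (J f) # symE # ys)"
    and rel_ERE: "c \<in> K \<Longrightarrow> xs \<in> lists M \<Longrightarrow> ys \<in> lists M \<Longrightarrow>
      \<tau> c (xs @ symE # emb f # symE # ys) = \<tau> c (xs @ emb (ev f) # symE # ys)"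
begin

text \<open>The ring element e is the scalar e times the ring element 1, and \<tau> does not
  distinguish the latter from the empty tensor.\<close>

lemma rep_const_head:
  assumes "c \<in> K" "e \<in> K" "ys \<in> lists M"
  shows "\<tau> c (emb e # ys) = \<tau> (c * e) ys"
  using rep_left [of c e "emb 1" ys] rel_one [of "c * e" "[]" ys] assms by (simp add: emb_simps)

context
  fixes c :: 'a and xs ys :: "'a ido list"
  assumes ctx: "c \<in> K" "xs \<in> lists M" "ys \<in> lists M"
begin

lemma rep_emb_add: "\<tau> c (xs @ emb (f + g) # ys) = \<tau> c (xs @ emb f # ys) + \<tau> c (xs @ emb g # ys)"
  using rep_slot [of c xs "emb f" "emb g" ys] ctx by (simp add: emb_simps)

lemma rep_emb_split: "\<tau> c (xs @ emb f # ys) = \<tau> c (xs @ emb (ev f) # ys) + \<tau> c (xs @ emb (J (d f)) # ys)"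
  by (simp add: ev_decomp flip: rep_emb_add)

lemma rep_const_left: "e \<in> K \<Longrightarrow> m \<in> M \<Longrightarrow> \<tau> c (xs @ m # emb e # ys) = \<tau> c (xs @ ido_ract m e # ys)"
  using rep_middle [of c e xs m "emb 1" ys] rel_one [of c "xs @ [ido_ract m e]" ys] ctx
  by (simp add: emb_simps)

lemma rep_const_right: "e \<in> K \<Longrightarrow> m \<in> M \<Longrightarrow> \<tau> c (xs @ emb e # m # ys) = \<tau> c (xs @ ido_lact e m # ys)"
  using rep_middle [of c e xs "emb 1" m ys] rel_one [of c xs "ido_lact e m # ys"] ctx
  by (simp add: emb_simps)

end

text \<open>The relation for \<partial> f E at f = 1, where d 1 = 0.\<close>

lemma rule_DE:
  assumes "c \<in> K" "xs \<in> lists M" "ys \<in> lists M"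
  shows "\<tau> c (xs @ symD # symE # ys) = 0"
  using rel_one [of c "xs @ [symD]" "symE # ys"] rel_DRE [of c xs ys 1] rep_zero [of c xs "symE # ys"] assms
  by (simp add: emb_simps)

text \<open>Two evaluations of \<integral> \<partial> \<integral>: one by \<partial> \<integral> =
  1, the other by \<integral> \<partial> = 1 - E.\<close>

lemma rule_EI:
  assumes "c \<in> K" "xs \<in> lists M" "ys \<in> lists M"
  shows "\<tau> c (xs @ symE # symI # ys) = 0"
  using rel_ID [of c xs "symI # ys"] rel_DI [of c "xs @ [symI]" ys] assms by simp

lemma rule_ERE:
  assumes "c \<in> K" "xs \<in> lists M" "ys \<in> lists M"
  shows "\<tau> c (xs @ symE # emb f # symE # ys) = \<tau> c (xs @ ido_lact (ev f) symE # ys)"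
  using rel_ERE [of c xs ys f] rep_const_right [of c xs ys "ev f" symE] assms by simp

lemma rule_EE:
  assumes "c \<in> K" "xs \<in> lists M" "ys \<in> lists M"
  shows "\<tau> c (xs @ symE # symE # ys) = \<tau> c (xs @ symE # ys)"
  using rel_one [of c "xs @ [symE]" "symE # ys"] rule_ERE [of c xs ys 1] assms by simp

text \<open>Integration by parts: \<integral> \<partial> f is expanded once by the Leibniz rule and
  once by \<integral> \<partial> = 1 - E.\<close>

lemma rule_IRD:
  assumes "c \<in> K" "xs \<in> lists M" "ys \<in> lists M"
  shows "\<tau> c (xs @ symI # emb f # symD # ys) =
    \<tau> c (xs @ emb f # ys) - \<tau> c (xs @ symE # emb f # ys) - \<tau> c (xs @ symI # emb (d f) # ys)"
  using rel_DR [of c "xs @ [symI]" ys f] rel_ID [of c xs "emb f # ys"] assms by (simp add: algebra_simps)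

text \<open>Two evaluations of \<integral> \<partial> (J f) \<integral>: one by the Leibniz rule
  with d (J f) = f and \<partial> \<integral> = 1, the other by \<integral> \<partial> = 1 -
  E.\<close>

lemma rule_IRI:
  assumes "c \<in> K" "xs \<in> lists M" "ys \<in> lists M"
  shows "\<tau> c (xs @ symI # emb f # symI # ys) =
    \<tau> c (xs @ emb (J f) # symI # ys) - \<tau> c (xs @ symE # emb (J f) # symI # ys) -
    \<tau> c (xs @ symI # emb (J f) # ys)"
proof -
  have "\<tau> c (xs @ symI # symD # emb (J f) # symI # ys) =
      \<tau> c (xs @ symI # emb (J f) # ys) + \<tau> c (xs @ symI # emb f # symI # ys)"
    using rel_DR [of c "xs @ [symI]" "symI # ys" "J f"] rel_DI [of c "xs @ [symI, emb (J f)]" ys] assms by simp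
  with rel_ID [of c xs "emb (J f) # symI # ys"] assms show ?thesis by (simp add: algebra_simps)
qed

lemma rule_IE:
  assumes "c \<in> K" "xs \<in> lists M" "ys \<in> lists M"
  shows "\<tau> c (xs @ symI # symE # ys) = \<tau> c (xs @ emb (J 1) # symE # ys)"
  using rel_one [of c "xs @ [symI]" "symE # ys"] rel_IRE [of c xs ys 1] assms by simp

lemma rule_II:
  assumes "c \<in> K" "xs \<in> lists M" "ys \<in> lists M"
  shows "\<tau> c (xs @ symI # symI # ys) =
    \<tau> c (xs @ emb (J 1) # symI # ys) - \<tau> c (xs @ symE # emb (J 1) # symI # ys) -
    \<tau> c (xs @ symI # emb (J 1) # ys)"
  using rel_one [of c "xs @ [symI]" "symI # ys"] rule_IRI [of c xs ys 1] assms by simp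

end

text \<open>Unlike in the standard tensors, the coefficients \<open>f\<close> and \<open>g\<close> range over the whole ring.\<close>

inductive_set (in integro_differential) full_words :: "'a ido list set" where
  D: "emb f # replicate j symD \<in> full_words"
| I: "[emb f, symI, emb g] \<in> full_words"
| E: "emb f # symE # emb g # replicate j symD \<in> full_words"
| EI: "[emb f, symE, emb (J h), symI, emb g] \<in> full_words"

text \<open>The words behind \<open>standard_tensors\<close>, kept as lists so that maps given on
  words apply to them; scalars are handled separately.\<close>

inductive_set (in integro_differential) standard_words :: "'a ido list set" where
  D: "f \<in> absent_or J \<Longrightarrow> f @ replicate j symD \<in> standard_words"
| I: "f \<in> absent_or J \<Longrightarrow> g \<in> absent_or J \<Longrightarrow> f @ symI # g \<in> standard_words"
| E: "f \<in> absent_or J \<Longrightarrow> g \<in> absent_or J \<Longrightarrow> f @ symE # g @ replicate j symD \<in> standard_words"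
| EI: "f \<in> absent_or J \<Longrightarrow> g \<in> absent_or J \<Longrightarrow> f @ symE # emb (J h) # symI # g \<in> standard_words"

context integro_differential
begin

lemma replicate_M [simp]: "replicate j symD \<in> lists M"
  by (induction j) auto

lemma full_words_M: "w \<in> full_words \<Longrightarrow> w \<in> lists M"
  by (induction rule: full_words.induct) simp_all

lemma absent_or_cases:
  assumes "f \<in> absent_or J" obtains "f = []" | g where "f = [emb (J g)]"
  using assms by (auto simp: absent_or_def)

lemma absent_or_I [simp]: "[] \<in> absent_or J" "[emb (J g)] \<in> absent_or J"
  by (auto simp: absent_or_def)

lemma absent_or_M: "f \<in> absent_or J \<Longrightarrow> f \<in> lists M"
  by (erule absent_or_cases) simp_all

lemma standard_words_M: "w \<in> standard_words \<Longrightarrow> w \<in> lists M"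
  by (induction rule: standard_words.induct) (simp_all add: absent_or_M)

end

text \<open>\<open>N\<close> is later the set of classes represented by combinations of standard
  tensors.\<close>

locale operator_rep_subgroup = operator_rep d J \<tau>
  for d J and \<tau> :: "'a::ring_1 \<Rightarrow> 'a ido list \<Rightarrow> 'b::ab_group_add" +
  fixes N :: "'b set"
  assumes N_zero [simp]: "0 \<in> N" and N_add: "v \<in> N \<Longrightarrow> w \<in> N \<Longrightarrow> v + w \<in> N"
    and N_minus: "v \<in> N \<Longrightarrow> - v \<in> N"
begin

lemma N_diff: "v \<in> N \<Longrightarrow> w \<in> N \<Longrightarrow> v - w \<in> N"
  using N_add [of v "- w"] N_minus [of w] by simp

text \<open>The leading coefficient of a full word is always present, so a ring element merges with
  it, and the other generators are handled by the rules for the first few letters. Only \<integral>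
  in front of f \<partial>^j needs a repeated rule.\<close>

lemma left_mult_full:
  assumes full: "\<And>c w. c \<in> K \<Longrightarrow> w \<in> full_words \<Longrightarrow> \<tau> c w \<in> N"
    and "c \<in> K" "m \<in> M" "w \<in> full_words"
  shows "\<tau> c (m # w) \<in> N"
proof -
  note full' = full [OF _ full_words.D] full [OF _ full_words.I] full [OF _ full_words.E] full [OF _ full_words.EI]
  have DR: "\<tau> e (symD # emb f # ys) = \<tau> e (emb f # symD # ys) + \<tau> e (emb (d f) # ys)"
    if "e \<in> K" "ys \<in> lists M" for e f ys
    using rel_DR [of e "[]" ys f] that by simp
  have IRD: "\<tau> e (symI # emb f # symD # ys) = \<tau> e (emb f # ys) - \<tau> e (symE # emb f # ys) - \<tau> e (symI # emb (d f) # ys)"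
    if "e \<in> K" "ys \<in> lists M" for e f ys
    using rule_IRD [of e "[]" ys f] that by simp
  have one: "\<tau> e (emb 1 # ys) = \<tau> e ys" if "e \<in> K" "ys \<in> lists M" for e ys
    using rel_one [of e "[]" ys] that by simp
  have mR: "\<tau> e (emb f # w) \<in> N" if "e \<in> K" for e f
    using assms(4)
    by cases (use rel_RR [of e "[]" _ f] that full' in simp_all)
  have mE: "\<tau> e (symE # w) \<in> N" if e: "e \<in> K" for e
    using assms(4)
  proof cases
    case (D f j)
    then show ?thesis using full'(3) [of e 1 f j] e by (simp add: one)
  next
    case (I f g)
    \<comment> \<open>The constant part of f moves across E and leaves E \<integral> = 0. So only J
      (d f) remains between E and \<integral>, as the last clause of \<open>full_words\<close>
      demands.\<close>
    have "\<tau> e (symE # emb (ev f) # symI # [emb g]) = \<tau> e (ido_lact (ev f) symE # symI # [emb g])"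
      using rep_const_left [of e "[]" "symI # [emb g]" "ev f" symE] e by (simp add: sym_ract)
    also have "\<dots> = 0"
      using rep_left [of e "ev f" symE "symI # [emb g]"] rule_EI [of "e * ev f" "[]" "[emb g]"] e by simp
    finally have "\<tau> e (symE # w) = \<tau> e (symE # emb (J (d f)) # symI # [emb g])"
      using rep_emb_split [of e "[symE]" "symI # [emb g]" f] e I by simp
    then show ?thesis using full'(4) [of e 1 "d f" g] e by (simp add: one)
  next
    case (E f g j)
    then show ?thesis using rel_ERE [of e "[]" "emb g # replicate j symD" f] e full'(3) by simp
  next
    case (EI f h g)
    then show ?thesis using rel_ERE [of e "[]" "[emb (J h), symI, emb g]" f] e full'(4) by simp
  qed
  have mD: "\<tau> e (symD # w) \<in> N" if e: "e \<in> K" for e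
    using assms(4)
  proof cases
    case (D f j)
    then show ?thesis using e full'(1) [of e f "Suc j"] full'(1) by (simp add: DR N_add)
  next
    case (I f g)
    have "\<tau> e [emb f, symD, symI, emb g] = \<tau> e [emb (f * g)]"
      using rel_DI [of e "[emb f]" "[emb g]"] rel_RR [of e "[]" "[]" f g] e by simp
    then show ?thesis using e I full'(1) [of e "f * g" 0] full'(2) by (simp add: DR N_add)
  next
    case (E f g j)
    then show ?thesis using e rule_DE [of e "[emb f]" "emb g # replicate j symD"] full'(3) by (simp add: DR)
  next
    case (EI f h g)
    then show ?thesis using e rule_DE [of e "[emb f]" "[emb (J h), symI, emb g]"] full'(4) by (simp add: DR)
  qed
  have mI: "\<tau> e (symI # w) \<in> N" if e: "e \<in> K" for e
    using assms(4)
  proof cases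
    case (D f j)
    \<comment> \<open>Integration by parts lowers the power of \<partial> but replaces f by d f,
      hence the induction for arbitrary f.\<close>
    have "\<tau> e (symI # emb f # replicate j symD) \<in> N" for f
    proof (induction j arbitrary: f)
      case 0
      then show ?case using full'(2) [of e 1 f] e by (simp add: one)
    next
      case (Suc j)
      then show ?case using full'(1) [of e f j] full'(3) [of e 1 f j] e by (simp add: IRD one N_diff)
    qed
    then show ?thesis by (simp add: D)
  next
    case (I f g)
    have "\<tau> e [symI, emb (J f), emb g] = \<tau> e [emb 1, symI, emb (J f * g)]"
      using rel_RR [of e "[symI]" "[]" "J f" g] e by (simp add: one)
    then show ?thesis
      using rule_IRI [of e "[]" "[emb g]" f] e full'(2) [of e 1 "J f * g"] full'(2) full'(4) [of e 1 f g]
      by (simp add: I one N_diff)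
  next
    case (E f g j)
    then show ?thesis using rel_IRE [of e "[]" "emb g # replicate j symD" f] e full'(3) by simp
  next
    case (EI f h g)
    then show ?thesis using rel_IRE [of e "[]" "[emb (J h), symI, emb g]" f] e full'(4) by simp
  qed
  obtain f x y z where m: "m = (f, x, y, z)" "x \<in> K" "y \<in> K" "z \<in> K"
    using assms(3) by (cases m) auto
  have w: "w \<in> lists M" by (rule full_words_M [OF assms(4)])
  \<comment> \<open>A letter is the sum of its four components, whose constants are absorbed by the
    scalar in front.\<close>
  have "\<tau> c (m # w) = \<tau> c (emb f # w) + (\<tau> (c * x) (symD # w) + (\<tau> (c * y) (symI # w) + \<tau> (c * z) (symE # w)))"
    using rep_slot [of c "[]"] assms(2) m w by (simp add: ido_decomp rep_left)
  then show ?thesis using mR mD mI mE assms(2) m by (simp add: N_add)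
qed

text \<open>Each coefficient is split by \<open>ev_decomp\<close>. The part in the image of
  \<open>J\<close> is a standard factor; the constant part leaves the factor absent and moves to the
  left, into the scalar or into the nearest coefficient before it.\<close>

lemma full_if_standard:
  assumes std: "\<And>c w. c \<in> K \<Longrightarrow> w \<in> standard_words \<Longrightarrow> \<tau> c w \<in> N"
    and "c \<in> K" "w \<in> full_words"
  shows "\<tau> c w \<in> N"
proof -
  have head: "\<tau> e (emb f # ys) \<in> N"
    if "\<And>e f. e \<in> K \<Longrightarrow> f \<in> absent_or J \<Longrightarrow> \<tau> e (f @ ys) \<in> N" "e \<in> K" "ys \<in> lists M" for e f ys
    using rep_emb_split [of e "[]" ys f] rep_const_head [of e "ev f" ys]
      that(1) [of "e * ev f" "[]"] that(1) [of e "[emb (J (d f))]"] that(2,3)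
    by (simp add: N_add)
  have slot: "\<tau> e (f @ s # emb g # ys) \<in> N"
    if std': "\<And>e f g. e \<in> K \<Longrightarrow> f \<in> absent_or J \<Longrightarrow> g \<in> absent_or J \<Longrightarrow> \<tau> e (f @ s # g @ ys) \<in> N"
      and "e \<in> K" "f \<in> absent_or J" "ys \<in> lists M" "s \<in> {symI, symE}" for e f g s ys
  proof -
    have s: "s \<in> M" "ido_ract s (ev g) = ido_lact (ev g) s" using that(5) by (auto simp: sym_ract)
    have "\<tau> e (f @ s # emb (ev g) # ys) = \<tau> e (f @ ido_lact (ev g) s # ys)"
      using rep_const_left [of e f ys "ev g" s] that s by (simp add: absent_or_M)
    also have "\<dots> \<in> N"
      using that(3)
    proof (cases rule: absent_or_cases)
      case 1
      then show ?thesis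
        using rep_left [of e "ev g" s ys] std' [of "e * ev g" "[]" "[]"] that(2,4) s by simp
    next
      case (2 h)
      \<comment> \<open>The constant that crossed \<open>s\<close> is absorbed by the coefficient in
        front, which stays in the image of \<open>J\<close> because J h c = J (h c).\<close>
      have "\<tau> e (f @ ido_lact (ev g) s # ys) = \<tau> e ([emb (J (h * ev g))] @ s # [] @ ys)"
        using rep_middle [of e "ev g" "[]" "emb (J h)" s ys] that(2,4) s 2 by (simp add: emb_simps J_const)
      then show ?thesis using std' [of e "[emb (J (h * ev g))]" "[]"] that(2) by simp
    qed
    finally show ?thesis
      using rep_emb_split [of e "f @ [s]" ys g] std' [OF that(2,3), of "[emb (J (d g))]"] that(2,3,4) s
      by (simp add: N_add absent_or_M)
  qed
  from assms(3) show ?thesis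
  proof cases
    case (D f j)
    then show ?thesis using head assms(2) std [OF _ standard_words.D] by simp
  next
    case (I f g)
    have "\<tau> e (f @ [symI, emb g]) \<in> N" if "e \<in> K" "f \<in> absent_or J" for e f
      using slot [of symI "[]"] that std [OF _ standard_words.I] by simp
    then show ?thesis using head [of "[symI, emb g]"] assms(2) I by simp
  next
    case (E f g j)
    have "\<tau> e (f @ symE # emb g # replicate j symD) \<in> N" if "e \<in> K" "f \<in> absent_or J" for e f
      using slot [of symE "replicate j symD"] that std [OF _ standard_words.E] by simp
    then show ?thesis using head [of "symE # emb g # replicate j symD"] assms(2) E by simp
  next
    case (EI f h g)
    have "\<tau> e (f @ [symE, emb (J h), symI, emb g]) \<in> N" if e: "e \<in> K" and f: "f \<in> absent_or J" for e f
    proof -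
      let ?xs = "f @ [symE]"
      \<comment> \<open>The constant part of g crosses \<integral> and is absorbed by J h.\<close>
      have "\<tau> e (?xs @ [emb (J h), symI, emb (ev g)]) = \<tau> e (?xs @ [emb (J h), ido_lact (ev g) symI])"
        using rep_const_left [of e "?xs @ [emb (J h)]" "[]" "ev g" symI] e f by (simp add: sym_ract absent_or_M)
      also have "\<dots> = \<tau> e (?xs @ [emb (J (h * ev g)), symI])"
        using rep_middle [of e "ev g" ?xs "emb (J h)" symI "[]"] e f
        by (simp add: emb_simps J_const absent_or_M)
      also have "\<dots> \<in> N"
        using std [OF e standard_words.EI [OF f, of "[]"]] by simp
      finally show ?thesis
        using rep_emb_split [of e "?xs @ [emb (J h), symI]" "[]" g] e f
          std [OF e standard_words.EI [OF f, of "[emb (J (d g))]"]]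
        by (simp add: N_add absent_or_M)
    qed
    then show ?thesis using head [of "[symE, emb (J h), symI, emb g]"] assms(2) EI by simp
  qed
qed

end

section \<open>Independence of the standard tensors\<close>

text \<open>The constructors stand for \<open>f \<partial>\<^sup>j\<close>, \<open>f \<integral> g\<close>, \<open>f E g \<partial>\<^sup>j\<close> and \<open>f E h \<integral> g\<close>, where in contrast to
  the standard tensors \<open>f\<close>, \<open>g\<close>, \<open>h\<close> are arbitrary.  Left multiplication of these expressions by the
  generators is represented by its transpose, a right action on functions of the expressions.  In this way
  no quotient of the expressions is needed: it suffices to consider additive and balanced functions.\<close>

datatype 'a shape = SD 'a nat | SI 'a 'a | SE 'a 'a nat | SEI 'a 'a 'a

primrec lmul :: "'a::ring_1 \<Rightarrow> 'a shape \<Rightarrow> 'a shape" where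
  "lmul r (SD f j) = SD (r * f) j"
| "lmul r (SI f g) = SI (r * f) g"
| "lmul r (SE f g j) = SE (r * f) g j"
| "lmul r (SEI f h g) = SEI (r * f) h g"

lemma lmul_mult: "lmul (a * b) s = lmul a (lmul b s)"
  by (cases s) (simp_all add: mult.assoc)

lemma lmul_one [simp]: "lmul 1 s = s"
  by (cases s) simp_all

section \<open>Transposed left multiplication on shapes\<close>

context integro_differential
begin

text \<open>\<open>actD \<phi> s\<close> is the value of \<phi> at \<partial> s, for instance
  \<partial> f \<integral> g = (d f) \<integral> g + f g. In front of E there is no second term
  because \<partial> E = 0.\<close>

primrec actD :: "('a shape \<Rightarrow> 'b::ab_group_add) \<Rightarrow> 'a shape \<Rightarrow> 'b" where
  "actD \<phi> (SD f j) = \<phi> (SD (d f) j) + \<phi> (SD f (Suc j))"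
| "actD \<phi> (SI f g) = \<phi> (SI (d f) g) + \<phi> (SD (f * g) 0)"
| "actD \<phi> (SE f g j) = \<phi> (SE (d f) g j)"
| "actD \<phi> (SEI f h g) = \<phi> (SEI (d f) h g)"

text \<open>Between E and \<integral> only the part of f in the image of \<open>J\<close> survives,
  since constants move out and leave E \<integral> = 0.\<close>

primrec actE :: "('a shape \<Rightarrow> 'b::ab_group_add) \<Rightarrow> 'a shape \<Rightarrow> 'b" where
  "actE \<phi> (SD f j) = \<phi> (SE 1 f j)"
| "actE \<phi> (SI f g) = \<phi> (SEI 1 (J (d f)) g)"
| "actE \<phi> (SE f g j) = \<phi> (SE (ev f) g j)"
| "actE \<phi> (SEI f h g) = \<phi> (SEI (ev f) h g)"

text \<open>The value of \<phi> at \<integral> f \<partial>^j, obtained by integrating by parts j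
  times.\<close>

primrec intD :: "('a shape \<Rightarrow> 'b::ab_group_add) \<Rightarrow> nat \<Rightarrow> 'a \<Rightarrow> 'b" where
  "intD \<phi> 0 f = \<phi> (SI 1 f)"
| "intD \<phi> (Suc j) f = \<phi> (SD f j) - \<phi> (SE 1 f j) - intD \<phi> j (d f)"

primrec actI :: "('a shape \<Rightarrow> 'b::ab_group_add) \<Rightarrow> 'a shape \<Rightarrow> 'b" where
  "actI \<phi> (SD f j) = intD \<phi> j f"
| "actI \<phi> (SI f g) = \<phi> (SI (J f) g) - \<phi> (SEI 1 (J f) g) - \<phi> (SI 1 (J f * g))"
| "actI \<phi> (SE f g j) = \<phi> (SE (J f) g j)"
| "actI \<phi> (SEI f h g) = \<phi> (SEI (J f) h g)"

text \<open>These are the additive maps on a direct sum of copies of R and of its twofold and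
  threefold tensor products over the constants, which is the module on which the operators
  act.\<close>

definition balanced :: "('a shape \<Rightarrow> 'b::ab_group_add) \<Rightarrow> bool" where
  "balanced \<phi> \<longleftrightarrow>
    (\<forall>f f' j. \<phi> (SD (f + f') j) = \<phi> (SD f j) + \<phi> (SD f' j)) \<and>
    (\<forall>f f' g. \<phi> (SI (f + f') g) = \<phi> (SI f g) + \<phi> (SI f' g)) \<and>
    (\<forall>f g g'. \<phi> (SI f (g + g')) = \<phi> (SI f g) + \<phi> (SI f g')) \<and>
    (\<forall>f f' g j. \<phi> (SE (f + f') g j) = \<phi> (SE f g j) + \<phi> (SE f' g j)) \<and>
    (\<forall>f g g' j. \<phi> (SE f (g + g') j) = \<phi> (SE f g j) + \<phi> (SE f g' j)) \<and>
    (\<forall>f f' h g. \<phi> (SEI (f + f') h g) = \<phi> (SEI f h g) + \<phi> (SEI f' h g)) \<and>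
    (\<forall>f h h' g. \<phi> (SEI f (h + h') g) = \<phi> (SEI f h g) + \<phi> (SEI f h' g)) \<and>
    (\<forall>f h g g'. \<phi> (SEI f h (g + g')) = \<phi> (SEI f h g) + \<phi> (SEI f h g')) \<and>
    (\<forall>c\<in>K. \<forall>f g. \<phi> (SI (f * c) g) = \<phi> (SI f (c * g))) \<and>
    (\<forall>c\<in>K. \<forall>f g j. \<phi> (SE (f * c) g j) = \<phi> (SE f (c * g) j)) \<and>
    (\<forall>c\<in>K. \<forall>f h g. \<phi> (SEI (f * c) h g) = \<phi> (SEI f (c * h) g)) \<and>
    (\<forall>c\<in>K. \<forall>f h g. \<phi> (SEI f (h * c) g) = \<phi> (SEI f h (c * g)))"

lemma balancedD:
  assumes "balanced \<phi>"
  shows "\<phi> (SD (f + f') j) = \<phi> (SD f j) + \<phi> (SD f' j)"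
    "\<phi> (SI (f + f') g) = \<phi> (SI f g) + \<phi> (SI f' g)"
    "\<phi> (SI f (g + g')) = \<phi> (SI f g) + \<phi> (SI f g')"
    "\<phi> (SE (f + f') g j) = \<phi> (SE f g j) + \<phi> (SE f' g j)"
    "\<phi> (SE f (g + g') j) = \<phi> (SE f g j) + \<phi> (SE f g' j)"
    "\<phi> (SEI (f + f') h g) = \<phi> (SEI f h g) + \<phi> (SEI f' h g)"
    "\<phi> (SEI f (h + h') g) = \<phi> (SEI f h g) + \<phi> (SEI f h' g)"
    "\<phi> (SEI f h (g + g')) = \<phi> (SEI f h g) + \<phi> (SEI f h g')"
    "c \<in> K \<Longrightarrow> \<phi> (SI (f * c) g) = \<phi> (SI f (c * g))"
    "c \<in> K \<Longrightarrow> \<phi> (SE (f * c) g j) = \<phi> (SE f (c * g) j)"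
    "c \<in> K \<Longrightarrow> \<phi> (SEI (f * c) h g) = \<phi> (SEI f (c * h) g)"
    "c \<in> K \<Longrightarrow> \<phi> (SEI f (h * c) g) = \<phi> (SEI f h (c * g))"
  using assms unfolding balanced_def by simp_all

lemma balanced_const:
  assumes "balanced \<phi>" "c \<in> K"
  shows "\<phi> (SI c g) = \<phi> (SI 1 (c * g))"
    "\<phi> (SE c g j) = \<phi> (SE 1 (c * g) j)"
    "\<phi> (SEI c h g) = \<phi> (SEI 1 (c * h) g)"
  using balancedD(9-11) [OF assms, of 1] by simp_all

lemma balanced_zero:
  assumes "balanced \<phi>"
  shows "\<phi> (SD 0 j) = 0" "\<phi> (SI 0 g) = 0" "\<phi> (SE 0 g j) = 0" "\<phi> (SEI 0 h g) = 0"
    "\<phi> (lmul 0 s) = 0"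
proof -
  show z: "\<phi> (SD 0 j) = 0" "\<phi> (SI 0 g) = 0" "\<phi> (SE 0 g j) = 0" "\<phi> (SEI 0 h g) = 0" for j g h
    using balancedD(1,2,4,6) [OF assms, of 0 0] by simp_all
  show "\<phi> (lmul 0 s) = 0" by (cases s) (simp_all add: z)
qed

lemma balanced_lmul_add:
  assumes "balanced \<phi>"
  shows "\<phi> (lmul (a + b) s) = \<phi> (lmul a s) + \<phi> (lmul b s)"
  by (cases s) (simp_all add: distrib_right balancedD [OF assms])

lemma balanced_lmul: "balanced \<phi> \<Longrightarrow> balanced (\<lambda>s. \<phi> (lmul r s))"
  unfolding balanced_def by (simp add: distrib_left flip: mult.assoc)

lemma balanced_add: "balanced \<phi> \<Longrightarrow> balanced \<psi> \<Longrightarrow> balanced (\<lambda>s. \<phi> s + \<psi> s)"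
  unfolding balanced_def by (simp add: algebra_simps)

lemma balanced_actD: "balanced \<phi> \<Longrightarrow> balanced (actD \<phi>)"
  unfolding balanced_def [of "actD \<phi>"]
  by (simp add: balancedD d_add d_const_mult distrib_left distrib_right mult.assoc)

lemma balanced_actE: "balanced \<phi> \<Longrightarrow> balanced (actE \<phi>)"
  unfolding balanced_def [of "actE \<phi>"]
  by (simp add: balancedD d_add J_add ev_add d_const_mult ev_const_mult J_const)

lemma intD_add: "balanced \<phi> \<Longrightarrow> intD \<phi> j (f + g) = intD \<phi> j f + intD \<phi> j g"
  by (induction j arbitrary: f g) (simp_all add: balancedD d_add)

lemma balanced_actI: "balanced \<phi> \<Longrightarrow> balanced (actI \<phi>)"
  unfolding balanced_def [of "actI \<phi>"]
  by (simp add: balancedD J_add J_const intD_add distrib_left distrib_right mult.assoc)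

text \<open>The two sides evaluate \<phi> at e \<partial> s and at \<partial> e s: the generator
  commutes with constants. The same is done for E and \<integral> below, where the constant crosses
  the symbol by balancedness.\<close>

lemma actD_lmul:
  "balanced \<phi> \<Longrightarrow> e \<in> K \<Longrightarrow> actD (\<lambda>s. \<phi> (lmul e s)) s = actD \<phi> (lmul e s)"
  by (cases s) (simp_all add: d_const_mult mult.assoc)

lemma actE_lmul:
  "balanced \<phi> \<Longrightarrow> e \<in> K \<Longrightarrow> actE (\<lambda>s. \<phi> (lmul e s)) s = actE \<phi> (lmul e s)"
  by (cases s) (simp_all add: d_const_mult J_const ev_const_mult balanced_const [of _ e])

lemma intD_lmul:
  "balanced \<phi> \<Longrightarrow> e \<in> K \<Longrightarrow> intD (\<lambda>s. \<phi> (lmul e s)) j f = intD \<phi> j (e * f)"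
  by (induction j arbitrary: f) (simp_all add: d_const_mult balanced_const [of _ e])

lemma actI_lmul:
  "balanced \<phi> \<Longrightarrow> e \<in> K \<Longrightarrow> actI (\<lambda>s. \<phi> (lmul e s)) s = actI \<phi> (lmul e s)"
  by (cases s) (simp_all add: J_const balanced_const [of _ e] intD_lmul mult.assoc)

fun act :: "'a ido \<Rightarrow> ('a shape \<Rightarrow> 'b::ab_group_add) \<Rightarrow> 'a shape \<Rightarrow> 'b" where
  "act (r, x, y, z) \<phi> = (\<lambda>s. \<phi> (lmul r s) + actD (\<lambda>s. \<phi> (lmul x s)) s +
     actI (\<lambda>s. \<phi> (lmul y s)) s + actE (\<lambda>s. \<phi> (lmul z s)) s)"

text \<open>Transposition reverses the order: the leftmost letter modifies \<phi> first, so that the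
  rightmost letter is the first to act on the shape.\<close>

primrec run :: "('a shape \<Rightarrow> 'b::ab_group_add) \<Rightarrow> 'a ido list \<Rightarrow> 'a shape \<Rightarrow> 'b" where
  "run \<phi> [] = \<phi>"
| "run \<phi> (m # ms) = run (act m \<phi>) ms"

lemma run_append: "run \<phi> (xs @ ys) = run (run \<phi> xs) ys"
  by (induction xs arbitrary: \<phi>) simp_all

lemma balanced_act: "balanced \<phi> \<Longrightarrow> balanced (act m \<phi>)"
  by (cases m) (simp add: balanced_add balanced_lmul balanced_actD balanced_actI balanced_actE)

lemma balanced_run: "balanced \<phi> \<Longrightarrow> balanced (run \<phi> ms)"
  by (induction ms arbitrary: \<phi>) (simp_all add: balanced_act)

lemma actD_plus: "actD (\<lambda>s. \<phi> s + \<psi> s) s = actD \<phi> s + actD \<psi> s"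
  by (cases s) (simp_all add: algebra_simps)

lemma actE_plus: "actE (\<lambda>s. \<phi> s + \<psi> s) s = actE \<phi> s + actE \<psi> s"
  by (cases s) simp_all

lemma intD_plus: "intD (\<lambda>s. \<phi> s + \<psi> s) j f = intD \<phi> j f + intD \<psi> j f"
  by (induction j arbitrary: f) (simp_all add: algebra_simps)

lemma actI_plus: "actI (\<lambda>s. \<phi> s + \<psi> s) s = actI \<phi> s + actI \<psi> s"
  by (cases s) (simp_all add: intD_plus algebra_simps)

lemma act_plus: "act m (\<lambda>s. \<phi> s + \<psi> s) = (\<lambda>s. act m \<phi> s + act m \<psi> s)"
  by (cases m) (simp add: actD_plus actE_plus actI_plus algebra_simps)

lemma run_plus: "run (\<lambda>s. \<phi> s + \<psi> s) ms = (\<lambda>s. run \<phi> ms s + run \<psi> ms s)"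
  by (induction ms arbitrary: \<phi> \<psi>) (simp_all add: act_plus)

lemma run_diff: "run (\<lambda>s. \<phi> s - \<psi> s) ms = (\<lambda>s. run \<phi> ms s - run \<psi> ms s)"
  using run_plus [of "\<lambda>s. \<phi> s - \<psi> s" \<psi> ms] by (simp add: fun_eq_iff algebra_simps)

lemma act_add:
  assumes "balanced \<phi>"
  shows "act (m + m') \<phi> = (\<lambda>s. act m \<phi> s + act m' \<phi> s)"
  by (cases m; cases m')
    (simp add: balanced_lmul_add [OF assms] actD_plus actE_plus actI_plus algebra_simps)

lemma act_left: "act (ido_lact e m) \<phi> = act m (\<lambda>s. \<phi> (lmul e s))"
  by (cases m) (simp add: lmul_mult)

lemma act_right:
  assumes "balanced \<phi>" "e \<in> K"
  shows "act (ido_ract m e) \<phi> = (\<lambda>s. act m \<phi> (lmul e s))"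
proof -
  obtain r x y z where m: "m = (r, x, y, z)" by (cases m)
  have "balanced (\<lambda>s. \<phi> (lmul a s))" for a using assms(1) by (rule balanced_lmul)
  from actD_lmul [OF this assms(2)] actE_lmul [OF this assms(2)] actI_lmul [OF this assms(2)]
  show ?thesis by (simp add: m lmul_mult fun_eq_iff)
qed

lemma act_zero: "actD (\<lambda>s. 0) s = 0" "actE (\<lambda>s. 0) s = 0" "actI (\<lambda>s. 0) s = 0"
  using actD_plus [of "\<lambda>s. 0" "\<lambda>s. 0" s] actE_plus [of "\<lambda>s. 0" "\<lambda>s. 0" s] actI_plus [of "\<lambda>s. 0" "\<lambda>s. 0" s]
  by simp_all

lemma act_generators:
  assumes "balanced \<phi>"
  shows "act (emb f) \<phi> = (\<lambda>s. \<phi> (lmul f s))" "act symD \<phi> = actD \<phi>" "act symI \<phi> = actI \<phi>" "act symE \<phi> = actE \<phi>"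
  by (simp_all add: emb_def symD_def symI_def symE_def balanced_zero [OF assms] act_zero fun_eq_iff)

lemma actDR:
  assumes "balanced \<phi>"
  shows "actD \<phi> (lmul f s) = actD (\<lambda>s. \<phi> (lmul f s)) s + \<phi> (lmul (d f) s)"
  by (cases s) (simp_all add: d_mult balancedD [OF assms] mult.assoc algebra_simps)

text \<open>In view of the reversed order this is \<partial> \<integral> = 1.\<close>

lemma actDI:
  assumes "balanced \<phi>"
  shows "actI (actD \<phi>) = \<phi>"
proof (rule ext)
  fix s
  \<comment> \<open>In the step, \<partial> f \<partial>^j contributes (d f) \<partial>^j, which the
    induction hypothesis for d f cancels.\<close>
  have "intD (actD \<phi>) j f = \<phi> (SD f j)" for j f
    by (induction j arbitrary: f) (simp_all add: balanced_zero [OF assms])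
  then show "actI (actD \<phi>) s = \<phi> s" by (cases s) (simp_all add: balanced_zero [OF assms])
qed

text \<open>This is \<integral> \<partial> = 1 - E. On f \<integral> g it amounts to J (d f)
  \<integral> g + \<integral> (f - J (d f)) g = f \<integral> g, which holds because the constant ev
  f = f - J (d f) commutes with \<integral>.\<close>

lemma actID:
  assumes "balanced \<phi>"
  shows "actD (actI \<phi>) = (\<lambda>s. \<phi> s - actE \<phi> s)"
proof (rule ext)
  fix s
  show "actD (actI \<phi>) s = \<phi> s - actE \<phi> s"
  proof (cases s)
  case (SI f g)
  have "\<phi> (SI f g) = \<phi> (SI (ev f) g) + \<phi> (SI (J (d f)) g)"
    by (simp add: ev_decomp flip: balancedD(2) [OF assms])
  moreover have "\<phi> (SI 1 (f * g)) = \<phi> (SI 1 (ev f * g)) + \<phi> (SI 1 (J (d f) * g))"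
    by (simp add: ev_decomp flip: balancedD(3) [OF assms] distrib_right)
  ultimately show ?thesis
    using balanced_const(1) [OF assms, of "ev f" g] by (simp add: SI)
next
  case (SE f g j)
  have "\<phi> (SE f g j) = \<phi> (SE (ev f) g j) + \<phi> (SE (J (d f)) g j)"
    by (simp add: ev_decomp flip: balancedD(4) [OF assms])
  then show ?thesis by (simp add: SE)
next
  case (SEI f h g)
  have "\<phi> (SEI f h g) = \<phi> (SEI (ev f) h g) + \<phi> (SEI (J (d f)) h g)"
    by (simp add: ev_decomp flip: balancedD(6) [OF assms])
  then show ?thesis by (simp add: SEI)
qed simp
qed

text \<open>E s always begins with a constant coefficient followed by E. So \<partial> f in front of
  it only differentiates f, and the constant passes through. The next two lemmas rest on the same
  fact.\<close>

lemma actDRE: "actE (\<lambda>s. actD \<phi> (lmul f s)) = actE (\<lambda>s. \<phi> (lmul (d f) s))"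
proof
  fix s show "(actE (\<lambda>s. actD \<phi> (lmul f s))) s = (actE (\<lambda>s. \<phi> (lmul (d f) s))) s"
    by (cases s) (simp_all add: d_const_mult)
qed

lemma actIRE: "actE (\<lambda>s. actI \<phi> (lmul f s)) = actE (\<lambda>s. \<phi> (lmul (J f) s))"
proof
  fix s show "(actE (\<lambda>s. actI \<phi> (lmul f s))) s = (actE (\<lambda>s. \<phi> (lmul (J f) s))) s"
    by (cases s) (simp_all add: J_const)
qed

lemma actERE: "actE (\<lambda>s. actE \<phi> (lmul f s)) = actE (\<lambda>s. \<phi> (lmul (ev f) s))"
proof
  fix s show "(actE (\<lambda>s. actE \<phi> (lmul f s))) s = (actE (\<lambda>s. \<phi> (lmul (ev f) s))) s"
    by (cases s) (simp_all add: ev_const_mult)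
qed

text \<open>Evaluates \<phi> at the result of letting the scaled word act on the unit, which as a
  shape is \<open>SD 1 0\<close>.\<close>

definition representation :: "('a shape \<Rightarrow> 'b::ab_group_add) \<Rightarrow> 'a \<Rightarrow> 'a ido list \<Rightarrow> 'b" where
  "representation \<phi> c ms = run (\<lambda>s. \<phi> (lmul c s)) ms (SD 1 0)"

text \<open>A relation inside a word becomes an identity between transposed operators, applied to
  the \<open>run\<close> of the prefix, which is again balanced; the suffix is then run on both
  sides.\<close>

lemma operator_rep_representation:
  assumes "balanced \<phi>"
  shows "operator_rep d J (representation \<phi>)"
proof -
  have bal: "balanced (run (\<lambda>s. \<phi> (lmul c s)) xs)" for c xs
    by (intro balanced_run balanced_lmul assms)
  show ?thesis
  proof
    show "tensor_map (representation \<phi>)"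
      unfolding tensor_map_def representation_def
    proof (intro conjI ballI)
      show "run (\<lambda>s. \<phi> (lmul (c + c') s)) xs (SD 1 0) =
          run (\<lambda>s. \<phi> (lmul c s)) xs (SD 1 0) + run (\<lambda>s. \<phi> (lmul c' s)) xs (SD 1 0)" for c c' xs
        by (simp add: balanced_lmul_add [OF assms] run_plus)
      show "run (\<lambda>s. \<phi> (lmul c s)) (xs @ (m + m') # ys) (SD 1 0) =
          run (\<lambda>s. \<phi> (lmul c s)) (xs @ m # ys) (SD 1 0) + run (\<lambda>s. \<phi> (lmul c s)) (xs @ m' # ys) (SD 1 0)"
        for c xs m m' ys
        by (simp add: run_append act_add [OF bal] run_plus)
      show "run (\<lambda>s. \<phi> (lmul (c * e) s)) (m # ys) (SD 1 0) =
          run (\<lambda>s. \<phi> (lmul c s)) (ido_lact e m # ys) (SD 1 0)" for c e m ys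
        by (simp add: act_left lmul_mult)
      show "run (\<lambda>s. \<phi> (lmul c s)) (xs @ ido_ract m e # m' # ys) (SD 1 0) =
          run (\<lambda>s. \<phi> (lmul c s)) (xs @ m # ido_lact e m' # ys) (SD 1 0)" if "e \<in> K" for c e xs m m' ys
        by (simp add: run_append act_left act_right [OF bal that])
    qed
  next
    fix c :: 'a and xs ys :: "'a ido list" and f :: 'a
    let ?\<psi> = "run (\<lambda>s. \<phi> (lmul c s)) xs"
    note act = act_generators [OF bal [of c xs]] act_generators [OF balanced_lmul [OF bal [of c xs]]]
      act_generators [OF balanced_actD [OF bal [of c xs]]] act_generators [OF balanced_actI [OF bal [of c xs]]]
      act_generators [OF balanced_actE [OF bal [of c xs]]]
      act_generators [OF balanced_lmul [OF balanced_actD [OF bal [of c xs]]]]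
      act_generators [OF balanced_lmul [OF balanced_actI [OF bal [of c xs]]]]
      act_generators [OF balanced_lmul [OF balanced_actE [OF bal [of c xs]]]]
    have run: "representation \<phi> c (xs @ zs) = run ?\<psi> zs (SD 1 0)" for zs
      by (simp add: representation_def run_append)
    show "representation \<phi> c (xs @ emb 1 # ys) = representation \<phi> c (xs @ ys)"
      by (simp add: run act)
    show "representation \<phi> c (xs @ emb f # emb g # ys) = representation \<phi> c (xs @ emb (f * g) # ys)" for g
      by (simp add: run act lmul_mult)
    show "representation \<phi> c (xs @ symD # emb f # ys) =
        representation \<phi> c (xs @ emb f # symD # ys) + representation \<phi> c (xs @ emb (d f) # ys)"
      by (simp add: run act actDR [OF bal] run_plus)
    show "representation \<phi> c (xs @ symD # symI # ys) = representation \<phi> c (xs @ ys)"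
      by (simp add: run act actDI [OF bal])
    show "representation \<phi> c (xs @ symI # symD # ys) = representation \<phi> c (xs @ ys) - representation \<phi> c (xs @ symE # ys)"
      by (simp add: run act actID [OF bal] run_diff)
    show "representation \<phi> c (xs @ symD # emb f # symE # ys) = representation \<phi> c (xs @ emb (d f) # symE # ys)"
      by (simp add: run act actDRE)
    show "representation \<phi> c (xs @ symI # emb f # symE # ys) = representation \<phi> c (xs @ emb (J f) # symE # ys)"
      by (simp add: run act actIRE)
    show "representation \<phi> c (xs @ symE # emb f # symE # ys) = representation \<phi> c (xs @ emb (ev f) # symE # ys)"
      by (simp add: run act actERE)
  qed
qed

end

section \<open>Reading shapes back as tensors\<close>

context tensor_rep
begin

text \<open>In the tensor ring the coefficient \<open>f\<close> of a standard tensor has to be split into its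
  constant part, which is moved to the left, and its part in the image of \<open>J\<close>.\<close>

definition coeff :: "'a \<Rightarrow> 'a ido list \<Rightarrow> 'b" where
  "coeff f ms = \<tau> (ev f) ms + \<tau> 1 (emb (J (d f)) # ms)"

text \<open>The last coefficient g is split as well. Its constant part is attached to the symbol on
  its left, so that the factor g is absent in that summand; the middle coefficient h is kept
  whole.\<close>

primrec canonical :: "'a shape \<Rightarrow> 'b" where
  "canonical (SD f j) = coeff f (replicate j symD)"
| "canonical (SI f g) = coeff f [ido_lact (ev g) symI] + coeff f [symI, emb (J (d g))]"
| "canonical (SE f g j) = coeff f (ido_lact (ev g) symE # replicate j symD) +
     coeff f (symE # emb (J (d g)) # replicate j symD)"
| "canonical (SEI f h g) = coeff f [symE, emb h, ido_lact (ev g) symI] +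
     coeff f [symE, emb h, symI, emb (J (d g))]"

lemma coeff_add: "ms \<in> lists M \<Longrightarrow> coeff (f + f') ms = coeff f ms + coeff f' ms"
  using rep_slot [of 1 "[]" "emb (J (d f))" "emb (J (d f'))" ms]
  by (simp add: coeff_def ev_add d_add J_add emb_simps rep_scalar algebra_simps)

lemma coeff_slot:
  "xs \<in> lists M \<Longrightarrow> m \<in> M \<Longrightarrow> m' \<in> M \<Longrightarrow> ys \<in> lists M \<Longrightarrow>
    coeff f (xs @ (m + m') # ys) = coeff f (xs @ m # ys) + coeff f (xs @ m' # ys)"
  using rep_slot [of 1 "emb (J (d f)) # xs" m m' ys]
  by (simp add: coeff_def rep_slot algebra_simps)

lemma coeff_middle:
  "e \<in> K \<Longrightarrow> xs \<in> lists M \<Longrightarrow> m \<in> M \<Longrightarrow> m' \<in> M \<Longrightarrow> ys \<in> lists M \<Longrightarrow>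
    coeff f (xs @ ido_ract m e # m' # ys) = coeff f (xs @ m # ido_lact e m' # ys)"
  using rep_middle [of 1 e "emb (J (d f)) # xs" m m' ys]
  by (simp add: coeff_def rep_middle)

lemma coeff_left:
  "e \<in> K \<Longrightarrow> m \<in> M \<Longrightarrow> ys \<in> lists M \<Longrightarrow> coeff (f * e) (m # ys) = coeff f (ido_lact e m # ys)"
  using rep_middle [of 1 e "[]" "emb (J (d f))" m ys]
  by (simp add: coeff_def ev_const_mult d_const_mult J_const emb_simps rep_left)

text \<open>Additivity and balancedness in the arguments of a shape are instances of the tensor
  relations satisfied by \<tau>, at the explicit positions that occur in
  \<open>canonical\<close>.\<close>

lemma balanced_canonical: "balanced canonical"
proof -
  have lact: "ido_lact (a + b) m = ido_lact a m + ido_lact b m"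
    "ido_lact (a * b) m = ido_lact a (ido_lact b m)" for a b :: 'a and m
    by (cases m; simp add: algebra_simps)+
  have J: "J (d (g + g')) = J (d g) + J (d g')" "c \<in> K \<Longrightarrow> J (d (c * g)) = c * J (d g)" for c g g'
    by (simp_all add: d_add J_add d_const_mult J_const)
  have slot:
    "m \<in> M \<Longrightarrow> m' \<in> M \<Longrightarrow> ys \<in> lists M \<Longrightarrow> coeff f ((m + m') # ys) = coeff f (m # ys) + coeff f (m' # ys)"
    "x \<in> M \<Longrightarrow> m \<in> M \<Longrightarrow> m' \<in> M \<Longrightarrow> ys \<in> lists M \<Longrightarrow>
      coeff f (x # (m + m') # ys) = coeff f (x # m # ys) + coeff f (x # m' # ys)"
    "x \<in> M \<Longrightarrow> y \<in> M \<Longrightarrow> m \<in> M \<Longrightarrow> m' \<in> M \<Longrightarrow> ys \<in> lists M \<Longrightarrow>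
      coeff f (x # y # (m + m') # ys) = coeff f (x # y # m # ys) + coeff f (x # y # m' # ys)"
    "x \<in> M \<Longrightarrow> y \<in> M \<Longrightarrow> z \<in> M \<Longrightarrow> m \<in> M \<Longrightarrow> m' \<in> M \<Longrightarrow> ys \<in> lists M \<Longrightarrow>
      coeff f (x # y # z # (m + m') # ys) = coeff f (x # y # z # m # ys) + coeff f (x # y # z # m' # ys)"
    for f m m' x y z ys
    using coeff_slot [of "[]"] coeff_slot [of "[x]"] coeff_slot [of "[x, y]"] coeff_slot [of "[x, y, z]"]
    by simp_all
  have middle: "coeff f (ido_lact c s # m # ys) = coeff f (s # ido_lact c m # ys)"
    if "c \<in> K" "s \<in> {symI, symE}" "m \<in> M" "ys \<in> lists M" for c s f m ys
    using coeff_middle [of c "[]" s m ys f] that by (auto simp: sym_ract)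
  have middleI:
    "c \<in> K \<Longrightarrow> m \<in> M \<Longrightarrow> coeff f [symE, emb (h * c), m] = coeff f [symE, emb h, ido_lact c m]"
    "c \<in> K \<Longrightarrow> m \<in> M \<Longrightarrow> m' \<in> M \<Longrightarrow>
      coeff f [symE, emb (h * c), m, m'] = coeff f [symE, emb h, ido_lact c m, m']"
    "c \<in> K \<Longrightarrow> m \<in> M \<Longrightarrow>
      coeff f [symE, emb h, ido_lact c symI, m] = coeff f [symE, emb h, symI, ido_lact c m]"
    for c f h m m'
    using coeff_middle [of c "[symE]" "emb h" m "[]" f] coeff_middle [of c "[symE]" "emb h" m "[m']" f]
      coeff_middle [of c "[symE, emb h]" symI m "[]" f]
    by (simp_all add: emb_simps sym_ract)
  show ?thesis
    unfolding balanced_def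
    apply (intro conjI allI ballI)
    apply (simp_all add: coeff_add coeff_left slot lact J ev_add ev_const_mult emb_simps(1) algebra_simps)
    apply (simp_all add: middle middleI emb_simps)
    done
qed

lemma operator_rep_canonical: "operator_rep d J (representation canonical)"
  by (rule operator_rep_representation [OF balanced_canonical])

lemma coeff_const: "c \<in> K \<Longrightarrow> ms \<in> lists M \<Longrightarrow> coeff c ms = \<tau> c ms"
  using rep_zero [of 1 "[]" ms] by (simp add: coeff_def emb_simps)

lemma coeff_J: "c \<in> K \<Longrightarrow> ms \<in> lists M \<Longrightarrow> coeff (c * J h) ms = \<tau> c (emb (J h) # ms)"
  using rep_left [of 1 c "emb (J h)" ms]
  by (simp add: coeff_def ev_const_mult d_const_mult J_const rep_scalar_zero emb_simps)

lemma coeff_zero_slot: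
  "xs \<in> lists M \<Longrightarrow> ys \<in> lists M \<Longrightarrow> coeff f (xs @ 0 # ys) = 0"
  using rep_zero [of 1 "emb (J (d f)) # xs" ys] by (simp add: coeff_def rep_zero)

text \<open>The derivative of the coefficient 1 vanishes, so each letter merely raises the
  exponent.\<close>

lemma run_symD: "balanced \<phi> \<Longrightarrow> run \<phi> (replicate j symD) (SD 1 i) = \<phi> (SD 1 (i + j))"
  by (induction j arbitrary: \<phi>) (simp_all add: act_generators balanced_actD balanced_zero)

text \<open>A standard word acts on the unit without branching: \<partial> only meets the
  coefficient 1, and \<integral> and E are put in front of what they meet. So a single shape
  results, and \<open>canonical\<close> reads it back.\<close>

lemma representation_standard:
  assumes "c \<in> K" "w \<in> standard_words"
  shows "representation canonical c w = \<tau> c w"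
proof -
  have bal: "balanced (\<lambda>s. canonical (lmul c s))"
    by (rule balanced_lmul [OF balanced_canonical])
  have bal2: "balanced (\<lambda>s. canonical (lmul c (lmul f s)))" for f
    by (rule balanced_lmul [OF bal])
  note act = act_generators bal2 balanced_act balanced_actD balanced_actE balanced_actI balanced_lmul bal balanced_canonical
    run_symD [where i = 0]
  \<comment> \<open>The constant part of an element of the image of \<open>J\<close> is 0 and that
    of 1 is 1, so one of the two summands in \<open>canonical\<close> vanishes.\<close>
  have zero: "ido_lact 0 m = 0" "ido_lact 1 m = m" for m :: "'a ido"
    by (cases m; simp add: zero_prod_def)+
  have coeff0: "ys \<in> lists M \<Longrightarrow> coeff f (0 # ys) = 0"
    "x \<in> M \<Longrightarrow> ys \<in> lists M \<Longrightarrow> coeff f (x # 0 # ys) = 0"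
    "x \<in> M \<Longrightarrow> y \<in> M \<Longrightarrow> ys \<in> lists M \<Longrightarrow> coeff f (x # y # 0 # ys) = 0"
    "x \<in> M \<Longrightarrow> y \<in> M \<Longrightarrow> z \<in> M \<Longrightarrow> ys \<in> lists M \<Longrightarrow> coeff f (x # y # z # 0 # ys) = 0" for f x y z ys
    using coeff_zero_slot [of "[]"] coeff_zero_slot [of "[x]"] coeff_zero_slot [of "[x, y]"]
      coeff_zero_slot [of "[x, y, z]"] by simp_all
  from assms(2) show ?thesis
  proof cases
    case (D f j)
    show ?thesis
      using D(2) by (cases rule: absent_or_cases)
        (simp_all add: D(1) representation_def act coeff_const coeff_J assms(1))
  next
    case (I f g)
    show ?thesis
      using I(2) by (cases rule: absent_or_cases; use I(3) in \<open>cases rule: absent_or_cases\<close>)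
        (simp_all add: I(1) representation_def act coeff_const coeff_J assms(1) zero coeff0 emb_simps)
  next
    case (E f g j)
    show ?thesis
      using E(2) by (cases rule: absent_or_cases; use E(3) in \<open>cases rule: absent_or_cases\<close>)
        (simp_all add: E(1) representation_def act coeff_const coeff_J assms(1) zero coeff0 emb_simps)
  next
    case (EI f g h)
    show ?thesis
      using EI(2) by (cases rule: absent_or_cases; use EI(3) in \<open>cases rule: absent_or_cases\<close>)
        (simp_all add: EI(1) representation_def act coeff_const coeff_J assms(1) zero coeff0 emb_simps)
  qed
qed

end

context ring
begin

lemma additive_map:
  fixes h :: "'a \<Rightarrow> 'c::ab_group_add"
  assumes "\<And>x y. x \<in> carrier R \<Longrightarrow> y \<in> carrier R \<Longrightarrow> h (x \<oplus> y) = h x + h y"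
  shows "h \<zero> = 0" "x \<in> carrier R \<Longrightarrow> h (\<ominus> x) = - h x"
    "x \<in> carrier R \<Longrightarrow> y \<in> carrier R \<Longrightarrow> h (x \<ominus> y) = h x - h y"
proof -
  show z: "h \<zero> = 0" using assms [of \<zero> \<zero>] by simp
  show m: "h (\<ominus> x) = - h x" if "x \<in> carrier R" for x
    using assms [of x "\<ominus> x"] that by (simp add: z r_neg eq_neg_iff_add_eq_0 add.commute)
  show "x \<in> carrier R \<Longrightarrow> y \<in> carrier R \<Longrightarrow> h (x \<ominus> y) = h x - h y"
    by (simp add: a_minus_def assms m)
qed

lemma subgroup_add_monoidI:
  assumes "S \<subseteq> carrier R" "\<zero> \<in> S" "\<And>x y. x \<in> S \<Longrightarrow> y \<in> S \<Longrightarrow> x \<oplus> y \<in> S" "\<And>x. x \<in> S \<Longrightarrow> \<ominus> x \<in> S"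
  shows "subgroup S (add_monoid R)"
  by (rule group.subgroupI [OF a_group]) (use assms in \<open>auto simp: a_inv_def\<close>)

end

context operator_rep
begin

lemma standard_to_full:
  assumes "w \<in> standard_words"
  obtains w' where "w' \<in> full_words" "\<And>c xs. c \<in> K \<Longrightarrow> xs \<in> lists M \<Longrightarrow> \<tau> c (xs @ w) = \<tau> c (xs @ w')"
proof -
  \<comment> \<open>An absent factor becomes the coefficient 1; \<open>fst (hd f)\<close> recovers
    the ring element of a factor that is present.\<close>
  define co where "co f = (if f = [] then 1 else fst (hd f))" for f :: "'a ido list"
  have co: "\<tau> c (xs @ f @ ys) = \<tau> c (xs @ emb (co f) # ys)"
    if "f \<in> absent_or J" "c \<in> K" "xs \<in> lists M" "ys \<in> lists M" for c f xs ys
    using that(1) by (cases rule: absent_or_cases) (use that(2-4) rel_one in \<open>simp_all add: co_def emb_def\<close>)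
  from assms show thesis
  proof cases
    case (D f j)
    show ?thesis by (rule that [OF full_words.D [of "co f" j]]) (simp add: D(1) co [OF D(2)])
  next
    case (I f g)
    show ?thesis
    proof (rule that [OF full_words.I [of "co f" "co g"]])
      fix c xs assume "c \<in> K" "xs \<in> lists M"
      then show "\<tau> c (xs @ w) = \<tau> c (xs @ [emb (co f), symI, emb (co g)])"
        using co [OF I(3), of c "xs @ [emb (co f), symI]" "[]"] absent_or_M [OF I(3)]
        by (simp add: I(1) co [OF I(2)])
    qed
  next
    case (E f g j)
    show ?thesis
    proof (rule that [OF full_words.E [of "co f" "co g" j]])
      fix c xs assume "c \<in> K" "xs \<in> lists M"
      then show "\<tau> c (xs @ w) = \<tau> c (xs @ emb (co f) # symE # emb (co g) # replicate j symD)"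
        using co [OF E(3), of c "xs @ [emb (co f), symE]" "replicate j symD"] absent_or_M [OF E(3)]
        by (simp add: E(1) co [OF E(2)])
    qed
  next
    case (EI f g h)
    show ?thesis
    proof (rule that [OF full_words.EI [of "co f" h "co g"]])
      fix c xs assume "c \<in> K" "xs \<in> lists M"
      then show "\<tau> c (xs @ w) = \<tau> c (xs @ [emb (co f), symE, emb (J h), symI, emb (co g)])"
        using co [OF EI(3), of c "xs @ [emb (co f), symE, emb (J h), symI]" "[]"] absent_or_M [OF EI(3)]
        by (simp add: EI(1) co [OF EI(2)])
    qed
  qed
qed

end

section \<open>The tensor ring modulo the operator ideal\<close>

context integro_differential
begin

abbreviation tens_mult_op (infixl \<open>\<star>\<close> 70) where
  "x \<star> y \<equiv> x \<otimes>\<^bsub>TR d\<^esub> y"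

abbreviation "opI \<equiv> operator_ideal d J"

lemma operator_relations_closed: "operator_relations d J \<subseteq> carrier (TR d)"
proof
  fix x assume "x \<in> operator_relations d J"
  then show "x \<in> carrier (TR d)"
    unfolding operator_relations_def by (elim UnE CollectE exE singletonE conjE) (simp_all add: one_tens)
qed

lemma ideal_operator_ideal: "ideal opI (TR d)"
  unfolding operator_ideal_def by (rule T.genideal_ideal [OF operator_relations_closed])

lemma operator_relations_subset: "operator_relations d J \<subseteq> opI"
  unfolding operator_ideal_def by (rule T.genideal_self [OF operator_relations_closed])

lemma operator_relationsI:
  "tens 1 [] \<ominus>\<^bsub>TR d\<^esub> tens 1 [emb 1] \<in> operator_relations d J"
  "tens 1 [emb f, emb g] \<ominus>\<^bsub>TR d\<^esub> tens 1 [emb (f * g)] \<in> operator_relations d J"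
  "tens 1 [symD, emb f] \<ominus>\<^bsub>TR d\<^esub> (tens 1 [emb f, symD] \<oplus>\<^bsub>TR d\<^esub> tens 1 [emb (d f)]) \<in> operator_relations d J"
  "tens 1 [symD, symI] \<ominus>\<^bsub>TR d\<^esub> tens 1 [] \<in> operator_relations d J"
  "tens 1 [symI, symD] \<ominus>\<^bsub>TR d\<^esub> (tens 1 [] \<ominus>\<^bsub>TR d\<^esub> tens 1 [symE]) \<in> operator_relations d J"
  "tens 1 [symD, emb f, symE] \<ominus>\<^bsub>TR d\<^esub> tens 1 [emb (d f), symE] \<in> operator_relations d J"
  "tens 1 [symI, emb f, symE] \<ominus>\<^bsub>TR d\<^esub> tens 1 [emb (J f), symE] \<in> operator_relations d J"
  "tens 1 [symE, emb f, symE] \<ominus>\<^bsub>TR d\<^esub> tens 1 [emb (ev f), symE] \<in> operator_relations d J"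
  unfolding operator_relations_def one_tens by blast+

text \<open>A relation between two outer tensors stays in the ideal \<open>H\<close>; multiplying
  out yields the equations on words that the locale asks for.\<close>

lemma operator_rep_quotient:
  assumes "ideal H (TR d)" "operator_relations d J \<subseteq> H"
  shows "operator_rep d J (\<lambda>c xs. ideal.coset_class H (TR d) (tens c xs))"
proof -
  interpret H: ideal H "TR d" by fact
  have rel: "H.coset_class (tens c xs \<star> x \<star> tens 1 ys) = 0"
    if "x \<in> operator_relations d J" "c \<in> K" "xs \<in> lists M" "ys \<in> lists M" for x c xs ys
  proof -
    have "x \<in> H" using that(1) assms(2) by blast
    then have "tens c xs \<star> x \<star> tens 1 ys \<in> H"
      using that by (intro H.I_l_closed H.I_r_closed) simp_all
    then show ?thesis using H.coset_class_eq_0_iff H.a_Hcarr by blast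
  qed
  have word: "H.coset_class (tens c xs \<star> tens 1 p \<star> tens 1 ys) = H.coset_class (tens c (xs @ p @ ys))"
    if "p \<in> lists M" "c \<in> K" "xs \<in> lists M" "ys \<in> lists M" for p c xs ys
    using that by (simp add: tens_mult_one)
  have expand:
    "H.coset_class (tens c xs \<star> (x \<oplus>\<^bsub>TR d\<^esub> y) \<star> tens 1 ys) =
      H.coset_class (tens c xs \<star> x \<star> tens 1 ys) + H.coset_class (tens c xs \<star> y \<star> tens 1 ys)"
    "H.coset_class (tens c xs \<star> (x \<ominus>\<^bsub>TR d\<^esub> y) \<star> tens 1 ys) =
      H.coset_class (tens c xs \<star> x \<star> tens 1 ys) - H.coset_class (tens c xs \<star> y \<star> tens 1 ys)"
    if "x \<in> carrier (TR d)" "y \<in> carrier (TR d)" "c \<in> K" "xs \<in> lists M" "ys \<in> lists M" for x y c xs ys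
    using that
    by (simp_all add: a_minus_def T.l_distr T.r_distr T.l_minus T.r_minus H.coset_class_add H.coset_class_minus)
  show ?thesis
  proof
    show "tensor_map (\<lambda>c xs. H.coset_class (tens c xs))"
      by (rule tensor_map_additive) (rule H.coset_class_add)
  next
    fix c :: 'a and xs ys :: "'a ido list" and f g
    assume asm: "c \<in> K" "xs \<in> lists M" "ys \<in> lists M"
    note expand' = expand [OF _ _ asm]
    note rels = operator_relationsI [THEN rel [OF _ asm]]
    show "H.coset_class (tens c (xs @ emb 1 # ys)) = H.coset_class (tens c (xs @ ys))"
      using rels(1) asm by (simp add: expand' word)
    show "H.coset_class (tens c (xs @ emb f # emb g # ys)) = H.coset_class (tens c (xs @ emb (f * g) # ys))"
      using rels(2) [of f g] asm by (simp add: expand' word)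
    show "H.coset_class (tens c (xs @ symD # emb f # ys)) =
        H.coset_class (tens c (xs @ emb f # symD # ys)) + H.coset_class (tens c (xs @ emb (d f) # ys))"
      using rels(3) [of f] asm by (simp add: expand' word)
    show "H.coset_class (tens c (xs @ symD # symI # ys)) = H.coset_class (tens c (xs @ ys))"
      using rels(4) asm by (simp add: expand' word)
    show "H.coset_class (tens c (xs @ symI # symD # ys)) =
        H.coset_class (tens c (xs @ ys)) - H.coset_class (tens c (xs @ symE # ys))"
      using rels(5) asm by (simp add: expand' word)
    show "H.coset_class (tens c (xs @ symD # emb f # symE # ys)) = H.coset_class (tens c (xs @ emb (d f) # symE # ys))"
      using rels(6) [of f] asm by (simp add: expand' word)
    show "H.coset_class (tens c (xs @ symI # emb f # symE # ys)) = H.coset_class (tens c (xs @ emb (J f) # symE # ys))"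
      using rels(7) [of f] asm by (simp add: expand' word)
    show "H.coset_class (tens c (xs @ symE # emb f # symE # ys)) = H.coset_class (tens c (xs @ emb (ev f) # symE # ys))"
      using rels(8) [of f] asm by (simp add: expand' word)
  qed
qed

text \<open>With the scalars included, the additive span is already the left span over the
  constants.\<close>

definition standard_tens :: "'a ido_tensor set" where
  "standard_tens = {tens c w | c w. c \<in> K \<and> w \<in> standard_words}"

lemma standard_tens_closed: "standard_tens \<subseteq> carrier (TR d)"
  by (auto simp: standard_tens_def standard_words_M)

text \<open>Induction on the number of letters: modulo the ideal, the tail of a word may be replaced
  by a combination of standard tensors before the first letter is multiplied to it.\<close>

lemma standard_decomposition:
  assumes "x \<in> carrier (TR d)"
  obtains s where "s \<in> T.span standard_tens" "x \<ominus>\<^bsub>TR d\<^esub> s \<in> opI"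
proof -
  interpret I: ideal opI "TR d" by (rule ideal_operator_ideal)
  interpret rep: operator_rep d J "\<lambda>c xs. I.coset_class (tens c xs)"
    by (rule operator_rep_quotient [OF ideal_operator_ideal operator_relations_subset])
  define N where "N = I.coset_class ` T.span standard_tens"
  note cl = T.span_closed [OF standard_tens_closed]
  interpret sub: operator_rep_subgroup d J "\<lambda>c xs. I.coset_class (tens c xs)" N
  proof
    show "0 \<in> N" using T.span_zero by (auto simp: N_def I.coset_class_zero [symmetric])
    show "v + w \<in> N" if "v \<in> N" "w \<in> N" for v w
      using that by (auto simp: N_def cl simp flip: I.coset_class_add intro!: imageI T.span_add)
    show "- v \<in> N" if "v \<in> N" for v
      using that by (auto simp: N_def cl simp flip: I.coset_class_minus
          intro!: imageI T.span_minus [OF standard_tens_closed])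
  qed
  have std: "I.coset_class (tens c w) \<in> N" if "c \<in> K" "w \<in> standard_words" for c w
    using that unfolding N_def by (intro imageI T.span_incl) (auto simp: standard_tens_def)
  have full: "I.coset_class (tens c w) \<in> N" if "c \<in> K" "w \<in> full_words" for c w
    using sub.full_if_standard std that by blast
  have left: "I.coset_class (tens c (m # w)) \<in> N" if "c \<in> K" "m \<in> M" "w \<in> full_words" for c m w
    using sub.left_mult_full full that by blast
  \<comment> \<open>The scalar of the standard tensor moves to the letter \<open>m\<close> on its
    left, and \<open>standard_to_full\<close> fills in the absent coefficients so that
    \<open>left\<close> applies.\<close>
  have left_span: "I.coset_class (tens c [m] \<star> s) \<in> N"
    if "s \<in> T.span standard_tens" "c \<in> K" "m \<in> M" for c m s
    using that(1) standard_tens_closed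
  proof (induction rule: T.span_induct)
    case zero
    then show ?case using that by (simp add: I.coset_class_zero)
  next
    case (incl s)
    then obtain e w where w: "s = tens e w" "e \<in> K" "w \<in> standard_words" by (auto simp: standard_tens_def)
    obtain w' where w': "w' \<in> full_words"
        "\<And>c xs. c \<in> K \<Longrightarrow> xs \<in> lists M \<Longrightarrow> I.coset_class (tens c (xs @ w)) = I.coset_class (tens c (xs @ w'))"
      using rep.standard_to_full [OF w(3)] by blast
    have "I.coset_class (tens c (ido_ract m e # w)) \<in> N"
      using w'(2) [of c "[ido_ract m e]"] left [of c "ido_ract m e" w'] w(2) w'(1) that by simp
    then show ?case using w that by (simp add: tens_mult standard_words_M)
  next
    case (minus x)
    then show ?case using that by (simp add: T.r_minus I.coset_class_minus sub.N_minus)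
  next
    case (add x y)
    then show ?case using that by (simp add: T.r_distr I.coset_class_add sub.N_add)
  qed
  have words: "I.coset_class (tens c ms) \<in> N" if "c \<in> K" "ms \<in> lists M" for c ms
    using that(2,1)
  proof (induction ms arbitrary: c)
    case Nil
    have "[emb 1] \<in> full_words" using full_words.D [of 1 0] by simp
    then show ?case
      using full [of c "[emb 1]"] rep.rel_one [of c "[]" "[]"] Nil by simp
  next
    case (Cons m ms)
    obtain s where s: "s \<in> T.span standard_tens" "I.coset_class (tens 1 ms) = I.coset_class s"
      using Cons.IH [of 1] by (auto simp: N_def)
    have cm: "tens 1 ms \<in> carrier (TR d)" "tens c [m] \<in> carrier (TR d)" "s \<in> carrier (TR d)"
      using Cons s cl by auto
    have "tens c [m] \<star> (tens 1 ms \<ominus>\<^bsub>TR d\<^esub> s) \<in> opI"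
      using cm s by (intro I.I_l_closed) (auto simp flip: I.coset_class_eq_iff)
    then have "I.coset_class (tens c [m] \<star> tens 1 ms) = I.coset_class (tens c [m] \<star> s)"
      using cm by (subst I.coset_class_eq_iff) (simp_all add: a_minus_def T.r_distr T.r_minus)
    then show ?case
      using left_span [OF s(1), of c m] Cons by (simp add: tens_mult_one)
  qed
  have "I.coset_class x \<in> N"
    using assms
    by (induction rule: TRing_induct) (auto simp: I.coset_class_zero I.coset_class_diff words sub.N_diff)
  then show thesis
    using that assms cl by (auto simp: N_def I.coset_class_eq_iff)
qed

lemma rep_operator_ideal:
  assumes rep: "operator_rep d J \<tau>" and x: "x \<in> opI"
    and h_add: "\<And>x y. x \<in> carrier (TR d) \<Longrightarrow> y \<in> carrier (TR d) \<Longrightarrow> h (x \<oplus>\<^bsub>TR d\<^esub> y) = h x + h y"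
    and h_tens: "\<And>c xs. c \<in> K \<Longrightarrow> xs \<in> lists M \<Longrightarrow> h (tens c xs) = \<tau> c xs"
  shows "h x = 0"
proof -
  interpret rep: operator_rep d J \<tau> by (rule rep)
  note h = T.additive_map [of h, OF h_add]
  \<comment> \<open>The largest two-sided ideal on which \<open>h\<close> vanishes; it contains the
    operator ideal as soon as it contains the relations.\<close>
  define Z where "Z = {x \<in> carrier (TR d). \<forall>a \<in> carrier (TR d). \<forall>b \<in> carrier (TR d). h (a \<star> x \<star> b) = 0}"
  have "ideal Z (TR d)"
  proof (rule idealI [OF T.ring_axioms])
    show "subgroup Z (add_monoid (TR d))"
      by (rule T.subgroup_add_monoidI)
        (auto simp: Z_def h T.l_minus T.r_minus T.l_distr T.r_distr h_add)
    show "y \<star> a \<in> Z" if "a \<in> Z" "y \<in> carrier (TR d)" for a y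
      using that by (auto simp: Z_def simp flip: T.m_assoc)
    show "a \<star> y \<in> Z" if "a \<in> Z" "y \<in> carrier (TR d)" for a y
      using that by (auto simp: Z_def T.m_assoc)
  qed
  moreover have "operator_relations d J \<subseteq> Z"
  proof
    fix x assume x: "x \<in> operator_relations d J"
    then have xc: "x \<in> carrier (TR d)" using operator_relations_closed by blast
    have word: "h (tens c xs \<star> x \<star> tens 1 ys) = 0" if ctx: "c \<in> K" "xs \<in> lists M" "ys \<in> lists M" for c xs ys
    proof -
      have expand:
        "h (tens c xs \<star> (x \<oplus>\<^bsub>TR d\<^esub> y) \<star> tens 1 ys) =
          h (tens c xs \<star> x \<star> tens 1 ys) + h (tens c xs \<star> y \<star> tens 1 ys)"
        "h (tens c xs \<star> (x \<ominus>\<^bsub>TR d\<^esub> y) \<star> tens 1 ys) =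
          h (tens c xs \<star> x \<star> tens 1 ys) - h (tens c xs \<star> y \<star> tens 1 ys)"
        if "x \<in> carrier (TR d)" "y \<in> carrier (TR d)" for x y
        using that ctx
        by (simp_all add: a_minus_def T.l_distr T.r_distr T.l_minus T.r_minus h_add h(2))
      have w: "h (tens c xs \<star> tens 1 p \<star> tens 1 ys) = \<tau> c (xs @ p @ ys)" if "p \<in> lists M" for p
        using that ctx by (simp add: tens_mult_one h_tens)
      note rel = rep.rel_one rep.rel_RR rep.rel_DR rep.rel_DI rep.rel_ID rep.rel_DRE rep.rel_IRE rep.rel_ERE
      \<comment> \<open>The Leibniz rule expands \<partial> f E and leaves the term f \<partial>
        E.\<close>
      have DE: "\<tau> c (xs @ emb f # symD # symE # ys) = 0" for f
        using rep.rule_DE [of c "xs @ [emb f]" ys] ctx by simp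
      from x show ?thesis
        unfolding operator_relations_def one_tens
        by (elim UnE CollectE exE singletonE conjE) (simp_all add: expand w rel ctx DE)
    qed
    \<comment> \<open>\<open>word\<close> covers right factors with scalar 1. Another scalar e is
      traded for the letter \<open>emb e\<close>, which \<open>h\<close> does not distinguish from
      it.\<close>
    have right: "h (y \<star> tens e ys) = h (y \<star> tens 1 (emb e # ys))"
      if "y \<in> carrier (TR d)" and e: "e \<in> K" "ys \<in> lists M" for y e ys
      using that(1)
    proof (induction rule: TRing_induct)
      case zero
      then show ?case using e by simp
    next
      case (tens c xs)
      show ?case
      proof (cases xs rule: rev_cases)
        case Nil
        then show ?thesis using tens e by (simp add: tens_mult h_tens rep.rep_const_head)
      next
        case (snoc zs z)
        then show ?thesis
          using tens e rep.rep_const_left [of c zs ys e z] by (simp add: tens_mult h_tens)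
      qed
    next
      case (diff x y)
      then show ?case using e by (simp add: a_minus_def T.l_distr T.l_minus h_add h(2))
    qed
    have "h (a \<star> x \<star> b) = 0" if a: "a \<in> carrier (TR d)" and b: "b \<in> carrier (TR d)" for a b
      using b
    proof (induction rule: TRing_induct)
      case (tens e ys)
      have "h (a \<star> x \<star> tens 1 (emb e # ys)) = 0"
        using a
      proof (induction rule: TRing_induct)
        case (tens c xs)
        then show ?case using word \<open>ys \<in> lists M\<close> by simp
      next
        case (diff u v)
        then show ?case using xc tens by (simp add: a_minus_def T.l_distr T.l_minus h_add h(2))
      qed (use xc tens h(1) in simp)
      then show ?case using right [of "a \<star> x" e ys] xc a tens by simp
    next
      case (diff u v)
      then show ?case using xc a by (simp add: a_minus_def T.r_distr T.r_minus h_add h(2))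
    qed (use xc a h(1) in simp)
    then show "x \<in> Z" using xc by (simp add: Z_def)
  qed
  ultimately have "opI \<subseteq> Z" unfolding operator_ideal_def by (rule T.genideal_minimal)
  with x have "h (\<one>\<^bsub>TR d\<^esub> \<star> x \<star> \<one>\<^bsub>TR d\<^esub>) = 0" "x \<in> carrier (TR d)" by (auto simp: Z_def)
  then show ?thesis by simp
qed

lemma standard_independent:
  assumes "s \<in> T.span standard_tens" "s \<in> opI"
  shows "s = \<zero>\<^bsub>TR d\<^esub>"
proof -
  \<comment> \<open>The class map of the zero ideal is an injective copy of the tensor ring in a
    type of class \<open>ab_group_add\<close>, so it can serve as \<tau>.\<close>
  interpret Z: ideal "{\<zero>\<^bsub>TR d\<^esub>}" "TR d" by (rule T.zeroideal)
  interpret rep: tensor_rep d J "\<lambda>c xs. Z.coset_class (tens c xs)"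
    by unfold_locales (rule tensor_map_additive, rule Z.coset_class_add)
  have op: "operator_rep d J (representation rep.canonical)" by (rule rep.operator_rep_canonical)
  obtain h where h: "\<And>x y. x \<in> carrier (TR d) \<Longrightarrow> y \<in> carrier (TR d) \<Longrightarrow> h (x \<oplus>\<^bsub>TR d\<^esub> y) = h x + h y"
      "\<And>c xs. c \<in> K \<Longrightarrow> xs \<in> lists M \<Longrightarrow> h (tens c xs) = representation rep.canonical c xs"
    by (rule tensor_map_extend [OF tensor_rep.tensor_map [OF operator_rep.axioms(1) [OF op]]]) (rule that)
  have "h s = Z.coset_class s"
    using assms(1) standard_tens_closed
  proof (induction rule: T.span_induct)
    case zero
    show ?case by (simp only: T.additive_map(1) [of h, OF h(1)] Z.coset_class_zero)
  next
    case (incl x)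
    then show ?case
      by (auto simp only: standard_tens_def h(2) standard_words_M rep.representation_standard)
  next
    case (minus x)
    then show ?case by (simp only: T.additive_map(2) [of h, OF h(1)] Z.coset_class_minus)
  next
    case (add x y)
    then show ?case by (simp only: h(1) Z.coset_class_add)
  qed
  moreover have "h s = 0"
    by (rule rep_operator_ideal [OF op assms(2) h])
  ultimately show ?thesis
    using Z.coset_class_eq_0_iff [OF T.span_closed [OF standard_tens_closed assms(1)]] by simp
qed

end

section \<open>The reduction rules\<close>

context integro_differential
begin

abbreviation in_components :: "'a ido list \<Rightarrow> letter list \<Rightarrow> bool" where
  "in_components \<equiv> list_all2 (\<lambda>m w. m \<in> component d J w)"

definition word_tens :: "letter list \<Rightarrow> 'a ido_tensor set" where
  "word_tens W = {tens c ms | c ms. c \<in> K \<and> in_components ms W}"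

lemma word_module_span: "word_module d J W = T.span (word_tens W)"
  by (simp add: word_module_def word_tens_def T.span_def)

lemma component_cases [consumes 1, case_names LK LRt LD LI LE LR]:
  assumes "m \<in> component d J w"
  obtains c where "w = LK" "c \<in> K" "m = emb c"
  | f where "w = LRt" "m = emb (J f)"
  | c where "w = LD" "c \<in> K" "m = ido_lact c symD"
  | c where "w = LI" "c \<in> K" "m = ido_lact c symI"
  | c where "w = LE" "c \<in> K" "m = ido_lact c symE"
  | f where "w = LR" "m = emb f"
  using assms by (cases w) auto

lemma lact_closed [simp]: "c \<in> K \<Longrightarrow> ido_lact c symD \<in> M" "c \<in> K \<Longrightarrow> ido_lact c symI \<in> M" "c \<in> K \<Longrightarrow> ido_lact c symE \<in> M"
  by simp_all

lemma component_M: "m \<in> component d J w \<Longrightarrow> m \<in> M"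
  by (erule component_cases; hypsubst; simp)

lemma lact_lact: "ido_lact a (ido_lact b m) = ido_lact (a * b) m"
  by (cases m) (simp add: mult.assoc)

lemma lact_one [simp]: "ido_lact 1 m = m"
  by (cases m) simp

lemma ract_lact_sym:
  "ido_ract (ido_lact c symD) e = ido_lact (c * e) symD"
  "ido_ract (ido_lact c symI) e = ido_lact (c * e) symI"
  "ido_ract (ido_lact c symE) e = ido_lact (c * e) symE"
  by (simp_all add: symD_def symI_def symE_def)

text \<open>For the image of \<open>J\<close> this holds because \<open>J\<close> commutes with
  constants.\<close>

lemma component_ract: "m \<in> component d J w \<Longrightarrow> e \<in> K \<Longrightarrow> ido_ract m e \<in> component d J w"
  by (erule component_cases; hypsubst; auto simp: emb_simps ract_lact_sym simp flip: J_const)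

lemma word_components_M: "in_components ms W \<Longrightarrow> ms \<in> lists M"
  by (induction rule: list_all2_induct) (auto simp only: component_M lists.intros)

lemma word_tens_closed: "word_tens W \<subseteq> carrier (TR d)"
  unfolding word_tens_def using word_components_M tens_closed by blast

lemma word_module_closed: "x \<in> word_module d J W \<Longrightarrow> x \<in> carrier (TR d)"
  unfolding word_module_span by (rule T.span_closed [OF word_tens_closed])

lemma tens_word_module:
  "c \<in> K \<Longrightarrow> in_components ms W \<Longrightarrow> tens c ms \<in> word_module d J W"
  unfolding word_module_span word_tens_def by (rule T.span_incl) blast

lemma word_module_induct [consumes 1, case_names zero tens minus add]:
  assumes "x \<in> word_module d J W" "P \<zero>\<^bsub>TR d\<^esub>"
    "\<And>c ms. c \<in> K \<Longrightarrow> ms \<in> lists M \<Longrightarrow> in_components ms W \<Longrightarrow> P (tens c ms)"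
    "\<And>x. x \<in> carrier (TR d) \<Longrightarrow> P x \<Longrightarrow> P (\<ominus>\<^bsub>TR d\<^esub> x)"
    "\<And>x y. x \<in> carrier (TR d) \<Longrightarrow> y \<in> carrier (TR d) \<Longrightarrow> P x \<Longrightarrow> P y \<Longrightarrow> P (x \<oplus>\<^bsub>TR d\<^esub> y)"
  shows "P x"
  using assms(1) unfolding word_module_span
proof (rule T.span_induct [OF _ word_tens_closed])
  fix x assume "x \<in> word_tens W"
  then show "P x" unfolding word_tens_def using assms(3) word_components_M by blast
qed (fact assms)+

lemma word_module_zero: "\<zero>\<^bsub>TR d\<^esub> \<in> word_module d J W"
  and word_module_add: "x \<in> word_module d J W \<Longrightarrow> y \<in> word_module d J W \<Longrightarrow> x \<oplus>\<^bsub>TR d\<^esub> y \<in> word_module d J W"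
  and word_module_minus: "x \<in> word_module d J W \<Longrightarrow> \<ominus>\<^bsub>TR d\<^esub> x \<in> word_module d J W"
  unfolding word_module_span by (auto intro: T.span_zero T.span_add T.span_minus [OF word_tens_closed])

lemma word_module_lact:
  assumes "x \<in> word_module d J W" and e: "e \<in> K"
  shows "tens e [] \<star> x \<in> word_module d J W"
proof -
  have "x \<in> carrier (TR d) \<and> tens e [] \<star> x \<in> word_module d J W"
    using assms(1)
    by (induction rule: word_module_induct)
      (use e in \<open>simp_all add: tens_mult T.r_minus T.r_distr word_module_zero word_module_add word_module_minus tens_word_module\<close>)
  then show ?thesis by simp
qed

lemma word_module_ract:
  assumes "x \<in> word_module d J W" and e: "e \<in> K"
  shows "x \<star> tens e [] \<in> word_module d J W"
proof -
  have "x \<in> carrier (TR d) \<and> x \<star> tens e [] \<in> word_module d J W"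
    using assms(1)
  proof (induction rule: word_module_induct)
    case (tens c ms)
    show ?case
    proof (cases ms rule: rev_cases)
      case Nil
      then show ?thesis using tens e by (simp add: tens_mult tens_word_module)
    next
      case (snoc ns n)
      then obtain V v where V: "W = V @ [v]" "in_components ns V" "n \<in> component d J v"
        using tens(3) by (auto simp: list_all2_append1 list_all2_Cons1)
      then have "in_components (ns @ [ido_ract n e]) W"
        using component_ract [OF V(3) e] by (simp add: list_all2_appendI)
      then show ?thesis using tens e snoc by (simp add: tens_mult tens_word_module)
    qed
  qed (use e in \<open>simp_all add: T.l_minus T.l_distr word_module_zero word_module_add word_module_minus\<close>)
  then show ?thesis by simp
qed

primrec coord :: "letter \<Rightarrow> 'a ido \<Rightarrow> 'a" where
  "coord LK m = fst m"
| "coord LRt m = fst m"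
| "coord LR m = fst m"
| "coord LD m = fst (snd m)"
| "coord LI m = fst (snd (snd m))"
| "coord LE m = snd (snd (snd m))"

text \<open>All coordinates lie in R, so multiplying them in order respects the tensor relations.
  The value 0 on words of another length makes it a map on the whole tensor ring.\<close>

fun word_prod :: "letter list \<Rightarrow> 'a ido list \<Rightarrow> 'a" where
  "word_prod [] [] = 1"
| "word_prod (w # W) (m # ms) = coord w m * word_prod W ms"
| "word_prod _ _ = 0"

lemma coord_simps:
  "coord w (m + m') = coord w m + coord w m'" "coord w (ido_lact e m) = e * coord w m"
  "coord w (ido_ract m e) = coord w m * e"
  by (cases m; cases m'; cases w; simp)+

lemma word_prod_slot: "word_prod W (xs @ (m + m') # ys) = word_prod W (xs @ m # ys) + word_prod W (xs @ m' # ys)"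
proof (induction xs arbitrary: W)
  case Nil
  then show ?case by (cases W) (simp_all add: coord_simps distrib_right)
next
  case (Cons x xs)
  then show ?case by (cases W) (simp_all add: distrib_left)
qed

lemma word_prod_middle: "word_prod W (xs @ ido_ract m e # m' # ys) = word_prod W (xs @ m # ido_lact e m' # ys)"
proof (induction xs arbitrary: W)
  case Nil
  then show ?case by (cases W; cases "tl W") (simp_all add: coord_simps mult.assoc)
next
  case (Cons x xs)
  then show ?case by (cases W) simp_all
qed

lemma word_prod_right: "word_prod W (xs @ [ido_ract m e]) = word_prod W (xs @ [m]) * e"
proof (induction xs arbitrary: W)
  case Nil
  then show ?case by (cases W; cases "tl W") (simp_all add: coord_simps mult.assoc)
next
  case (Cons x xs)
  then show ?case by (cases W) (simp_all add: mult.assoc)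
qed

lemma word_prod_left: "word_prod W (ido_lact e m # ys) = e * word_prod W (m # ys)"
  by (cases W) (simp_all add: coord_simps mult.assoc)

lemma word_prod_extend:
  obtains h where "\<And>x y. x \<in> carrier (TR d) \<Longrightarrow> y \<in> carrier (TR d) \<Longrightarrow> h (x \<oplus>\<^bsub>TR d\<^esub> y) = h x + h y"
    "\<And>c ms. c \<in> K \<Longrightarrow> ms \<in> lists M \<Longrightarrow> h (tens c ms) = c * word_prod W ms"
    "\<And>e x. e \<in> K \<Longrightarrow> x \<in> carrier (TR d) \<Longrightarrow> h (tens e [] \<star> x) = e * h x"
    "\<And>e x. e \<in> K \<Longrightarrow> x \<in> carrier (TR d) \<Longrightarrow> h (x \<star> tens e []) = h x * e"
proof -
  have "tensor_map (\<lambda>c ms. c * word_prod W ms)"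
    unfolding tensor_map_def
    by (simp add: distrib_right distrib_left word_prod_slot word_prod_middle word_prod_left mult.assoc)
  then obtain h where h: "\<And>x y. x \<in> carrier (TR d) \<Longrightarrow> y \<in> carrier (TR d) \<Longrightarrow> h (x \<oplus>\<^bsub>TR d\<^esub> y) = h x + h y"
    "\<And>c ms. c \<in> K \<Longrightarrow> ms \<in> lists M \<Longrightarrow> h (tens c ms) = c * word_prod W ms"
    by (rule tensor_map_extend) (rule that)
  note h' = T.additive_map [of h, OF h(1)]
  show thesis
  proof (rule that [OF h])
    show "h (tens e [] \<star> x) = e * h x" if "e \<in> K" "x \<in> carrier (TR d)" for e x
      using that(2)
    proof (induction rule: TRing_induct)
      case (tens c xs)
      then show ?case using that(1) by (simp add: tens_mult h(2) mult.assoc)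
    next
      case (diff x y)
      then show ?case using that(1) by (simp add: a_minus_def T.r_distr T.r_minus h h'(2) algebra_simps)
    qed (use that(1) h'(1) in simp)
    show "h (x \<star> tens e []) = h x * e" if "e \<in> K" "x \<in> carrier (TR d)" for e x
      using that(2)
    proof (induction rule: TRing_induct)
      case (tens c xs)
      then show ?case using that(1)
        by (cases xs rule: rev_cases; cases W)
          (simp_all add: tens_mult h(2) mult.assoc word_prod_right)
    next
      case (diff x y)
      then show ?case using that(1) by (simp add: a_minus_def T.l_distr T.l_minus h h'(2) algebra_simps)
    qed (use that(1) h'(1) in simp)
  qed
qed

text \<open>All rules factor through the product of the coordinates of a tensor, so they are determined by
  bimodule homomorphisms on the coefficient ring.\<close>

definition coefficient_hom :: "('a \<Rightarrow> 'a ido_tensor) \<Rightarrow> bool" where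
  "coefficient_hom F \<longleftrightarrow> (\<forall>u. F u \<in> carrier (TR d)) \<and> (\<forall>u v. F (u + v) = F u \<oplus>\<^bsub>TR d\<^esub> F v) \<and>
     (\<forall>c\<in>K. \<forall>u. F (c * u) = tens c [] \<star> F u \<and> F (u * c) = F u \<star> tens c [])"

text \<open>The composition of the coordinate product with \<open>F\<close>, restricted to the word
  module to make it extensional. It provides the existence of all rules.\<close>

lemma bimodule_hom_exists:
  assumes "coefficient_hom F"
  obtains h where "bimodule_hom d (word_module d J W) h"
    "\<And>c ms. c \<in> K \<Longrightarrow> in_components ms W \<Longrightarrow> h (tens c ms) = F (c * word_prod W ms)"
proof -
  obtain g where g: "\<And>x y. x \<in> carrier (TR d) \<Longrightarrow> y \<in> carrier (TR d) \<Longrightarrow> g (x \<oplus>\<^bsub>TR d\<^esub> y) = g x + g y"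
    "\<And>c ms. c \<in> K \<Longrightarrow> ms \<in> lists M \<Longrightarrow> g (tens c ms) = c * word_prod W ms"
    "\<And>e x. e \<in> K \<Longrightarrow> x \<in> carrier (TR d) \<Longrightarrow> g (tens e [] \<star> x) = e * g x"
    "\<And>e x. e \<in> K \<Longrightarrow> x \<in> carrier (TR d) \<Longrightarrow> g (x \<star> tens e []) = g x * e"
    by (rule word_prod_extend) (rule that)
  have F: "F u \<in> carrier (TR d)" "F (u + v) = F u \<oplus>\<^bsub>TR d\<^esub> F v"
    "c \<in> K \<Longrightarrow> F (c * u) = tens c [] \<star> F u" "c \<in> K \<Longrightarrow> F (u * c) = F u \<star> tens c []" for c u v
    using assms unfolding coefficient_hom_def by auto
  let ?h = "\<lambda>x\<in>word_module d J W. F (g x)"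
  show thesis
  proof (rule that)
    show "bimodule_hom d (word_module d J W) ?h"
      unfolding bimodule_hom_def TR_lact_def TR_ract_def
      by (simp add: F g word_module_closed word_module_add word_module_lact word_module_ract)
    show "?h (tens c ms) = F (c * word_prod W ms)"
      if "c \<in> K" "in_components ms W" for c ms
      using that by (simp add: tens_word_module g word_components_M)
  qed
qed

lemma coefficient_hom_zero: "coefficient_hom (\<lambda>u. \<zero>\<^bsub>TR d\<^esub>)"
  by (simp add: coefficient_hom_def)

lemma coefficient_hom_add:
  "coefficient_hom F \<Longrightarrow> coefficient_hom G \<Longrightarrow> coefficient_hom (\<lambda>u. F u \<oplus>\<^bsub>TR d\<^esub> G u)"
  by (simp add: coefficient_hom_def T.r_distr T.l_distr T.a_ac)

lemma coefficient_hom_diff: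
  "coefficient_hom F \<Longrightarrow> coefficient_hom G \<Longrightarrow> coefficient_hom (\<lambda>u. F u \<ominus>\<^bsub>TR d\<^esub> G u)"
  by (simp add: coefficient_hom_def a_minus_def T.r_distr T.l_distr T.r_minus T.l_minus T.minus_add T.a_ac)

text \<open>Constants commute with the three symbols, so a scalar on either side reaches the slot.
  At most one symbol on each side occurs in the values of the rules.\<close>

lemma coefficient_hom_slot:
  assumes "\<And>u v. A (u + v) = A u + A v" "\<And>c u. c \<in> K \<Longrightarrow> A (c * u) = c * A u" "\<And>c u. c \<in> K \<Longrightarrow> A (u * c) = A u * c"
    and "xs \<in> {[], [symI], [symE]}" "ys \<in> {[], [symD], [symI], [symE]}"
  shows "coefficient_hom (\<lambda>u. tens 1 (xs @ emb (A u) # ys))"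
proof -
  have M: "xs \<in> lists M" "ys \<in> lists M" using assms(4,5) by auto
  have left: "tens c (xs @ emb v # ys) = tens 1 (xs @ emb (c * v) # ys)" if "c \<in> K" for c v
    using assms(4) tens_left [of 1 c "emb v" ys] tens_left [of 1 c "hd xs" "emb v # ys"]
      tens_middle [of 1 c "[]" "hd xs" "emb v" ys] that M
    by (auto simp: emb_simps sym_ract)
  have right: "tens 1 (xs @ emb v # ys) \<star> tens c [] = tens 1 (xs @ emb (v * c) # ys)" if "c \<in> K" for c v
    using assms(5) tens_mult [of 1 "xs @ emb v # ys" c "[]"] tens_middle [of 1 c xs "emb v" "hd ys" "[]"] that M
    by (auto simp: emb_simps sym_ract butlast_append)
  show ?thesis
    unfolding coefficient_hom_def
  proof (intro conjI allI ballI)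
    show "tens 1 (xs @ emb (A u) # ys) \<in> carrier (TR d)" for u using M by simp
    show "tens 1 (xs @ emb (A (u + v)) # ys) = tens 1 (xs @ emb (A u) # ys) \<oplus>\<^bsub>TR d\<^esub> tens 1 (xs @ emb (A v) # ys)" for u v
      using M by (simp add: assms(1) emb_simps(1) tens_slot_add)
    show "tens 1 (xs @ emb (A (c * u)) # ys) = tens c [] \<star> tens 1 (xs @ emb (A u) # ys)" if "c \<in> K" for c u
      using M left [OF that, of "A u"] that by (simp add: assms(2) tens_mult)
    show "tens 1 (xs @ emb (A (u * c)) # ys) = tens 1 (xs @ emb (A u) # ys) \<star> tens c []" if "c \<in> K" for c u
      using right [OF that] that by (simp add: assms(3))
  qed
qed

text \<open>\<open>F\<close> has to be defined on all of R even if the rule has only constant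
  coordinates; \<open>ev\<close> is a bimodule map onto the constants that fixes them.\<close>

lemma coefficient_hom_ev: "coefficient_hom (\<lambda>u. tens (ev u) [])"
  by (simp add: coefficient_hom_def ev_add tens_scalar_add ev_const_mult tens_mult)

lemma coefficient_hom_ev_symE: "coefficient_hom (\<lambda>u. tens 1 [ido_lact (ev u) symE])"
proof -
  have add: "ido_lact (a + b) symE = ido_lact a symE + ido_lact b symE" for a b :: 'a
    by (simp add: symE_def)
  show ?thesis
    unfolding coefficient_hom_def
  proof (intro conjI allI ballI)
    show "tens 1 [ido_lact (ev (u + v)) symE] = tens 1 [ido_lact (ev u) symE] \<oplus>\<^bsub>TR d\<^esub> tens 1 [ido_lact (ev v) symE]" for u v
      using tens_slot_add [of 1 "[]" "ido_lact (ev u) symE" "ido_lact (ev v) symE" "[]"] by (simp add: ev_add add)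
    show "tens 1 [ido_lact (ev (c * u)) symE] = tens c [] \<star> tens 1 [ido_lact (ev u) symE]" if "c \<in> K" for c u
      using tens_left [of 1 c "ido_lact (ev u) symE" "[]"] that by (simp add: tens_mult ev_const_mult lact_lact)
    show "tens 1 [ido_lact (ev (u * c)) symE] = tens 1 [ido_lact (ev u) symE] \<star> tens c []" if "c \<in> K" for c u
      using that by (simp add: tens_mult ev_const_mult ract_lact_sym)
  qed simp
qed

end

section \<open>The table of reduction rules\<close>

context integro_differential
begin

text \<open>Separates the prescribed values from the homomorphisms that take them, so that existence
  and soundness can be proved for all fourteen rules at once.\<close>

inductive rule_value :: "letter list \<Rightarrow> 'a ido list \<Rightarrow> 'a ido_tensor \<Rightarrow> bool" where
  K: "rule_value [LK] [emb 1] (tens 1 [])"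
| RR: "rule_value [LR, LR] [emb f, emb g] (tens 1 [emb (f * g)])"
| DR: "rule_value [LD, LR] [symD, emb f] (tens 1 [emb f, symD] \<oplus>\<^bsub>TR d\<^esub> tens 1 [emb (d f)])"
| DE: "rule_value [LD, LE] [symD, symE] \<zero>\<^bsub>TR d\<^esub>"
| DI: "rule_value [LD, LI] [symD, symI] (tens 1 [])"
| ERE: "rule_value [LE, LR, LE] [symE, emb f, symE] (tens 1 [ido_lact (ev f) symE])"
| EE: "rule_value [LE, LE] [symE, symE] (tens 1 [symE])"
| EI: "rule_value [LE, LI] [symE, symI] \<zero>\<^bsub>TR d\<^esub>"
| IRD: "rule_value [LI, LR, LD] [symI, emb f, symD]
    (tens 1 [emb f] \<ominus>\<^bsub>TR d\<^esub> tens 1 [symE, emb f] \<ominus>\<^bsub>TR d\<^esub> tens 1 [symI, emb (d f)])"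
| IRE: "rule_value [LI, LR, LE] [symI, emb f, symE] (tens 1 [emb (J f), symE])"
| IRI: "rule_value [LI, LR, LI] [symI, emb f, symI]
    (tens 1 [emb (J f), symI] \<ominus>\<^bsub>TR d\<^esub> tens 1 [symE, emb (J f), symI] \<ominus>\<^bsub>TR d\<^esub> tens 1 [symI, emb (J f)])"
| ID: "rule_value [LI, LD] [symI, symD] (tens 1 [] \<ominus>\<^bsub>TR d\<^esub> tens 1 [symE])"
| IE: "rule_value [LI, LE] [symI, symE] (tens 1 [emb (J 1), symE])"
| II: "rule_value [LI, LI] [symI, symI]
    (tens 1 [emb (J 1), symI] \<ominus>\<^bsub>TR d\<^esub> tens 1 [symE, emb (J 1), symI] \<ominus>\<^bsub>TR d\<^esub> tens 1 [symI, emb (J 1)])"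

inductive_simps rule_value_simps:
  "rule_value [LK] p v" "rule_value [LR, LR] p v" "rule_value [LD, LR] p v" "rule_value [LD, LE] p v"
  "rule_value [LD, LI] p v" "rule_value [LE, LR, LE] p v" "rule_value [LE, LE] p v" "rule_value [LE, LI] p v"
  "rule_value [LI, LR, LD] p v" "rule_value [LI, LR, LE] p v" "rule_value [LI, LR, LI] p v"
  "rule_value [LI, LD] p v" "rule_value [LI, LE] p v" "rule_value [LI, LI] p v"

definition rule_words :: "letter list set" where
  "rule_words = {[LK], [LR, LR], [LD, LR], [LD, LE], [LD, LI], [LE, LR, LE], [LE, LE], [LE, LI],
     [LI, LR, LD], [LI, LR, LE], [LI, LR, LI], [LI, LD], [LI, LE], [LI, LI]}"

lemma rule_value_words: "rule_value W p v \<Longrightarrow> W \<in> rule_words"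
  by (induction rule: rule_value.induct) (simp_all add: rule_words_def)

lemma rules_with_iff: "(W, h) \<in> rules_with d J V P \<longleftrightarrow> W = V \<and> bimodule_hom d (word_module d J W) h \<and> P h"
  by (auto simp: rules_with_def)

lemma ido_rules_iff:
  "(W, h) \<in> ido_rules d J \<longleftrightarrow>
    W \<in> rule_words \<and> bimodule_hom d (word_module d J W) h \<and> (\<forall>p v. rule_value W p v \<longrightarrow> h (tens 1 p) = v)"
  (is "?L \<longleftrightarrow> ?R")
proof
  assume ?L
  then show ?R
    unfolding ido_rules_def rule_words_def Un_iff rules_with_iff one_tens
    by (elim disjE conjE; hypsubst; auto simp: rule_value_simps)
next
  assume R: ?R
  then have "W \<in> rule_words" by simp
  then show ?L
    unfolding rule_words_def insert_iff empty_iff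
    by (elim disjE FalseE; hypsubst; use R in \<open>simp add: ido_rules_def rules_with_iff rule_value_simps one_tens; blast\<close>)
qed

lemma rule_value_closed: "rule_value W p v \<Longrightarrow> v \<in> carrier (TR d)"
  by (induction rule: rule_value.induct) simp_all

lemma component_generators [simp]:
  "emb f \<in> component d J LR" "symD \<in> component d J LD" "symI \<in> component d J LI" "symE \<in> component d J LE"
  "c \<in> K \<Longrightarrow> emb c \<in> component d J LK"
  using imageI [of 1 K "\<lambda>c. ido_lact c symD"] imageI [of 1 K "\<lambda>c. ido_lact c symI"] imageI [of 1 K "\<lambda>c. ido_lact c symE"]
  by simp_all

lemma rule_value_components: "rule_value W p v \<Longrightarrow> in_components p W"
  by (induction rule: rule_value.induct) (simp_all del: component.simps)

lemma rule_value_word_module: "rule_value W p v \<Longrightarrow> tens 1 p \<in> word_module d J W"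
  by (rule tens_word_module) (simp_all add: rule_value_components)

lemma rule_value_target:
  assumes "W \<in> rule_words"
  obtains F where "coefficient_hom F" "\<And>p v. rule_value W p v \<Longrightarrow> F (word_prod W p) = v"
proof -
  have ID: "coefficient_hom (\<lambda>u. tens (ev u) [] \<ominus>\<^bsub>TR d\<^esub> tens 1 [ido_lact (ev u) symE])"
    by (intro coefficient_hom_diff coefficient_hom_ev coefficient_hom_ev_symE)
  have RR: "coefficient_hom (\<lambda>u. tens 1 [emb u])"
    using coefficient_hom_slot [of "\<lambda>u. u" "[]" "[]"] by simp
  have DR: "coefficient_hom (\<lambda>u. tens 1 [emb u, symD] \<oplus>\<^bsub>TR d\<^esub> tens 1 [emb (d u)])"
    using coefficient_hom_add [OF coefficient_hom_slot [of "\<lambda>u. u" "[]" "[symD]"] coefficient_hom_slot [of d "[]" "[]"]]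
    by (simp add: d_add d_const_mult)
  have IRE: "coefficient_hom (\<lambda>u. tens 1 [emb (J u), symE])"
    using coefficient_hom_slot [of J "[]" "[symE]"] by (simp add: J_add J_const)
  have IRI: "coefficient_hom (\<lambda>u. tens 1 [emb (J u), symI] \<ominus>\<^bsub>TR d\<^esub> tens 1 [symE, emb (J u), symI] \<ominus>\<^bsub>TR d\<^esub> tens 1 [symI, emb (J u)])"
    using coefficient_hom_diff [OF coefficient_hom_diff [OF coefficient_hom_slot [of J "[]" "[symI]"]
          coefficient_hom_slot [of J "[symE]" "[symI]"]] coefficient_hom_slot [of J "[symI]" "[]"]]
    by (simp add: J_add J_const)
  have IRD: "coefficient_hom (\<lambda>u. tens 1 [emb u] \<ominus>\<^bsub>TR d\<^esub> tens 1 [symE, emb u] \<ominus>\<^bsub>TR d\<^esub> tens 1 [symI, emb (d u)])"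
    using coefficient_hom_diff [OF coefficient_hom_diff [OF coefficient_hom_slot [of "\<lambda>u. u" "[]" "[]"]
          coefficient_hom_slot [of "\<lambda>u. u" "[symE]" "[]"]] coefficient_hom_slot [of d "[symI]" "[]"]]
    by (simp add: d_add d_const_mult)
  note coord = emb_def symD_def symI_def symE_def
  \<comment> \<open>Mostly a rule without coefficient has the value at u = 1 of the rule with
    coefficient, as II and IRI. But ID is separate from IRD, because it yields the empty tensor
    where IRD yields \<open>emb 1\<close>.\<close>
  from assms consider "W \<in> {[LK], [LD, LI]}" | "W = [LR, LR]" | "W = [LD, LR]" | "W \<in> {[LD, LE], [LE, LI]}"
    | "W \<in> {[LE, LR, LE], [LE, LE]}" | "W \<in> {[LI, LR, LE], [LI, LE]}" | "W \<in> {[LI, LR, LI], [LI, LI]}"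
    | "W = [LI, LR, LD]" | "W = [LI, LD]"
    by (auto simp: rule_words_def)
  then show thesis
  proof cases
    case 1
    show thesis by (rule that [OF coefficient_hom_ev]) (use 1 in \<open>auto simp: rule_value_simps coord\<close>)
  next
    case 2
    show thesis by (rule that [OF RR]) (use 2 in \<open>auto simp: rule_value_simps coord\<close>)
  next
    case 3
    show thesis by (rule that [OF DR]) (use 3 in \<open>auto simp: rule_value_simps coord\<close>)
  next
    case 4
    show thesis by (rule that [OF coefficient_hom_zero]) (use 4 in \<open>auto simp: rule_value_simps coord\<close>)
  next
    case 5
    show thesis by (rule that [OF coefficient_hom_ev_symE]) (use 5 in \<open>auto simp: rule_value_simps coord\<close>)
  next
    case 6
    show thesis by (rule that [OF IRE]) (use 6 in \<open>auto simp: rule_value_simps coord\<close>)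
  next
    case 7
    show thesis by (rule that [OF IRI]) (use 7 in \<open>auto simp: rule_value_simps coord\<close>)
  next
    case 8
    show thesis by (rule that [OF IRD]) (use 8 in \<open>auto simp: rule_value_simps coord\<close>)
  next
    case 9
    show thesis by (rule that [OF ID]) (use 9 in \<open>auto simp: rule_value_simps coord\<close>)
  qed
qed

lemma rule_exists:
  assumes "W \<in> rule_words"
  obtains h where "(W, h) \<in> ido_rules d J"
proof -
  obtain F where F: "coefficient_hom F" "\<And>p v. rule_value W p v \<Longrightarrow> F (word_prod W p) = v"
    using rule_value_target [OF assms] by blast
  obtain h where h: "bimodule_hom d (word_module d J W) h"
    "\<And>c ms. c \<in> K \<Longrightarrow> in_components ms W \<Longrightarrow> h (tens c ms) = F (c * word_prod W ms)"
    by (rule bimodule_hom_exists [OF F(1)]) (rule that)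
  show thesis
    by (rule that [of h]) (simp add: ido_rules_iff assms h rule_value_components F(2))
qed

text \<open>Constants carried by the symbols move to the left: the one of the last symbol into the
  coefficient f if there is one, all others into the scalar. Hence the prescribed values determine
  each rule.\<close>

lemma rule_value_cover:
  assumes "W \<in> rule_words" "c \<in> K" "in_components ms W"
  obtains e p v where "e \<in> K" "rule_value W p v" "tens c ms = tens e p"
proof -
  have pull1: "tens a (ido_lact x s # ys) = tens (a * x) (s # ys)"
    if "a \<in> K" "x \<in> K" "s \<in> M" "ys \<in> lists M" for a x s ys
    using tens_left [of a x s ys] that by simp
  have pull2: "tens a (s # ido_lact x s' # ys) = tens (a * x) (s # s' # ys)"
    if "a \<in> K" "x \<in> K" "s \<in> {symD, symI, symE}" "s' \<in> M" "ys \<in> lists M" for a x s s' ys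
    using tens_middle [of a x "[]" s s' ys] tens_left [of a x s "s' # ys"] that by (auto simp: sym_ract)
  have pull3: "tens a [s, emb f, ido_lact x s'] = tens a [s, emb (f * x), s']"
    if "a \<in> K" "x \<in> K" "s \<in> M" "s' \<in> M" for a x s s' f
    using tens_middle [of a x "[s]" "emb f" s' "[]"] that by (simp add: emb_simps)
  have pullK: "tens a [emb x] = tens (a * x) [emb 1]" if "a \<in> K" "x \<in> K" for a x
    using tens_left [of a x "emb 1" "[]"] that by (simp add: emb_simps)
  have sym: "\<exists>x\<in>K. m = ido_lact x (case w of LD \<Rightarrow> symD | LI \<Rightarrow> symI | LE \<Rightarrow> symE)"
    if "m \<in> component d J w" "w \<in> {LD, LI, LE}" for m w
    using that by auto
  note W = assms(1) [unfolded rule_words_def insert_iff empty_iff]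
  consider "W = [LK]" | "W = [LR, LR]" | "W = [LD, LR]"
    \<comment> \<open>Among the nine pairs of symbols only \<partial> \<partial> and E \<partial>
      are not left sides of rules.\<close>
    | w w' where "W = [w, w']" "w \<in> {LD, LI, LE}" "w' \<in> {LD, LI, LE}" "(w, w') \<noteq> (LD, LD)" "(w, w') \<noteq> (LE, LD)"
    | w w' where "W = [w, LR, w']" "w \<in> {LI, LE}" "w' \<in> {LD, LI, LE}" "w = LE \<Longrightarrow> w' = LE"
    using W by (elim disjE) auto
  then show thesis
  proof cases
    case 1
    then obtain x where "ms = [emb x]" "x \<in> K" using assms(3) by (auto simp: list_all2_Cons2)
    then show thesis using that [OF _ rule_value.K [folded 1], of "c * x"] assms(2) pullK [of c x] by simp
  next
    case 2
    then obtain f g where "ms = [emb f, emb g]" using assms(3) by (auto simp: list_all2_Cons2)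
    then show thesis using that [OF assms(2) rule_value.RR [of f g, folded 2]] by simp
  next
    case 3
    then obtain x f where "ms = [ido_lact x symD, emb f]" "x \<in> K" using assms(3) by (auto simp: list_all2_Cons2)
    then show thesis using that [OF _ rule_value.DR [of f, folded 3], of "c * x"] assms(2) by (simp add: pull1)
  next
    case (4 w w')
    let ?s = "\<lambda>w. case w of LD \<Rightarrow> symD | LI \<Rightarrow> symI | LE \<Rightarrow> symE"
    obtain x y where "ms = [ido_lact x (?s w), ido_lact y (?s w')]" and xy: "x \<in> K" "y \<in> K"
      using assms(3) 4 sym by (auto simp: list_all2_Cons2)
    then have eq: "tens c ms = tens (c * x * y) [?s w, ?s w']"
      using pull1 [of c x "?s w" "[ido_lact y (?s w')]"] pull2 [of "c * x" y "?s w" "?s w'" "[]"] 4 assms(2) by auto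
    have "\<exists>v. rule_value W [?s w, ?s w'] v"
      using 4 by (auto intro: rule_value.intros [THEN exI [of "rule_value V p" for V p]])
    then show thesis using that [OF _ _ eq] xy assms(2) by auto
  next
    case (5 w w')
    let ?s = "\<lambda>w. case w of LD \<Rightarrow> symD | LI \<Rightarrow> symI | LE \<Rightarrow> symE"
    obtain x y f where "ms = [ido_lact x (?s w), emb f, ido_lact y (?s w')]" and xy: "x \<in> K" "y \<in> K"
      using assms(3) 5 sym by (auto simp: list_all2_Cons2)
    then have eq: "tens c ms = tens (c * x) [?s w, emb (f * y), ?s w']"
      using pull1 [of c x "?s w" "[emb f, ido_lact y (?s w')]"] pull3 [of "c * x" y "?s w" "?s w'" f] 5 assms(2) by auto
    have "\<exists>v. rule_value W [?s w, emb (f * y), ?s w'] v"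
      using 5 by (auto intro: rule_value.intros [THEN exI [of "rule_value V p" for V p]])
    then show thesis using that [OF _ _ eq] xy assms(2) by auto
  qed
qed

end

context ideal
begin

lemma coset_class_mult_cong:
  assumes "coset_class x = coset_class y" "x \<in> carrier R" "y \<in> carrier R" "a \<in> carrier R" "b \<in> carrier R"
  shows "coset_class (a \<otimes> x \<otimes> b) = coset_class (a \<otimes> y \<otimes> b)"
proof -
  have "a \<otimes> (x \<ominus> y) \<otimes> b \<in> I"
    using assms by (intro I_l_closed I_r_closed) (simp_all flip: coset_class_eq_iff)
  then show ?thesis
    using assms by (subst coset_class_eq_iff) (simp_all add: a_minus_def l_distr r_distr l_minus r_minus)
qed

lemma coset_class_mult_cong_left:
  "coset_class x = coset_class y \<Longrightarrow> x \<in> carrier R \<Longrightarrow> y \<in> carrier R \<Longrightarrow> a \<in> carrier R \<Longrightarrow>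
    coset_class (a \<otimes> x) = coset_class (a \<otimes> y)"
  using coset_class_mult_cong [of x y a \<one>] by simp

lemma coset_class_mult_cong_right:
  "coset_class x = coset_class y \<Longrightarrow> x \<in> carrier R \<Longrightarrow> y \<in> carrier R \<Longrightarrow> b \<in> carrier R \<Longrightarrow>
    coset_class (x \<otimes> b) = coset_class (y \<otimes> b)"
  using coset_class_mult_cong [of x y \<one> b] by simp

end

section \<open>Reduction as congruence modulo the operator ideal\<close>

context integro_differential
begin

abbreviation "\<Sigma> \<equiv> ido_rules d J"
abbreviation "red \<equiv> reduction_step d J \<Sigma>"
abbreviation "cls \<equiv> ideal.coset_class opI (TR d)"

sublocale I: ideal opI "TR d"
  by (rule ideal_operator_ideal)

sublocale quotient_rep: operator_rep d J "\<lambda>c xs. cls (tens c xs)"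
  by (rule operator_rep_quotient [OF ideal_operator_ideal operator_relations_subset])

text \<open>The rules that are not among the defining relations were derived from them in
  \<open>operator_rep\<close>; they are taken here with empty context.\<close>

lemma rule_value_sound:
  assumes "rule_value W p v"
  shows "cls (tens 1 p) = cls v"
proof -
  note rules = quotient_rep.rel_one [of 1 "[]" "[]"] quotient_rep.rel_RR [of 1 "[]" "[]"]
    quotient_rep.rel_DR [of 1 "[]" "[]"] quotient_rep.rule_DE [of 1 "[]" "[]"] quotient_rep.rel_DI [of 1 "[]" "[]"]
    quotient_rep.rule_ERE [of 1 "[]" "[]"] quotient_rep.rule_EE [of 1 "[]" "[]"] quotient_rep.rule_EI [of 1 "[]" "[]"]
    quotient_rep.rule_IRD [of 1 "[]" "[]"] quotient_rep.rel_IRE [of 1 "[]" "[]"] quotient_rep.rule_IRI [of 1 "[]" "[]"]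
    quotient_rep.rel_ID [of 1 "[]" "[]"] quotient_rep.rule_IE [of 1 "[]" "[]"] quotient_rep.rule_II [of 1 "[]" "[]"]
  from assms show ?thesis
    by cases (use rules in \<open>simp_all add: I.coset_class_add I.coset_class_diff I.coset_class_zero\<close>)
qed

lemma rule_hom:
  assumes "(W, h) \<in> \<Sigma>"
  shows "x \<in> word_module d J W \<Longrightarrow> h x \<in> carrier (TR d)"
    "x \<in> word_module d J W \<Longrightarrow> y \<in> word_module d J W \<Longrightarrow> h (x \<oplus>\<^bsub>TR d\<^esub> y) = h x \<oplus>\<^bsub>TR d\<^esub> h y"
    "x \<in> word_module d J W \<Longrightarrow> c \<in> K \<Longrightarrow> h (tens c [] \<star> x) = tens c [] \<star> h x"
  using assms unfolding ido_rules_iff bimodule_hom_def TR_lact_def by auto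

lemma rule_hom_zero: "(W, h) \<in> \<Sigma> \<Longrightarrow> h \<zero>\<^bsub>TR d\<^esub> = \<zero>\<^bsub>TR d\<^esub>"
  using rule_hom(2) [of W h "\<zero>\<^bsub>TR d\<^esub>" "\<zero>\<^bsub>TR d\<^esub>"] rule_hom(1) [of W h "\<zero>\<^bsub>TR d\<^esub>"] word_module_zero [of W]
  by (simp add: T.add.r_cancel_one)

lemma rule_hom_minus:
  assumes "(W, h) \<in> \<Sigma>" "x \<in> word_module d J W"
  shows "h (\<ominus>\<^bsub>TR d\<^esub> x) = \<ominus>\<^bsub>TR d\<^esub> h x"
proof -
  have "h (\<ominus>\<^bsub>TR d\<^esub> x) \<oplus>\<^bsub>TR d\<^esub> h x = \<zero>\<^bsub>TR d\<^esub>"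
    using rule_hom(2) [OF assms(1), of "\<ominus>\<^bsub>TR d\<^esub> x" x] assms word_module_minus word_module_closed
    by (simp add: T.l_neg rule_hom_zero)
  then show ?thesis
    using T.minus_equality [of "h (\<ominus>\<^bsub>TR d\<^esub> x)" "h x"] rule_hom(1) [OF assms(1)] assms(2) word_module_minus by simp
qed

text \<open>By \<open>rule_value_cover\<close> and left linearity of \<open>h\<close>, it suffices
  to compare the prescribed values.\<close>

lemma rule_sound:
  assumes "(W, h) \<in> \<Sigma>" "w \<in> word_module d J W"
  shows "cls (h w) = cls w"
proof -
  have "w \<in> word_module d J W \<and> cls (h w) = cls w"
    using assms(2)
  proof (induction rule: word_module_induct)
    case zero
    then show ?case by (simp add: rule_hom_zero [OF assms(1)] word_module_zero)
  next
    case (tens c ms)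
    have W: "W \<in> rule_words" using assms(1) by (simp add: ido_rules_iff)
    obtain e p v where ep: "e \<in> K" "rule_value W p v" "tens c ms = tens e p"
      using rule_value_cover [OF W tens(1,3)] by blast
    have p: "p \<in> lists M" using rule_value_components [OF ep(2)] word_components_M by blast
    have "h (tens 1 p) = v" using assms(1) ep(2) by (simp add: ido_rules_iff)
    moreover have eq: "tens c ms = tens e [] \<star> tens 1 p" using ep p by (simp add: tens_mult)
    ultimately have "h (tens c ms) = tens e [] \<star> v"
      using rule_hom(3) [OF assms(1) rule_value_word_module [OF ep(2)] ep(1)] by simp
    moreover have "cls (tens e [] \<star> tens 1 p) = cls (tens e [] \<star> v)"
      by (rule I.coset_class_mult_cong_left [OF rule_value_sound [OF ep(2)]])
        (use rule_value_closed [OF ep(2)] p ep(1) in simp_all)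
    ultimately have "cls (h (tens c ms)) = cls (tens c ms)"
      using eq by simp
    then show ?case using tens tens_word_module by blast
  next
    case (minus x)
    then show ?case
      by (simp add: rule_hom_minus [OF assms(1)] word_module_minus I.coset_class_minus rule_hom(1) [OF assms(1)])
  next
    case (add x y)
    then show ?case
      by (simp add: rule_hom(2) [OF assms(1)] word_module_add I.coset_class_add rule_hom(1) [OF assms(1)])
  qed
  then show ?thesis by simp
qed

lemma reduction_step_sound:
  assumes "(t, s) \<in> red"
  shows "t \<in> carrier (TR d)" "s \<in> carrier (TR d)" "cls t = cls s"
proof -
  obtain u a w b W h A B where st: "t = u \<oplus>\<^bsub>TR d\<^esub> (a \<star> w \<star> b)" "s = u \<oplus>\<^bsub>TR d\<^esub> (a \<star> h w \<star> b)"
    and W: "(W, h) \<in> \<Sigma>" "w \<in> word_module d J W"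
    and ab: "u \<in> carrier (TR d)" "a \<in> word_module d J A" "b \<in> word_module d J B"
    using assms unfolding reduction_step_def by blast
  note cl = ab(1) ab(2,3) [THEN word_module_closed] W(2) [THEN word_module_closed] rule_hom(1) [OF W]
  show "t \<in> carrier (TR d)" "s \<in> carrier (TR d)" using cl by (simp_all add: st)
  show "cls t = cls s"
    using cl I.coset_class_mult_cong [OF rule_sound [OF W], of a b] by (simp add: st I.coset_class_add)
qed

lemma reduction_sound:
  assumes "(t, s) \<in> red\<^sup>*" "t \<in> carrier (TR d)"
  shows "s \<in> carrier (TR d) \<and> cls t = cls s"
  using assms by (induction rule: rtrancl_induct) (auto dest: reduction_step_sound)

lemma sym_reduction: "sym (red\<^sup>*)"
proof (intro sym_rtrancl symI)
  fix t s assume "(t, s) \<in> red"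
  then obtain u a w b W h A B where st: "t = u \<oplus>\<^bsub>TR d\<^esub> (a \<star> w \<star> b)" "s = u \<oplus>\<^bsub>TR d\<^esub> (a \<star> h w \<star> b)"
    and W: "(W, h) \<in> \<Sigma>" "w \<in> word_module d J W"
    and ab: "u \<in> carrier (TR d)" "a \<in> word_module d J A" "b \<in> word_module d J B"
    unfolding reduction_step_def by blast
  note cl = ab(1) ab(2,3) [THEN word_module_closed] W(2) [THEN word_module_closed] rule_hom(1) [OF W]
  let ?w = "a \<star> w \<star> b" and ?h = "a \<star> h w \<star> b"
  \<comment> \<open>The rule is applied to the negative of \<open>w\<close>. Before the step the
    summand \<open>?w\<close> cancels, which gives \<open>s\<close>; after it the summand
    \<open>?h\<close> cancels, which gives \<open>t\<close>.\<close>
  let ?u = "u \<oplus>\<^bsub>TR d\<^esub> (?w \<oplus>\<^bsub>TR d\<^esub> ?h)"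
  have cl2: "?w \<in> carrier (TR d)" "?h \<in> carrier (TR d)" using cl by simp_all
  have "(?u \<oplus>\<^bsub>TR d\<^esub> (a \<star> (\<ominus>\<^bsub>TR d\<^esub> w) \<star> b), ?u \<oplus>\<^bsub>TR d\<^esub> (a \<star> h (\<ominus>\<^bsub>TR d\<^esub> w) \<star> b)) \<in> red"
    unfolding reduction_step_def using W ab cl2 word_module_minus [OF W(2)] by blast
  moreover have "?u \<oplus>\<^bsub>TR d\<^esub> (a \<star> (\<ominus>\<^bsub>TR d\<^esub> w) \<star> b) = s"
    using cl cl2 by (simp add: st T.r_minus T.l_minus T.a_comm [of ?w ?h] T.a_assoc T.r_neg)
  moreover have "?u \<oplus>\<^bsub>TR d\<^esub> (a \<star> h (\<ominus>\<^bsub>TR d\<^esub> w) \<star> b) = t"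
    using cl cl2 by (simp add: st rule_hom_minus [OF W] T.r_minus T.l_minus T.a_assoc T.r_neg)
  ultimately show "(s, t) \<in> red" by simp
qed

text \<open>Splitting every letter into its four components writes a pure tensor as a sum of tensors
  that belong to single words.\<close>

lemma word_induct [consumes 1, case_names zero word minus add]:
  assumes x: "x \<in> carrier (TR d)" and zero: "P \<zero>\<^bsub>TR d\<^esub>" and word: "\<And>W x. x \<in> word_module d J W \<Longrightarrow> P x"
    and minus: "\<And>x. x \<in> carrier (TR d) \<Longrightarrow> P x \<Longrightarrow> P (\<ominus>\<^bsub>TR d\<^esub> x)"
    and add: "\<And>x y. x \<in> carrier (TR d) \<Longrightarrow> y \<in> carrier (TR d) \<Longrightarrow> P x \<Longrightarrow> P y \<Longrightarrow> P (x \<oplus>\<^bsub>TR d\<^esub> y)"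
  shows "P x"
  using x
proof (induction rule: TRing_induct)
  case (tens c ms)
  have "P (tens c (xs @ ms))" if "in_components xs W" for xs W
    using that tens(2)
  proof (induction ms arbitrary: xs W)
    case Nil
    then show ?case using word [OF tens_word_module [OF tens(1) Nil.prems(1)]] by simp
  next
    case (Cons m ms)
    obtain f x y z where m: "m = (f, x, y, z)" "x \<in> K" "y \<in> K" "z \<in> K"
      using Cons.prems(2) by (cases m) auto
    have xs: "xs \<in> lists M" using Cons.prems(1) word_components_M by blast
    have step: "P (tens c (xs @ n # ms))" if "n \<in> component d J w" for n w
      using Cons.IH [of "xs @ [n]" "W @ [w]"] Cons.prems that by (simp add: list_all2_appendI)
    have "P (tens c (xs @ emb f # ms))" "P (tens c (xs @ ido_lact x symD # ms))"
      "P (tens c (xs @ ido_lact y symI # ms))" "P (tens c (xs @ ido_lact z symE # ms))"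
      using m step [of _ LR] step [of _ LD] step [of _ LI] step [of _ LE] by simp_all
    then show ?case
      using m xs Cons.prems(2) tens(1) by (simp add: ido_decomp tens_slot_add add)
  qed
  from this [of "[]" "[]"] show ?case by simp
next
  case (diff x y)
  then show ?case by (simp add: a_minus_def minus add)
qed (rule zero)

text \<open>Quantification over the outer factors makes it two-sided, and quantification over the
  summand \<open>u\<close> allows reductions to be chained.\<close>

definition reducible_ideal :: "'a ido_tensor set" where
  "reducible_ideal = {x \<in> carrier (TR d). \<forall>a \<in> carrier (TR d). \<forall>b \<in> carrier (TR d). \<forall>u \<in> carrier (TR d).
     (u \<oplus>\<^bsub>TR d\<^esub> (a \<star> x \<star> b), u) \<in> red\<^sup>*}"

text \<open>A chain that removes x, started at u - x + x and read backwards, leads from u - x to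
  u.\<close>

lemma reducible_minus:
  assumes "\<forall>u \<in> carrier (TR d). (u \<oplus>\<^bsub>TR d\<^esub> x, u) \<in> red\<^sup>*" "x \<in> carrier (TR d)" "u \<in> carrier (TR d)"
  shows "(u \<oplus>\<^bsub>TR d\<^esub> \<ominus>\<^bsub>TR d\<^esub> x, u) \<in> red\<^sup>*"
proof -
  have "((u \<oplus>\<^bsub>TR d\<^esub> \<ominus>\<^bsub>TR d\<^esub> x) \<oplus>\<^bsub>TR d\<^esub> x, u \<oplus>\<^bsub>TR d\<^esub> \<ominus>\<^bsub>TR d\<^esub> x) \<in> red\<^sup>*"
    using assms by blast
  then have "(u, u \<oplus>\<^bsub>TR d\<^esub> \<ominus>\<^bsub>TR d\<^esub> x) \<in> red\<^sup>*"
    using assms(2,3) by (simp add: T.a_assoc T.l_neg)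
  then show ?thesis using sym_reduction by (meson symD)
qed

lemma reducible_add:
  assumes "\<forall>u \<in> carrier (TR d). (u \<oplus>\<^bsub>TR d\<^esub> x, u) \<in> red\<^sup>*" "\<forall>u \<in> carrier (TR d). (u \<oplus>\<^bsub>TR d\<^esub> y, u) \<in> red\<^sup>*"
    "x \<in> carrier (TR d)" "y \<in> carrier (TR d)" "u \<in> carrier (TR d)"
  shows "(u \<oplus>\<^bsub>TR d\<^esub> (x \<oplus>\<^bsub>TR d\<^esub> y), u) \<in> red\<^sup>*"
proof -
  have "((u \<oplus>\<^bsub>TR d\<^esub> x) \<oplus>\<^bsub>TR d\<^esub> y, u \<oplus>\<^bsub>TR d\<^esub> x) \<in> red\<^sup>*" "(u \<oplus>\<^bsub>TR d\<^esub> x, u) \<in> red\<^sup>*"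
    using assms by blast+
  then show ?thesis using assms(3-5) by (simp add: T.a_assoc)
qed

lemma ideal_reducible: "ideal reducible_ideal (TR d)"
proof (rule idealI [OF T.ring_axioms])
  show "subgroup reducible_ideal (add_monoid (TR d))"
  proof (rule T.subgroup_add_monoidI)
    show "\<zero>\<^bsub>TR d\<^esub> \<in> reducible_ideal" by (simp add: reducible_ideal_def)
    show "x \<oplus>\<^bsub>TR d\<^esub> y \<in> reducible_ideal" if "x \<in> reducible_ideal" "y \<in> reducible_ideal" for x y
      using that unfolding reducible_ideal_def
      by (auto simp: T.l_distr T.r_distr intro!: reducible_add)
    show "\<ominus>\<^bsub>TR d\<^esub> x \<in> reducible_ideal" if "x \<in> reducible_ideal" for x
      using that unfolding reducible_ideal_def
      by (auto simp: T.l_minus T.r_minus intro!: reducible_minus)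
  qed (auto simp: reducible_ideal_def)
  show "y \<star> x \<in> reducible_ideal" if "x \<in> reducible_ideal" "y \<in> carrier (TR d)" for x y
    using that unfolding reducible_ideal_def by (simp flip: T.m_assoc)
  show "x \<star> y \<in> reducible_ideal" if "x \<in> reducible_ideal" "y \<in> carrier (TR d)" for x y
  proof -
    have "a \<star> (x \<star> y) \<star> b = a \<star> x \<star> (y \<star> b)"
      if "a \<in> carrier (TR d)" "b \<in> carrier (TR d)" for a b
      using that \<open>x \<in> reducible_ideal\<close> \<open>y \<in> carrier (TR d)\<close> by (simp add: reducible_ideal_def T.m_assoc)
    then show ?thesis using that unfolding reducible_ideal_def by simp
  qed
qed

lemma rule_reducible:
  assumes "(W, h) \<in> \<Sigma>" "w \<in> word_module d J W"
  shows "w \<ominus>\<^bsub>TR d\<^esub> h w \<in> reducible_ideal"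
proof -
  note cl = word_module_closed [OF assms(2)] rule_hom(1) [OF assms]
  let ?x = "w \<ominus>\<^bsub>TR d\<^esub> h w"
  have cx: "?x \<in> carrier (TR d)" using cl by simp
  have step: "(u \<oplus>\<^bsub>TR d\<^esub> (a \<star> ?x \<star> b), u) \<in> red\<^sup>*"
    if a: "a \<in> word_module d J A" and b: "b \<in> word_module d J B" and u: "u \<in> carrier (TR d)" for a b u A B
  proof -
    note cab = a [THEN word_module_closed] b [THEN word_module_closed]
    \<comment> \<open>Subtracting the result of the step beforehand makes the step end exactly in
      \<open>u\<close>.\<close>
    let ?u = "u \<ominus>\<^bsub>TR d\<^esub> (a \<star> h w \<star> b)"
    have "?u \<in> carrier (TR d)" using cab cl u by simp
    then have "(?u \<oplus>\<^bsub>TR d\<^esub> (a \<star> w \<star> b), ?u \<oplus>\<^bsub>TR d\<^esub> (a \<star> h w \<star> b)) \<in> red"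
      unfolding reduction_step_def using assms a b by blast
    moreover have "?u \<oplus>\<^bsub>TR d\<^esub> (a \<star> h w \<star> b) = u"
      using cab cl u by (simp add: a_minus_def T.a_assoc T.l_neg)
    moreover have "?u \<oplus>\<^bsub>TR d\<^esub> (a \<star> w \<star> b) = u \<oplus>\<^bsub>TR d\<^esub> (a \<star> ?x \<star> b)"
      using cab cl u by (simp add: a_minus_def T.a_ac T.l_distr T.r_distr T.l_minus T.r_minus)
    ultimately show ?thesis by simp
  qed
  \<comment> \<open>A step only allows outer factors from single word modules; additivity removes
    this restriction, for \<open>a\<close> here and for \<open>b\<close> afterwards.\<close>
  have step_a: "\<forall>u\<in>carrier (TR d). (u \<oplus>\<^bsub>TR d\<^esub> (a \<star> ?x \<star> b), u) \<in> red\<^sup>*"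
    if b: "b \<in> word_module d J B" and a: "a \<in> carrier (TR d)" for a b B
    using a
  proof (induction rule: word_induct)
    case (word W a)
    then show ?case using step b by blast
  next
    case (minus a)
    then show ?case using cx word_module_closed [OF b] reducible_minus by (simp add: T.l_minus)
  next
    case (add a a')
    then show ?case using cx word_module_closed [OF b] reducible_add by (simp add: T.l_distr)
  qed (use cx word_module_closed [OF b] in simp)
  have "\<forall>u\<in>carrier (TR d). (u \<oplus>\<^bsub>TR d\<^esub> (a \<star> ?x \<star> b), u) \<in> red\<^sup>*"
    if a: "a \<in> carrier (TR d)" and b: "b \<in> carrier (TR d)" for a b
    using b
  proof (induction rule: word_induct)
    case (word W b)
    then show ?case using step_a a by blast
  next
    case (minus b)
    then show ?case using cx a reducible_minus by (simp add: T.r_minus)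
  next
    case (add b b')
    then show ?case using cx a reducible_add by (simp add: T.r_distr)
  qed (use cx a in simp)
  then show ?thesis using cx by (simp add: reducible_ideal_def)
qed

text \<open>Six relations compare the two sides of a rule. For \<partial> f E the rules DR and DE
  are combined, and for E f E the rule K turns the scalar ev f into a ring element.\<close>

lemma operator_ideal_reducible: "opI \<subseteq> reducible_ideal"
  unfolding operator_ideal_def
proof (rule T.genideal_minimal [OF ideal_reducible], rule subsetI)
  interpret Y: ideal reducible_ideal "TR d" by (rule ideal_reducible)
  have rv: "Y.coset_class (tens 1 p) = Y.coset_class v" if v: "rule_value W p v" for W p v
  proof -
    obtain h where h: "(W, h) \<in> \<Sigma>" using rule_exists [OF rule_value_words [OF v]] by blast
    have "h (tens 1 p) = v" using h v by (simp add: ido_rules_iff)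
    then have "tens 1 p \<ominus>\<^bsub>TR d\<^esub> v \<in> reducible_ideal"
      using rule_reducible [OF h rule_value_word_module [OF v]] by simp
    then show ?thesis
      using rule_value_closed [OF v] word_module_closed [OF rule_value_word_module [OF v]]
      by (simp add: Y.coset_class_eq_iff)
  qed
  note vals = rule_value.intros [THEN rv]
  have DRE: "Y.coset_class (tens 1 [symD, emb f, symE]) = Y.coset_class (tens 1 [emb (d f), symE])" for f
  proof -
    have "Y.coset_class (tens 1 [symD, emb f] \<star> tens 1 [symE]) =
        Y.coset_class ((tens 1 [emb f, symD] \<oplus>\<^bsub>TR d\<^esub> tens 1 [emb (d f)]) \<star> tens 1 [symE])"
      by (rule Y.coset_class_mult_cong_right) (simp_all add: vals)
    moreover have "Y.coset_class (tens 1 [emb f] \<star> tens 1 [symD, symE]) = Y.coset_class (tens 1 [emb f] \<star> \<zero>\<^bsub>TR d\<^esub>)"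
      by (rule Y.coset_class_mult_cong_left) (simp_all add: vals)
    ultimately show ?thesis
      by (simp add: T.l_distr tens_mult Y.coset_class_add Y.coset_class_zero)
  qed
  have ERE: "Y.coset_class (tens 1 [symE, emb f, symE]) = Y.coset_class (tens 1 [emb (ev f), symE])" for f
  proof -
    have "Y.coset_class (tens (ev f) [] \<star> tens 1 [emb 1] \<star> tens 1 [symE]) =
        Y.coset_class (tens (ev f) [] \<star> tens 1 [] \<star> tens 1 [symE])"
      by (rule Y.coset_class_mult_cong) (simp_all add: vals)
    then show ?thesis
      using tens_left [of 1 "ev f" "emb 1" "[symE]"] tens_left [of 1 "ev f" symE "[]"] vals(6) [of f]
      by (simp add: tens_mult emb_simps)
  qed
  fix x assume x: "x \<in> operator_relations d J"
  then have "Y.coset_class x = 0"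
    unfolding operator_relations_def one_tens
    by (elim UnE CollectE exE singletonE conjE)
      (simp_all add: Y.coset_class_diff Y.coset_class_add DRE ERE vals)
  then show "x \<in> reducible_ideal"
    using x operator_relations_closed by (simp add: Y.coset_class_eq_0_iff subset_iff)
qed

lemma reduction_iff:
  assumes "t \<in> carrier (TR d)" "s \<in> carrier (TR d)"
  shows "(t, s) \<in> red\<^sup>* \<longleftrightarrow> cls t = cls s"
proof
  assume "(t, s) \<in> red\<^sup>*"
  then show "cls t = cls s" using reduction_sound assms(1) by blast
next
  assume "cls t = cls s"
  then have "t \<ominus>\<^bsub>TR d\<^esub> s \<in> reducible_ideal"
    using assms operator_ideal_reducible by (auto simp: I.coset_class_eq_iff)
  then have "(s \<oplus>\<^bsub>TR d\<^esub> (\<one>\<^bsub>TR d\<^esub> \<star> (t \<ominus>\<^bsub>TR d\<^esub> s) \<star> \<one>\<^bsub>TR d\<^esub>), s) \<in> red\<^sup>*"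
    using assms(2) unfolding reducible_ideal_def by blast
  moreover have "s \<oplus>\<^bsub>TR d\<^esub> (\<one>\<^bsub>TR d\<^esub> \<star> (t \<ominus>\<^bsub>TR d\<^esub> s) \<star> \<one>\<^bsub>TR d\<^esub>) = t"
    using assms by (simp add: a_minus_def T.a_comm [of t] T.r_neg T.a_assoc [symmetric])
  ultimately show "(t, s) \<in> red\<^sup>*" by simp
qed

end

section \<open>Irreducible words\<close>

context integro_differential
begin

abbreviation "irreducible \<equiv> irreducible_word \<Sigma>"

lemma irreducible_iff:
  "irreducible V \<longleftrightarrow> V \<in> lists base_letters \<and> (\<forall>W \<in> rule_words. \<forall>U \<in> specializations W. \<not> sublist U V)"
proof -
  have "(\<exists>h. (W, h) \<in> \<Sigma>) \<longleftrightarrow> W \<in> rule_words" for W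
    using rule_exists ido_rules_iff by metis
  then show ?thesis
    unfolding irreducible_word_def by blast
qed

lemma specializations_simps:
  "specializations [] = {[]}"
  "specializations (w # W) = (\<Union>v \<in> (if w = LR then {LK, LRt} else {w}). (#) v ` specializations W)"
  unfolding specializations_def by (auto simp: list_all2_Cons2)

text \<open>The specialized left sides without the letter \<open>LK\<close>; words with
  \<open>LK\<close> are reducible by the rule K anyway.\<close>

definition forbidden :: "letter list set" where
  "forbidden = {[LRt, LRt], [LD, LRt], [LD, LE], [LD, LI], [LE, LRt, LE], [LE, LE], [LE, LI],
     [LI, LRt, LD], [LI, LRt, LE], [LI, LRt, LI], [LI, LD], [LI, LE], [LI, LI]}"

lemma forbidden_subset: "forbidden \<subseteq> (\<Union>W \<in> rule_words. specializations W)"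
  by (simp add: forbidden_def rule_words_def specializations_simps)

lemma specialization_cases:
  assumes "U \<in> specializations W" "W \<in> rule_words"
  shows "LK \<in> set U \<or> U \<in> forbidden"
proof -
  have "W = [LK] \<or> W = [LR, LR] \<or> W = [LD, LR] \<or> W = [LD, LE] \<or> W = [LD, LI] \<or> W = [LE, LR, LE] \<or> W = [LE, LE] \<or>
    W = [LE, LI] \<or> W = [LI, LR, LD] \<or> W = [LI, LR, LE] \<or> W = [LI, LR, LI] \<or> W = [LI, LD] \<or> W = [LI, LE] \<or> W = [LI, LI]"
    using assms(2) unfolding rule_words_def by blast
  then show ?thesis
    using assms(1)
    by (elim disjE; hypsubst; simp add: specializations_simps forbidden_def; elim disjE; hypsubst; simp)
qed

lemma irreducible_iff_forbidden:
  "irreducible V \<longleftrightarrow> set V \<subseteq> {LRt, LD, LI, LE} \<and> (\<forall>U \<in> forbidden. \<not> sublist U V)"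
proof
  assume irr: "irreducible V"
  have "LK \<notin> set V"
  proof
    assume "LK \<in> set V"
    then have "sublist [LK] V" by (auto simp: sublist_def in_set_conv_decomp)
    moreover have "[LK] \<in> rule_words" "[LK] \<in> specializations [LK]"
      by (simp_all add: rule_words_def specializations_simps)
    ultimately show False using irr unfolding irreducible_iff by blast
  qed
  then have "set V \<subseteq> {LRt, LD, LI, LE}"
    using irr by (auto simp: irreducible_iff base_letters_def in_lists_conv_set)
  moreover have "\<forall>U \<in> forbidden. \<not> sublist U V"
    using irr forbidden_subset unfolding irreducible_iff by blast
  ultimately show "set V \<subseteq> {LRt, LD, LI, LE} \<and> (\<forall>U \<in> forbidden. \<not> sublist U V)" by blast
next
  assume R: "set V \<subseteq> {LRt, LD, LI, LE} \<and> (\<forall>U \<in> forbidden. \<not> sublist U V)"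
  have "\<not> sublist U V" if "W \<in> rule_words" "U \<in> specializations W" for U W
    using specialization_cases [OF that(2,1)] R set_mono_sublist [of U V] by auto
  moreover have "V \<in> lists base_letters"
    using R by (auto simp: base_letters_def in_lists_conv_set)
  ultimately show "irreducible V" by (simp add: irreducible_iff)
qed

lemma irreducible_Cons: "irreducible (v # V) \<Longrightarrow> irreducible V"
  by (auto simp: irreducible_iff_forbidden sublist_Cons_right)

lemma irreducible_letters: "irreducible (v # V) \<Longrightarrow> v = LRt \<or> v = LD \<or> v = LI \<or> v = LE"
  by (auto simp: irreducible_iff_forbidden)

lemma irreducible_no_prefix: "irreducible V \<Longrightarrow> U \<in> forbidden \<Longrightarrow> \<not> prefix U V"
  by (auto simp: irreducible_iff_forbidden dest: prefix_imp_sublist)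

text \<open>Every letter other than \<open>LD\<close> behind \<open>LD\<close> completes a forbidden
  word.\<close>

lemma irreducible_D: "irreducible (LD # V) \<Longrightarrow> \<exists>j. V = replicate j LD"
proof (induction V)
  case (Cons v V)
  then have "v = LD"
    using irreducible_letters [OF irreducible_Cons [OF Cons.prems]]
      irreducible_no_prefix [OF Cons.prems, of "[LD, v]"] by (auto simp: forbidden_def)
  with Cons obtain j where "V = replicate j LD" using irreducible_Cons by blast
  then have "v # V = replicate (Suc j) LD" using \<open>v = LD\<close> by simp
  then show ?case by blast
qed (auto intro: exI [of _ 0])

text \<open>Only \<open>LRt\<close> may follow \<open>LI\<close>, and each letter behind these two
  completes a forbidden word.\<close>

lemma irreducible_I:
  assumes "irreducible (LI # V)"
  shows "V = [] \<or> V = [LRt]"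
proof (cases V)
  case (Cons v V')
  then have v: "v = LRt"
    using irreducible_letters [of v V'] irreducible_Cons assms
      irreducible_no_prefix [OF assms, of "[LI, v]"] by (auto simp: forbidden_def)
  have "V' = []"
  proof (rule ccontr)
    assume "V' \<noteq> []"
    then obtain w W where w: "V' = w # W" by (cases V') auto
    then show False
      using assms Cons v irreducible_letters [of w W] irreducible_Cons
        irreducible_no_prefix [OF assms, of "[LI, LRt, w]"]
        irreducible_no_prefix [OF irreducible_Cons [OF assms], of "[LRt, w]"] by (auto simp: forbidden_def)
  qed
  then show ?thesis using Cons v by simp
qed simp

text \<open>\<open>LE\<close> may be followed by \<open>LD\<close> or \<open>LRt\<close>, and
  \<open>LE\<close>, \<open>LRt\<close> by \<open>LD\<close> or \<open>LI\<close>; what comes then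
  is known from the previous two lemmas.\<close>

lemma irreducible_E:
  assumes "irreducible (LE # V)"
  shows "(\<exists>g j. g \<in> {[], [LRt]} \<and> V = g @ replicate j LD) \<or> (\<exists>g. g \<in> {[], [LRt]} \<and> V = LRt # LI # g)"
proof (cases V)
  case Nil
  then show ?thesis by (auto intro!: exI [of _ "[]"] exI [of _ 0])
next
  case (Cons v V')
  have irrV: "irreducible (v # V')" using assms Cons irreducible_Cons by blast
  have "v = LD \<or> v = LRt"
    using irreducible_letters [OF irrV] irreducible_no_prefix [OF assms, of "[LE, v]"] Cons
    by (auto simp: forbidden_def)
  then show ?thesis
  proof
    assume v: "v = LD"
    then obtain j where "V' = replicate j LD" using irreducible_D irrV by blast
    then have "V = [] @ replicate (Suc j) LD" using Cons v by simp
    then show ?thesis by blast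
  next
    assume v: "v = LRt"
    show ?thesis
    proof (cases V')
      case Nil
      then have "V = [LRt] @ replicate 0 LD" using Cons v by simp
      then show ?thesis by blast
    next
      fix w W assume w: "V' = w # W"
      have irrW: "irreducible (w # W)" using irrV w irreducible_Cons by blast
      have "w = LD \<or> w = LI"
        using irreducible_letters [OF irrW] irreducible_no_prefix [OF assms, of "[LE, LRt, w]"]
          irreducible_no_prefix [OF irrV, of "[LRt, w]"] Cons v w
        by (auto simp: forbidden_def)
      then show ?thesis
      proof
        assume "w = LD"
        then obtain j where "W = replicate j LD" using irreducible_D irrW by blast
        then have "V = [LRt] @ replicate (Suc j) LD" using Cons v w \<open>w = LD\<close> by simp
        then show ?thesis by blast
      next
        assume "w = LI"
        then have "W = [] \<or> W = [LRt]" using irreducible_I irrW by blast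
        then show ?thesis using Cons v w \<open>w = LI\<close> by auto
      qed
    qed
  qed
qed

inductive_set standard_shapes :: "letter list set" where
  D: "f \<in> {[], [LRt]} \<Longrightarrow> f @ replicate j LD \<in> standard_shapes"
| I: "f \<in> {[], [LRt]} \<Longrightarrow> g \<in> {[], [LRt]} \<Longrightarrow> f @ LI # g \<in> standard_shapes"
| E: "f \<in> {[], [LRt]} \<Longrightarrow> g \<in> {[], [LRt]} \<Longrightarrow> f @ LE # g @ replicate j LD \<in> standard_shapes"
| EI: "f \<in> {[], [LRt]} \<Longrightarrow> g \<in> {[], [LRt]} \<Longrightarrow> f @ LE # LRt # LI # g \<in> standard_shapes"

text \<open>An optional leading \<open>LRt\<close> is split off; the rest starts with another
  letter, whose possible continuations are known.\<close>

lemma irreducible_standard: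
  assumes "irreducible V"
  shows "V \<in> standard_shapes"
proof -
  have head: "f @ V \<in> standard_shapes"
    if V: "irreducible V" "V = [] \<or> hd V \<noteq> LRt" and f: "f \<in> {[], [LRt]}" for f V
  proof (cases V)
    case Nil
    then show ?thesis using standard_shapes.D [OF f, of 0] by simp
  next
    case (Cons v V')
    then consider "v = LD" | "v = LI" | "v = LE" using V irreducible_letters by auto
    then show ?thesis
    proof cases
      case 1
      then obtain j where "V' = replicate j LD" using V Cons irreducible_D by blast
      then show ?thesis using standard_shapes.D [OF f, of "Suc j"] Cons 1 by simp
    next
      case 2
      then have "V' \<in> {[], [LRt]}" using V Cons irreducible_I by auto
      then show ?thesis using standard_shapes.I [OF f] Cons 2 by simp
    next
      case 3
      then have "(\<exists>g j. g \<in> {[], [LRt]} \<and> V' = g @ replicate j LD) \<or> (\<exists>g. g \<in> {[], [LRt]} \<and> V' = LRt # LI # g)"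
        using V Cons irreducible_E by blast
      then show ?thesis using standard_shapes.E [OF f] standard_shapes.EI [OF f] Cons 3 by blast
    qed
  qed
  show ?thesis
  proof (cases V)
    case (Cons v V')
    show ?thesis
    proof (cases "v = LRt")
      case True
      have "V' = [] \<or> hd V' \<noteq> LRt"
        using irreducible_no_prefix [OF assms, of "[LRt, LRt]"] Cons True by (cases V') (auto simp: forbidden_def)
      then show ?thesis using head [of V' "[LRt]"] Cons True assms irreducible_Cons by simp
    next
      case False
      then show ?thesis using head [of V "[]"] Cons assms by simp
    qed
  qed (use head [of "[]" "[]"] assms in simp)
qed

text \<open>Concrete words can thus be tested letter by letter, comparing forbidden words with
  prefixes only.\<close>

lemma irreducible_Cons_iff:
  "irreducible (v # V) \<longleftrightarrow> irreducible V \<and> v \<in> {LRt, LD, LI, LE} \<and> (\<forall>U \<in> forbidden. \<not> prefix U (v # V))"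
  unfolding irreducible_iff_forbidden by (auto simp only: sublist_Cons_right set_simps insert_subset)

lemma standard_irreducible:
  assumes "V \<in> standard_shapes"
  shows "irreducible V"
proof -
  have prefix: "prefix (x # U) (replicate j v) \<longleftrightarrow> j > 0 \<and> x = v \<and> prefix U (replicate (j - 1) v)" for x U j and v :: letter
    by (cases j) auto
  have "irreducible []"
    by (auto simp: irreducible_iff_forbidden forbidden_def)
  moreover have "irreducible (replicate j LD)" for j
    by (induction j) (simp_all add: irreducible_Cons_iff forbidden_def prefix \<open>irreducible []\<close>)
  ultimately have irr: "irreducible []" "irreducible (replicate j LD)" for j by blast+
  from assms show ?thesis
    by cases (elim insertE emptyE; hypsubst; simp add: irreducible_Cons_iff irr; simp add: forbidden_def prefix)+
qed

lemma standard_word_shape: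
  assumes "w \<in> standard_words"
  obtains V where "V \<in> standard_shapes" "in_components w V"
proof -
  define shape where "shape f = (if f = [] then [] else [LRt])" for f :: "'a ido list"
  have f: "shape f \<in> {[], [LRt]}" "in_components f (shape f)" if "f \<in> absent_or J" for f
    using that by (cases rule: absent_or_cases; simp add: shape_def)+
  have symD: "in_components (replicate j symD) (replicate j LD)" for j
    by (induction j) (simp_all del: component.simps)
  have J: "emb (J h) \<in> component d J LRt" for h by simp
  from assms show thesis
  proof cases
    case (D f j)
    show thesis
      by (rule that [OF standard_shapes.D [OF f(1) [OF D(2)], of j]])
        (simp add: D(1) list_all2_appendI f(2) [OF D(2)] symD)
  next
    case (I f g)
    show thesis
      by (rule that [OF standard_shapes.I [OF f(1) [OF I(2)] f(1) [OF I(3)]]])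
        (simp add: I(1) list_all2_appendI f(2) [OF I(2)] f(2) [OF I(3)] del: component.simps)
  next
    case (E f g j)
    show thesis
      by (rule that [OF standard_shapes.E [OF f(1) [OF E(2)] f(1) [OF E(3)], of j]])
        (simp add: E(1) list_all2_appendI f(2) [OF E(2)] f(2) [OF E(3)] symD del: component.simps)
  next
    case (EI f g h)
    show thesis
      by (rule that [OF standard_shapes.EI [OF f(1) [OF EI(2)] f(1) [OF EI(3)]]])
        (simp add: EI(1) list_all2_appendI f(2) [OF EI(2)] f(2) [OF EI(3)] J del: component.simps)
  qed
qed

text \<open>In contrast to \<open>component\<close>, the symbols carry no constant factor here, as
  in the standard tensors.\<close>

definition bare :: "'a ido \<Rightarrow> letter \<Rightarrow> bool" where
  "bare m v \<longleftrightarrow> (v = LRt \<and> m \<in> emb ` range J) \<or> (v = LD \<and> m = symD) \<or> (v = LI \<and> m = symI) \<or> (v = LE \<and> m = symE)"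

lemma bare_letters:
  "bare m LRt \<longleftrightarrow> (\<exists>f. m = emb (J f))" "bare m LD \<longleftrightarrow> m = symD" "bare m LI \<longleftrightarrow> m = symI" "bare m LE \<longleftrightarrow> m = symE"
  by (auto simp: bare_def)

lemma bare_component: "bare m v \<Longrightarrow> m \<in> component d J v"
  unfolding bare_def using component_generators by auto

text \<open>The constants are collected from right to left: the scalar of the normalized tail acts
  on the letter before it and is passed on.\<close>

lemma bare_normalize:
  assumes "in_components ms V" "set V \<subseteq> {LRt, LD, LI, LE}"
  shows "\<exists>e\<in>K. \<exists>ns. list_all2 bare ns V \<and> tens 1 ms = tens e ns"
  using assms
proof (induction rule: list_all2_induct)
  case Nil
  show ?case by (auto intro!: bexI [of _ 1])
next
  case (Cons m ms v V)
  then obtain e ns where e: "e \<in> K" "list_all2 bare ns V" "tens 1 ms = tens e ns" by auto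
  have ms: "ms \<in> lists M" using Cons.hyps(2) word_components_M by blast
  have "in_components ns V"
    using e(2) by (rule list_all2_mono) (rule bare_component)
  then have ns: "ns \<in> lists M" using word_components_M by blast
  have m: "m \<in> M" using Cons.hyps(1) component_M by blast
  have "tens 1 (m # ms) = tens 1 [m] \<star> tens 1 ms" using m ms by (simp add: tens_mult_one)
  also have "\<dots> = tens 1 (ido_ract m e # ns)" using m ns e by (simp add: tens_mult)
  finally have eq: "tens 1 (m # ms) = tens 1 (ido_ract m e # ns)" .
  \<comment> \<open>A symbol lets the constant pass to its left. A factor J f absorbs it as J (f e),
    and the scalar 1 is passed on.\<close>
  have "\<exists>e'\<in>K. \<exists>n. bare n v \<and> ido_ract m e = ido_lact e' n"
    using Cons.hyps(1)
  proof (cases rule: component_cases)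
    case (LRt f)
    then show ?thesis using J_const(2) [OF e(1), of f, symmetric]
      by (intro bexI [of _ 1] exI [of _ "emb (J (f * e))"]) (auto simp: bare_def emb_simps)
  next
    case (LD c)
    then show ?thesis using e(1)
      by (intro bexI [of _ "c * e"] exI [of _ symD]) (auto simp: bare_def ract_lact_sym)
  next
    case (LI c)
    then show ?thesis using e(1)
      by (intro bexI [of _ "c * e"] exI [of _ symI]) (auto simp: bare_def ract_lact_sym)
  next
    case (LE c)
    then show ?thesis using e(1)
      by (intro bexI [of _ "c * e"] exI [of _ symE]) (auto simp: bare_def ract_lact_sym)
  qed (use Cons.prems in auto)
  then obtain e' n where n: "e' \<in> K" "bare n v" "ido_ract m e = ido_lact e' n" by blast
  have "tens 1 (m # ms) = tens e' (n # ns)"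
    using eq n tens_left [of 1 e' n ns] ns component_M [OF bare_component [OF n(2)]] by simp
  then show ?case using n(1,2) e(2) by (intro bexI [of _ e'] exI [of _ "n # ns"]) auto
qed

lemma bare_standard:
  assumes "list_all2 bare ns V" "V \<in> standard_shapes"
  shows "ns \<in> standard_words"
proof -
  have f: "g \<in> absent_or J" if "list_all2 bare g f" "f \<in> {[], [LRt]}" for f g
    using that by (auto simp: list_all2_Cons2 bare_def absent_or_def)
  have symD: "g = replicate j symD" if "list_all2 bare g (replicate j LD)" for g j
    using that by (induction j arbitrary: g) (auto simp: list_all2_Cons2 bare_def)
  from assms(2) show ?thesis
  proof cases
    case (D f' j)
    then obtain us vs where "ns = us @ vs" "list_all2 bare us f'" "list_all2 bare vs (replicate j LD)"
      using assms(1) by (auto simp: list_all2_append2)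
    then show ?thesis using D(2) f symD standard_words.D by metis
  next
    case (I f' g')
    obtain us vs where ns: "ns = us @ symI # vs" "list_all2 bare us f'" "list_all2 bare vs g'"
      using assms(1) unfolding I(1) list_all2_append2 list_all2_Cons2 bare_letters by blast
    show ?thesis
      unfolding ns(1) by (intro standard_words.I f [OF ns(2) I(2)] f [OF ns(3) I(3)])
  next
    case (E f' g' j)
    obtain us vs ws where ns: "ns = us @ symE # vs @ ws" "list_all2 bare us f'" "list_all2 bare vs g'"
        "list_all2 bare ws (replicate j LD)"
      using assms(1) unfolding E(1) list_all2_append2 list_all2_Cons2 bare_letters by blast
    show ?thesis
      unfolding ns(1) symD [OF ns(4)] by (intro standard_words.E f [OF ns(2) E(2)] f [OF ns(3) E(3)])
  next
    case (EI f' g')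
    obtain us h vs where ns: "ns = us @ symE # emb (J h) # symI # vs" "list_all2 bare us f'" "list_all2 bare vs g'"
      using assms(1) unfolding EI(1) list_all2_append2 list_all2_Cons2 bare_letters by blast
    show ?thesis
      unfolding ns(1) by (intro standard_words.EI f [OF ns(2) EI(2)] f [OF ns(3) EI(3)])
  qed
qed

text \<open>Irreducible words are exactly the shapes of standard words, and
  \<open>bare_normalize\<close> removes the constants by which tensors of such a shape differ from
  standard ones.\<close>

lemma irr_span: "irr d J \<Sigma> = T.span standard_tens"
proof
  let ?S = "\<Union>V \<in> {V. irreducible V}. word_module d J V"
  have S: "?S \<subseteq> carrier (TR d)" using word_module_closed by blast
  have irr: "irr d J \<Sigma> = T.span ?S" by (simp add: irr_def T.span_def)
  show "irr d J \<Sigma> \<subseteq> T.span standard_tens"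
  proof
    fix x assume "x \<in> irr d J \<Sigma>"
    then have "x \<in> T.span ?S" by (simp add: irr)
    then show "x \<in> T.span standard_tens"
    proof (rule T.span_mono_subgroup [OF _ _ standard_tens_closed], intro subsetI)
      fix y assume "y \<in> ?S"
      then obtain V where V: "irreducible V" "y \<in> word_module d J V" by blast
      from V(2) show "y \<in> T.span standard_tens"
      proof (induction rule: word_module_induct)
        case (tens c ms)
        obtain e ns where e: "e \<in> K" "list_all2 bare ns V" "tens 1 ms = tens e ns"
          using bare_normalize [OF tens(3)] V(1) irreducible_iff_forbidden by blast
        have ns: "ns \<in> standard_words" by (rule bare_standard [OF e(2) irreducible_standard [OF V(1)]])
        have "tens c ms = tens c [] \<star> tens 1 ms" using tens by (simp add: tens_mult)
        also have "\<dots> = tens (c * e) ns" using tens e ns by (simp add: tens_mult standard_words_M)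
        moreover have "tens (c * e) ns \<in> standard_tens"
          unfolding standard_tens_def using tens(1) e(1) ns K_mult by blast
        ultimately show ?case by (simp add: T.span_incl)
      qed (simp_all add: T.span_zero T.span_add T.span_minus [OF standard_tens_closed])
    qed
  qed
  show "T.span standard_tens \<subseteq> irr d J \<Sigma>"
  proof
    fix x assume "x \<in> T.span standard_tens"
    then show "x \<in> irr d J \<Sigma>"
      unfolding irr
    proof (rule T.span_mono_subgroup [OF _ _ S], intro subsetI)
      fix y assume "y \<in> standard_tens"
      then obtain c w where w: "y = tens c w" "c \<in> K" "w \<in> standard_words" by (auto simp: standard_tens_def)
      obtain V where "V \<in> standard_shapes" "in_components w V"
        using standard_word_shape [OF w(3)] by blast
      then show "y \<in> T.span ?S"
        using w by (auto intro!: T.span_incl intro: standard_irreducible tens_word_module)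
    qed
  qed
qed

end

section \<open>Normal forms and the operator ring\<close>

text \<open>If scalars act by multiplication with the image of a unital homomorphism
  \<open>i\<close>, the bimodule laws follow from the ring axioms.\<close>

lemma K_ringI:
  fixes A :: "('b, 'c) ring_scheme" (structure) and K :: "'k::ring_1 set"
  assumes "ring A" "\<one> \<noteq> \<zero>"
    and i: "\<And>c. c \<in> K \<Longrightarrow> i c \<in> carrier A" "i 1 = \<one>"
      "\<And>c e. c \<in> K \<Longrightarrow> e \<in> K \<Longrightarrow> i (c + e) = i c \<oplus> i e" "\<And>c e. c \<in> K \<Longrightarrow> e \<in> K \<Longrightarrow> i (c * e) = i c \<otimes> i e"
    and l: "\<And>c x. c \<in> K \<Longrightarrow> x \<in> carrier A \<Longrightarrow> l c x = i c \<otimes> x"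
    and r: "\<And>c x. c \<in> K \<Longrightarrow> x \<in> carrier A \<Longrightarrow> r x c = x \<otimes> i c"
    and K: "1 \<in> K" "\<And>c e. c \<in> K \<Longrightarrow> e \<in> K \<Longrightarrow> c + e \<in> K" "\<And>c e. c \<in> K \<Longrightarrow> e \<in> K \<Longrightarrow> c * e \<in> K"
  shows "K_ring K A l r"
proof -
  interpret ring A by fact
  show ?thesis
    unfolding K_ring_def using assms(1,2)
    by (simp add: i l r K l_distr r_distr m_assoc)
qed

section \<open>Uniqueness of normal forms\<close>

context integro_differential
begin

lemma irr_closed: "x \<in> irr d J \<Sigma> \<Longrightarrow> x \<in> carrier (TR d)"
  unfolding irr_span by (rule T.span_closed [OF standard_tens_closed])

lemma irr_unique:
  assumes "x \<in> irr d J \<Sigma>" "y \<in> irr d J \<Sigma>" "cls x = cls y"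
  shows "x = y"
proof -
  have xy: "x \<in> carrier (TR d)" "y \<in> carrier (TR d)" using assms irr_closed by blast+
  have "x \<ominus>\<^bsub>TR d\<^esub> y \<in> T.span standard_tens"
    using assms(1,2) unfolding irr_span by (rule T.span_diff [OF standard_tens_closed])
  moreover have "x \<ominus>\<^bsub>TR d\<^esub> y \<in> opI" using assms(3) xy by (simp add: I.coset_class_eq_iff)
  ultimately have "x \<ominus>\<^bsub>TR d\<^esub> y = \<zero>\<^bsub>TR d\<^esub>" by (rule standard_independent)
  moreover have "x = (x \<ominus>\<^bsub>TR d\<^esub> y) \<oplus>\<^bsub>TR d\<^esub> y" using xy by (simp add: a_minus_def T.a_assoc T.l_neg)
  ultimately show ?thesis using xy by simp
qed

lemma normal_form_iff:
  "t \<in> carrier (TR d) \<Longrightarrow> normal_form d J \<Sigma> t s \<longleftrightarrow> s \<in> irr d J \<Sigma> \<and> cls t = cls s"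
  unfolding normal_form_def using irr_closed reduction_iff by blast

lemma normal_form_unique:
  assumes "t \<in> carrier (TR d)"
  shows "\<exists>!s. normal_form d J \<Sigma> t s"
proof -
  obtain s where s: "s \<in> irr d J \<Sigma>" "t \<ominus>\<^bsub>TR d\<^esub> s \<in> opI"
    using standard_decomposition [OF assms] unfolding irr_span by blast
  then have "cls t = cls s" using assms irr_closed by (simp add: I.coset_class_eq_iff)
  then show ?thesis
    using s irr_unique by (auto simp: normal_form_iff [OF assms])
qed

lemma nf_props:
  assumes "t \<in> carrier (TR d)"
  shows "nf d J \<Sigma> t \<in> irr d J \<Sigma>" "cls (nf d J \<Sigma> t) = cls t"
proof -
  have "normal_form d J \<Sigma> t (nf d J \<Sigma> t)"
    unfolding nf_def by (rule theI' [OF normal_form_unique [OF assms]])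
  then show "nf d J \<Sigma> t \<in> irr d J \<Sigma>" "cls (nf d J \<Sigma> t) = cls t"
    by (simp_all only: normal_form_iff [OF assms])
qed

lemma nf_eqI:
  "t \<in> carrier (TR d) \<Longrightarrow> s \<in> irr d J \<Sigma> \<Longrightarrow> cls t = cls s \<Longrightarrow> nf d J \<Sigma> t = s"
  using nf_props [of t] irr_unique by simp

lemma nf_closed: "t \<in> carrier (TR d) \<Longrightarrow> nf d J \<Sigma> t \<in> carrier (TR d)"
  using nf_props(1) irr_closed by blast

lemma nf_irr: "s \<in> irr d J \<Sigma> \<Longrightarrow> nf d J \<Sigma> s = s"
  by (rule nf_eqI) (simp_all add: irr_closed)

lemma nf_cong:
  "x \<in> carrier (TR d) \<Longrightarrow> y \<in> carrier (TR d) \<Longrightarrow> cls x = cls y \<Longrightarrow> nf d J \<Sigma> x = nf d J \<Sigma> y"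
  by (rule nf_eqI) (simp_all add: nf_props)

lemma irr_add: "x \<in> irr d J \<Sigma> \<Longrightarrow> y \<in> irr d J \<Sigma> \<Longrightarrow> x \<oplus>\<^bsub>TR d\<^esub> y \<in> irr d J \<Sigma>"
  unfolding irr_span by (rule T.span_add)

lemma irr_const: "c \<in> K \<Longrightarrow> tens c [] \<in> irr d J \<Sigma>"
  unfolding irr_span standard_tens_def using standard_words.D [of "[]" 0] by (intro T.span_incl) auto

lemma irr_word_module:
  "x \<in> irr d J \<Sigma> \<longleftrightarrow> x \<in> T.span (\<Union>V \<in> {V. irreducible V}. word_module d J V)"
  by (simp add: irr_def T.span_def)

text \<open>The description by word modules is used because these are closed under constants on both
  sides, whereas standard tensors only carry scalars on the left.\<close>

lemma irr_const_mult:
  assumes "x \<in> irr d J \<Sigma>" "c \<in> K"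
  shows "tens c [] \<star> x \<in> irr d J \<Sigma>" "x \<star> tens c [] \<in> irr d J \<Sigma>"
proof -
  let ?S = "\<Union>V \<in> {V. irreducible V}. word_module d J V"
  have S: "?S \<subseteq> carrier (TR d)" using word_module_closed by blast
  have "tens c [] \<star> x \<in> T.span ?S \<and> x \<star> tens c [] \<in> T.span ?S"
    using assms(1) [unfolded irr_word_module] S
  proof (induction rule: T.span_induct)
    case (incl x)
    then obtain V where V: "irreducible V" "x \<in> word_module d J V" by blast
    have "tens c [] \<star> x \<in> ?S" "x \<star> tens c [] \<in> ?S"
      using V(1) word_module_lact [OF V(2) assms(2)] word_module_ract [OF V(2) assms(2)] by blast+
    then show ?case by (intro conjI T.span_incl)
  qed (use assms(2) in \<open>simp_all add: T.span_zero T.span_add T.span_minus [OF S] T.l_minus T.r_minus T.l_distr T.r_distr\<close>)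
  then show "tens c [] \<star> x \<in> irr d J \<Sigma>" "x \<star> tens c [] \<in> irr d J \<Sigma>"
    by (simp_all only: irr_word_module)
qed

lemma irr_left_span:
  assumes "x \<in> irr d J \<Sigma>"
  shows "x \<in> left_span d (standard_tensors d J)"
proof -
  let ?T = "{TR_lact d c x | c x. c \<in> K \<and> x \<in> standard_tensors d J}"
  have std: "tens 1 w \<in> standard_tensors d J" if "w \<in> standard_words" for w
    using that unfolding standard_tensors_def
  proof cases
    case (EI f g h)
    have "w = f @ [symE, emb (J h), symI] @ g" "J h \<in> range J" using EI by simp_all
    then show "tens 1 w \<in> {pure_tensor d (f @ replicate j symD) |f j. f \<in> absent_or J} \<union>
       {pure_tensor d (f @ [symI] @ g) |f g. f \<in> absent_or J \<and> g \<in> absent_or J} \<union>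
       {pure_tensor d (f @ [symE] @ g @ replicate j symD) |f g j. f \<in> absent_or J \<and> g \<in> absent_or J} \<union>
       {pure_tensor d (f @ [symE, emb h, symI] @ g) |f g h. f \<in> absent_or J \<and> g \<in> absent_or J \<and> h \<in> range J}"
      using EI(2,3) by blast
  qed auto
  have T: "?T \<subseteq> carrier (TR d)"
  proof
    fix y assume "y \<in> ?T"
    then obtain c x where y: "y = TR_lact d c x" "c \<in> K" "x \<in> standard_tensors d J" by blast
    have "x \<in> carrier (TR d)"
      using y(3) unfolding standard_tensors_def by (elim UnE CollectE exE conjE) (simp_all add: absent_or_M)
    then show "y \<in> carrier (TR d)" using y by (simp add: TR_lact_def)
  qed
  have "standard_tens \<subseteq> ?T"
  proof
    fix y assume "y \<in> standard_tens"
    then obtain c w where w: "y = tens c w" "c \<in> K" "w \<in> standard_words" by (auto simp: standard_tens_def)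
    then have "y = TR_lact d c (tens 1 w)" by (simp add: TR_lact_def tens_mult standard_words_M)
    then show "y \<in> ?T" using w std by blast
  qed
  then have "x \<in> T.span ?T"
    using assms unfolding irr_span by (intro T.span_mono_subgroup [OF _ _ T]) (auto intro: T.span_incl)
  then show ?thesis by (simp add: left_span_def T.span_def)
qed

section \<open>The isomorphism with the operator ring\<close>

abbreviation "A \<equiv> operator_ring d J"
abbreviation "B \<equiv> irr_ring d J \<Sigma>"
abbreviation "q \<equiv> (+>\<^bsub>TR d\<^esub>) opI"

lemma q_hom: "q \<in> ring_hom (TR d) A"
  unfolding operator_ring_def by (rule I.rcos_ring_hom)

lemma q_surj: "X \<in> carrier A \<Longrightarrow> \<exists>x \<in> carrier (TR d). X = q x"
  unfolding operator_ring_def FactRing_def by (auto simp: A_RCOSETS_defs a_r_coset_def)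

lemma ring_A: "ring A"
  unfolding operator_ring_def by (rule I.quotient_is_ring)

text \<open>The choice of representative does not matter, because normal forms depend on the class
  alone (\<open>nf_class_q\<close>).\<close>

definition nf_class :: "'a ido_tensor set \<Rightarrow> 'a ido_tensor" where
  "nf_class X = nf d J \<Sigma> (SOME x. x \<in> carrier (TR d) \<and> X = q x)"

lemma q_eq_iff: "x \<in> carrier (TR d) \<Longrightarrow> y \<in> carrier (TR d) \<Longrightarrow> q x = q y \<longleftrightarrow> cls x = cls y"
  using T.quotient_eq_iff_same_a_r_cos [OF ideal_operator_ideal] by (simp add: I.coset_class_eq_iff)

lemma nf_class_q: "x \<in> carrier (TR d) \<Longrightarrow> nf_class (q x) = nf d J \<Sigma> x"
proof -
  assume x: "x \<in> carrier (TR d)"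
  define y where "y = (SOME y. y \<in> carrier (TR d) \<and> q x = q y)"
  have y: "y \<in> carrier (TR d) \<and> q x = q y"
    unfolding y_def by (rule someI [of _ x]) (use x in simp)
  then have "nf d J \<Sigma> y = nf d J \<Sigma> x"
    using x q_eq_iff nf_props by (intro nf_eqI) auto
  then show ?thesis by (simp add: nf_class_def flip: y_def)
qed

lemma B_simps [simp]:
  "carrier B = irr d J \<Sigma>" "x \<otimes>\<^bsub>B\<^esub> y = nf d J \<Sigma> (x \<star> y)" "x \<oplus>\<^bsub>B\<^esub> y = x \<oplus>\<^bsub>TR d\<^esub> y"
  "\<one>\<^bsub>B\<^esub> = \<one>\<^bsub>TR d\<^esub>" "\<zero>\<^bsub>B\<^esub> = \<zero>\<^bsub>TR d\<^esub>"
  by (simp_all add: irr_ring_def)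

text \<open>Multiplicativity holds because x y and the product of the two normal forms are congruent
  and so have the same normal form.\<close>

lemma nf_class_iso: "nf_class \<in> ring_iso A B"
proof (rule ring_iso_memI)
  fix X Y assume "X \<in> carrier A" "Y \<in> carrier A"
  then obtain x y where xy: "x \<in> carrier (TR d)" "X = q x" "y \<in> carrier (TR d)" "Y = q y"
    using q_surj by blast
  note n = nf_props [OF xy(1)] nf_props [OF xy(3)] nf_closed [OF xy(1)] nf_closed [OF xy(3)]
  show "nf_class X \<in> carrier B" using xy n by (simp add: nf_class_q)
  have "X \<otimes>\<^bsub>A\<^esub> Y = q (x \<star> y)" using ring_hom_mult [OF q_hom] xy by simp
  moreover have "cls (x \<star> y) = cls (nf d J \<Sigma> x \<star> nf d J \<Sigma> y)"
    using I.coset_class_mult_cong_right [of x "nf d J \<Sigma> x" y]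
      I.coset_class_mult_cong_left [of y "nf d J \<Sigma> y" "nf d J \<Sigma> x"] xy n by simp
  ultimately show "nf_class (X \<otimes>\<^bsub>A\<^esub> Y) = nf_class X \<otimes>\<^bsub>B\<^esub> nf_class Y"
    using xy n nf_cong [of "x \<star> y" "nf d J \<Sigma> x \<star> nf d J \<Sigma> y"] by (simp add: nf_class_q)
  have "X \<oplus>\<^bsub>A\<^esub> Y = q (x \<oplus>\<^bsub>TR d\<^esub> y)" using ring_hom_add [OF q_hom] xy by simp
  then show "nf_class (X \<oplus>\<^bsub>A\<^esub> Y) = nf_class X \<oplus>\<^bsub>B\<^esub> nf_class Y"
    using xy n nf_eqI [of "x \<oplus>\<^bsub>TR d\<^esub> y" "nf d J \<Sigma> x \<oplus>\<^bsub>TR d\<^esub> nf d J \<Sigma> y"]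
    by (simp add: nf_class_q I.coset_class_add irr_add)
next
  have "\<one>\<^bsub>A\<^esub> = q \<one>\<^bsub>TR d\<^esub>" using ring_hom_one [OF q_hom] by simp
  then show "nf_class \<one>\<^bsub>A\<^esub> = \<one>\<^bsub>B\<^esub>"
    using irr_const [of 1] by (simp add: nf_class_q one_tens nf_irr)
next
  show "bij_betw nf_class (carrier A) (carrier B)"
  proof (rule bij_betwI')
    fix X Y assume "X \<in> carrier A" "Y \<in> carrier A"
    then obtain x y where xy: "x \<in> carrier (TR d)" "X = q x" "y \<in> carrier (TR d)" "Y = q y"
      using q_surj by blast
    show "nf_class X = nf_class Y \<longleftrightarrow> X = Y"
      using xy nf_props(2) [OF xy(1)] nf_props(2) [OF xy(3)] nf_cong [OF xy(1,3)]
      by (simp add: nf_class_q q_eq_iff) metis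
  next
    fix X assume "X \<in> carrier A"
    then obtain x where "x \<in> carrier (TR d)" "X = q x" using q_surj by blast
    then show "nf_class X \<in> carrier B" using nf_props(1) by (simp add: nf_class_q)
  next
    fix s assume "s \<in> carrier B"
    then have s: "s \<in> irr d J \<Sigma>" "s \<in> carrier (TR d)" using irr_closed by simp_all
    then have "s = nf_class (q s)" by (simp add: nf_class_q nf_eqI)
    then show "\<exists>X\<in>carrier A. s = nf_class X" using ring_hom_closed [OF q_hom s(2)] by blast
  qed
qed

text \<open>The coordinate product for the empty word reads off the part of degree 0, where 1 and 0
  differ.\<close>

lemma one_neq_zero: "\<one>\<^bsub>TR d\<^esub> \<noteq> \<zero>\<^bsub>TR d\<^esub>"
proof -
  obtain h where h: "\<And>x y. x \<in> carrier (TR d) \<Longrightarrow> y \<in> carrier (TR d) \<Longrightarrow> h (x \<oplus>\<^bsub>TR d\<^esub> y) = h x + h y"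
    "\<And>c ms. c \<in> K \<Longrightarrow> ms \<in> lists M \<Longrightarrow> h (tens c ms) = c * word_prod [] ms"
    by (rule word_prod_extend) (rule that)
  have "h \<one>\<^bsub>TR d\<^esub> = 1" "h \<zero>\<^bsub>TR d\<^esub> = 0"
    using T.additive_map(1) [of h, OF h(1)] by (simp_all add: one_tens h(2))
  then show ?thesis by auto
qed

text \<open>The ring axioms, associativity in particular, are transported along
  \<open>nf_class\<close> instead of being checked on normal forms.\<close>

lemma ring_B: "ring B"
proof -
  \<comment> \<open>The transported ring has the image of zero as its zero, which has to be
    identified with the zero of \<open>B\<close>.\<close>
  have "\<zero>\<^bsub>A\<^esub> = q \<zero>\<^bsub>TR d\<^esub>" using ring_hom_zero [OF q_hom T.ring_axioms ring_A] by simp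
  then have "nf_class \<zero>\<^bsub>A\<^esub> = \<zero>\<^bsub>TR d\<^esub>"
    using T.span_zero [of standard_tens] by (simp add: nf_class_q nf_irr irr_span)
  then show ?thesis
    using ring.ring_iso_imp_img_ring [OF ring_A nf_class_iso] by (simp add: irr_ring_def)
qed

text \<open>Products of a constant and an irreducible tensor are irreducible, so on \<open>B\<close>
  the actions of the tensor ring agree with multiplication in \<open>B\<close>.\<close>

lemma K_ring_B: "K_ring K B (TR_lact d) (TR_ract d)"
proof (rule K_ringI [where i = "\<lambda>c. tens c []"])
  show "ring B" by (rule ring_B)
  show "\<one>\<^bsub>B\<^esub> \<noteq> \<zero>\<^bsub>B\<^esub>" using one_neq_zero by simp
  show "tens (c * e) [] = tens c [] \<otimes>\<^bsub>B\<^esub> tens e []" if "c \<in> K" "e \<in> K" for c e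
    using that by (simp add: tens_mult nf_irr irr_const)
  show "TR_lact d c x = tens c [] \<otimes>\<^bsub>B\<^esub> x" "TR_ract d x c = x \<otimes>\<^bsub>B\<^esub> tens c []" if "c \<in> K" "x \<in> carrier B" for c x
    using that irr_const_mult [of x c] irr_closed by (simp_all add: TR_lact_def TR_ract_def nf_irr)
qed (simp_all add: irr_const tens_scalar_add one_tens)

lemma K_ring_A: "K_ring K A (operator_lact d J) (operator_ract d J)"
proof (rule K_ringI [where i = "\<lambda>c. q (tens c [])"])
  show "ring A" by (rule ring_A)
  show "\<one>\<^bsub>A\<^esub> \<noteq> \<zero>\<^bsub>A\<^esub>"
  proof
    assume "\<one>\<^bsub>A\<^esub> = \<zero>\<^bsub>A\<^esub>"
    then have "nf_class (q \<one>\<^bsub>TR d\<^esub>) = nf_class (q \<zero>\<^bsub>TR d\<^esub>)"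
      using ring_hom_one [OF q_hom] ring_hom_zero [OF q_hom T.ring_axioms ring_A] by simp
    then show False
      using one_neq_zero irr_const [of 1] T.span_zero [of standard_tens]
      by (simp add: nf_class_q nf_irr one_tens irr_span)
  qed
  show "q (tens (c * e) []) = q (tens c []) \<otimes>\<^bsub>A\<^esub> q (tens e [])" if "c \<in> K" "e \<in> K" for c e
    using ring_hom_mult [OF q_hom, of "tens c []" "tens e []"] that by (simp add: tens_mult)
qed (use ring_hom_closed [OF q_hom] ring_hom_one [OF q_hom] ring_hom_add [OF q_hom] in
    \<open>simp_all add: tens_scalar_add operator_lact_def operator_ract_def flip: one_tens\<close>)

lemma K_ring_isomorphic_operator_ring:
  "K_ring_isomorphic K A (operator_lact d J) (operator_ract d J) B (TR_lact d) (TR_ract d)"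
  unfolding K_ring_isomorphic_def
proof (intro conjI K_ring_A K_ring_B bexI [OF _ nf_class_iso] ballI)
  fix c X assume c: "c \<in> K" and "X \<in> carrier A"
  then obtain x where x: "x \<in> carrier (TR d)" "X = q x" using q_surj by blast
  note n = nf_props [OF x(1)] nf_closed [OF x(1)]
  have "operator_lact d J c X = q (tens c [] \<star> x)" "operator_ract d J X c = q (x \<star> tens c [])"
    using ring_hom_mult [OF q_hom] x c by (simp_all add: operator_lact_def operator_ract_def)
  then show "nf_class (operator_lact d J c X) = TR_lact d c (nf_class X)"
      "nf_class (operator_ract d J X c) = TR_ract d (nf_class X) c"
    using x c n I.coset_class_mult_cong_left [of x "nf d J \<Sigma> x" "tens c []"]
      I.coset_class_mult_cong_right [of x "nf d J \<Sigma> x" "tens c []"]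
      nf_eqI [of "tens c [] \<star> x" "tens c [] \<star> nf d J \<Sigma> x"]
      nf_eqI [of "x \<star> tens c []" "nf d J \<Sigma> x \<star> tens c []"]
    by (simp_all add: nf_class_q TR_lact_def TR_ract_def irr_const_mult)
qed

end

theorem theoremA3:
  fixes d J :: "'a::ring_1 \<Rightarrow> 'a"
  assumes "integro_differential_ring d J"
  shows "(\<forall>t \<in> carrier (TR d).
            (\<exists>!s. normal_form d J (ido_rules d J) t s) \<and>
            nf d J (ido_rules d J) t \<in> left_span d (standard_tensors d J)) \<and>
         K_ring_isomorphic (constants d)
           (operator_ring d J) (operator_lact d J) (operator_ract d J)
           (irr_ring d J (ido_rules d J)) (TR_lact d) (TR_ract d)"
proof -
  interpret integro_differential d J by unfold_locales (rule assms)
  show ?thesis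
    using normal_form_unique nf_props(1) irr_left_span K_ring_isomorphic_operator_ring by blast
qed

end
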